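(* Let $e_p=p-p_{\tau,h}$ be the pressure error, where $(\boldsymbol u,p)$ is the solution of the nonstationary Stokes system and $p_{\tau,h}$ is any pressure trajectory of the discrete scheme (G), and let $\boldsymbol e^{\boldsymbol u}_{\tau,h}=\widehat{\boldsymbol u}_{\tau,h}-\boldsymbol u_{\tau,h}$. Then there is a constant $C>0$, independent of the mesh sizes in space and time, such that for all $n=1,\dots,N$ $$\sum_{m=1}^n\tau_m\|e_p(\bar t_m)\|^2\le C\big(\|\nabla\boldsymbol e^{\boldsymbol u}_{\tau,h}(0)\|^2+\tau^4+h^{2r}\big).$$
   Context: Let $d\in\{2,3\}$, $\Omega\subset\mathbb R^d$ an open bounded domain, $T>0$, $I=(0,T]$, $\overline I=[0,T]$; $\langle\cdot,\cdot\rangle$ and $\|\cdot\|$ are the inner product and norm of $L^2(\Omega)$ (scalar-, vector- or matrix-valued), $\|\cdot\|_m$ the norm of $H^m(\Omega)$. $\boldsymbol V=H^1_0(\Omega)^d$, $Q=\{q\in L^2(\Omega):\int_\Omega q\,dx=0\}$, $\boldsymbol V^{\mathrm{div}}=\{\boldsymbol v\in\boldsymbol V:\langle\nabla\cdot\boldsymbol v,q\rangle=0\ \forall q\in Q\}$. Time mesh: $0=t_0<\dots<t_N=T$, $I_n=(t_{n-1},t_n]$, $\tau_n=t_n-t_{n-1}$, $\tau=\max_n\tau_n$, $\bar t_n=(t_{n-1}+t_n)/2$. $\mathbb P_k(J;B)$: $B$-valued polynomials in $t\in J$ of degree at most $k$. $w^+$ denotes right-sided limits. Continuous problem: $\partial_t\boldsymbol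 u-\Delta\boldsymbol u+\nabla p=\boldsymbol f$, $\nabla\cdot\boldsymbol u=0$ in $\Omega\times(0,T]$, $\boldsymbol u(0)=\boldsymbol u_0$ in $\Omega$, $\boldsymbol u=\boldsymbol 0$ on $\partial\Omega\times[0,T]$, with $\boldsymbol u(t)\in\boldsymbol V^{\mathrm{div}}$, $p(t)\in Q$. Standing assumptions: the solution is sufficiently regular up to $t=0$, i.e. $\boldsymbol u\in C^k(\overline I;H^k(\Omega)^d)$, $p\in C^k(\overline I;H^k(\Omega))$ for a sufficiently large $k$ depending only on $r$ (and $\boldsymbol f$ is correspondingly regular); the stationary Stokes problem on $\Omega$ is $H^2$-regular, i.e. for every $\boldsymbol g\in L^2(\Omega)^d$ the solution $(\boldsymbol w,s)\in\boldsymbol V\times Q$ of $-\Delta\boldsymbol w+\nabla s=\boldsymbol g$, $\nabla\cdot\boldsymbol w=0$ lies in $H^2\times H^1$ and $\|\boldsymbol w\|_2+\|s\|_1\le C\|\boldsymbol g\|$. Constants $C$ are independent of $h$ and of the time mesh, but may depend on $T$, the data (including $\Omega$), the solution $(\boldsymbol u,p)$, the shape regularity of the space meshes, and the polynomial degree in space. Finite elements: $\{\mathcal T_h\}$ is a shape-regular family of meshes of $\Omega$ with mesh size $h$, and $\boldsymbol V_h=\{\boldsymbol v\in\boldsymbol V:\boldsymbol v|_K\in\boldsymbol V(K)\ \forall K\in\mathcal T_h\}$, $Q_h=\{q\in Q:q|_K\in Q(K)\ \forall K\in\mathcal T_h\}$ with local spaces of mapped polynomials of uniformly bounded degree. Assumption: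 with $\beta$ independent of $h$, $0<\beta\le\inf_{q_h\in Q_h\setminus\{0\}}\sup_{\boldsymbol v_h\in\boldsymbol V_h\setminus\{0\}}\frac{-\langle\nabla\cdot\boldsymbol v_h,q_h\rangle}{\|\boldsymbol v_h\|_1\|q_h\|}$; and for $\boldsymbol v\in\boldsymbol V\cap H^{r+1}(\Omega)^d$, $q\in Q\cap H^r(\Omega)$ there are $i_h\boldsymbol v\in\boldsymbol V_h$, $j_hq\in Q_h$ with $\|\boldsymbol v-i_h\boldsymbol v\|+h\|\nabla(\boldsymbol v-i_h\boldsymbol v)\|\le Ch^{r+1}\|\boldsymbol v\|_{r+1}$, $\|q-j_hq\|\le Ch^r\|q\|_r$. $\boldsymbol V_h^{\mathrm{div}}=\{\boldsymbol v_h\in\boldsymbol V_h:\langle\nabla\cdot\boldsymbol v_h,q_h\rangle=0\ \forall q_h\in Q_h\}$. Operators: $\langle A_h\boldsymbol u,\boldsymbol v_h\rangle=\langle\nabla\boldsymbol u,\nabla\boldsymbol v_h\rangle$, $\langle B_h\boldsymbol v,q_h\rangle=-\langle\nabla\cdot\boldsymbol v,q_h\rangle$, $\langle B_h'q,\boldsymbol v_h\rangle=-\langle\nabla\cdot\boldsymbol v_h,q\rangle$. Scheme (G): let $\boldsymbol u_{\tau,h}(0)=\boldsymbol u_{0,h}\in\boldsymbol V_h^{\mathrm{div}}$ be an approximation of $\boldsymbol u_0$. Successively for $n=1,\dots,N$, $(\boldsymbol u_{\tau,h},p_{\tau,h})|_{I_n}\in\mathbb P_1(I_n;\boldsymbol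 V_h)\times\mathbb P_1(I_n;Q_h)$ satisfies $\boldsymbol u_{\tau,h}^+(t_{n-1})=\boldsymbol u_{\tau,h}(t_{n-1})$ and $$\int_{I_n}\langle\partial_t\boldsymbol u_{\tau,h}+A_h\boldsymbol u_{\tau,h}+B_h'p_{\tau,h},\boldsymbol v_h\rangle dt=\tfrac{\tau_n}{2}\langle\boldsymbol f(t_{n-1})+\boldsymbol f(t_n),\boldsymbol v_h\rangle,\qquad\int_{I_n}\langle B_h\boldsymbol u_{\tau,h},q_h\rangle dt=0$$ for all $(\boldsymbol v_h,q_h)\in\boldsymbol V_h\times Q_h$. The velocity $\boldsymbol u_{\tau,h}$ and the values $p_{\tau,h}(\bar t_n)$ are uniquely determined, while $p^+_{\tau,h}(t_{n-1})\in Q_h$ is arbitrary; $p_{\tau,h}$ denotes any of the resulting pressure solutions. Interpolants: the Stokes projection $R_h(\boldsymbol w,s)=(R_h^{\boldsymbol u}(\boldsymbol w,s),R_h^p(\boldsymbol w,s))=(\widehat{\boldsymbol w}_h,\widehat s_h)\in\boldsymbol V_h\times Q_h$ of $(\boldsymbol w,s)\in\boldsymbol V^{\mathrm{div}}\times Q$ is defined by $\langle A_h\widehat{\boldsymbol w}_h+B_h'\widehat s_h,\boldsymbol v_h\rangle=\langle A_h\boldsymbol w+B_h's,\boldsymbol v_h\rangle$ and $\langle B_h\widehat{\boldsymbol w}_h,q_h\rangle=0$ for all $\boldsymbol v_h\in\boldsymbol V_h$, $q_h\in Q_h$. For continuous $v$ on $\overline I$, $R^1_\tau v$ is given on each $I_n$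 by the polynomial of degree at most 1 in $t$ with value $v(t_{n-1})$ at $t_{n-1}$ and time derivative at $\bar t_n$ equal to that of the quadratic Lagrange interpolant of $v$ at $t_{n-1},\bar t_n,t_n$; $R^1_\tau v(0)=v(0)$. Set $\widehat{\boldsymbol u}_{\tau,h}=R_h^{\boldsymbol u}(R^1_\tau\boldsymbol u,R^1_\tau p)$. *)

theory Defs
  imports "HOL-Analysis.Analysis"
begin

section \<open>Lebesgue and Sobolev spaces on a domain\<close>

text \<open>
  Elements of function spaces are represented by functions on the whole of \<open>\<real>\<^sup>d\<close>; only their
  values almost everywhere in \<open>\<Omega>\<close> matter, and all notions below respect equality a.e. in \<open>\<Omega>\<close>.
  The codomain \<open>'b\<close> covers the scalar-, vector- and matrix-valued case at once
  (on matrices the library inner product is the Frobenius product).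
\<close>

definition bounded_domain :: "('a::euclidean_space) set \<Rightarrow> bool" where
  "bounded_domain \<Omega> \<longleftrightarrow> open \<Omega> \<and> connected \<Omega> \<and> bounded \<Omega> \<and> \<Omega> \<noteq> {}"

definition L2 :: "('a::euclidean_space) set \<Rightarrow> ('a \<Rightarrow> 'b::euclidean_space) set" where
  "L2 \<Omega> = {f. f \<in> borel_measurable (lebesgue_on \<Omega>) \<and> integrable (lebesgue_on \<Omega>) (\<lambda>x. (norm (f x))\<^sup>2)}"

definition L2_inner :: "('a::euclidean_space) set \<Rightarrow> ('a \<Rightarrow> 'b::euclidean_space) \<Rightarrow> ('a \<Rightarrow> 'b) \<Rightarrow> real" where
  "L2_inner \<Omega> f g = (LINT x|lebesgue_on \<Omega>. f x \<bullet> g x)"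

definition L2_norm :: "('a::euclidean_space) set \<Rightarrow> ('a \<Rightarrow> 'b::euclidean_space) \<Rightarrow> real" where
  "L2_norm \<Omega> f = sqrt (L2_inner \<Omega> f f)"

definition partial_deriv :: "'d \<Rightarrow> (real^'d \<Rightarrow> 'b::euclidean_space) \<Rightarrow> real^'d \<Rightarrow> 'b" where
  "partial_deriv i f x = frechet_derivative f (at x) (axis i 1)"

definition partials :: "'d list \<Rightarrow> (real^'d \<Rightarrow> 'b::euclidean_space) \<Rightarrow> real^'d \<Rightarrow> 'b" where
  "partials is f = foldr partial_deriv is f"

primrec C_diff :: "nat \<Rightarrow> (real^'d \<Rightarrow> 'b::euclidean_space) \<Rightarrow> bool" where
  "C_diff 0 = (\<lambda>f. continuous_on UNIV f)"
| "C_diff (Suc k) = (\<lambda>f. (\<forall>x. f differentiable (at x)) \<and> (\<forall>i. C_diff k (partial_deriv i f)))"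

definition test_functions :: "(real^'d) set \<Rightarrow> (real^'d \<Rightarrow> 'b::euclidean_space) set" where
  "test_functions \<Omega> = {\<phi>. (\<forall>k. C_diff k \<phi>) \<and>
     compact (closure {x. \<phi> x \<noteq> 0}) \<and> closure {x. \<phi> x \<noteq> 0} \<subseteq> \<Omega>}"

definition is_weak_deriv ::
    "(real^'d) set \<Rightarrow> 'd list \<Rightarrow> (real^'d \<Rightarrow> 'b::euclidean_space) \<Rightarrow> (real^'d \<Rightarrow> 'b) \<Rightarrow> bool" where
  "is_weak_deriv \<Omega> is v g \<longleftrightarrow>
     (\<forall>\<phi>\<in>test_functions \<Omega>.
        (LINT x|lebesgue_on \<Omega>. (partials is \<phi> x :: real) *\<^sub>R v x) =
        (-1) ^ length is *\<^sub>R (LINT x|lebesgue_on \<Omega>. \<phi> x *\<^sub>R g x))"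

text \<open>Determined up to a null set whenever a weak derivative in \<open>L\<^sup>2\<close> exists.\<close>

definition weak_deriv ::
    "(real^'d) set \<Rightarrow> 'd list \<Rightarrow> (real^'d \<Rightarrow> 'b::euclidean_space) \<Rightarrow> real^'d \<Rightarrow> 'b" where
  "weak_deriv \<Omega> is v = (SOME g. g \<in> L2 \<Omega> \<and> is_weak_deriv \<Omega> is v g)"

definition H_space :: "(real^'d) set \<Rightarrow> nat \<Rightarrow> (real^'d \<Rightarrow> 'b::euclidean_space) set" where
  "H_space \<Omega> m = {v \<in> L2 \<Omega>. \<forall>is. length is \<le> m \<longrightarrow> (\<exists>g\<in>L2 \<Omega>. is_weak_deriv \<Omega> is v g)}"

text \<open>
  \<open>\<parallel>v\<parallel>\<^sub>m\<^sup>2\<close> is the sum over \<open>j \<le> m\<close> of \<open>\<parallel>\<nabla>\<^sup>j v\<parallel>\<^sup>2\<close>, with the Euclidean norm of the tensor \<open>\<nabla>\<^sup>j v\<close>;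
  its entries are indexed by the lists of length \<open>j\<close>.
\<close>

definition H_norm :: "(real^'d) set \<Rightarrow> nat \<Rightarrow> (real^'d \<Rightarrow> 'b::euclidean_space) \<Rightarrow> real" where
  "H_norm \<Omega> m v = sqrt (\<Sum>is | length is \<le> m. (L2_norm \<Omega> (weak_deriv \<Omega> is v))\<^sup>2)"

definition H10 :: "(real^'d) set \<Rightarrow> (real^'d \<Rightarrow> 'b::euclidean_space) set" where
  "H10 \<Omega> = {v \<in> H_space \<Omega> 1. \<forall>\<epsilon>>0. \<exists>\<phi>\<in>test_functions \<Omega>. H_norm \<Omega> 1 (\<lambda>x. v x - \<phi> x) < \<epsilon>}"

definition gradient :: "(real^'d) set \<Rightarrow> (real^'d \<Rightarrow> real) \<Rightarrow> real^'d \<Rightarrow> real^'d" where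
  "gradient \<Omega> q x = (\<chi> i. weak_deriv \<Omega> [i] q x)"

definition Jacobian :: "(real^'d) set \<Rightarrow> (real^'d \<Rightarrow> real^'d) \<Rightarrow> real^'d \<Rightarrow> real^'d^'d" where
  "Jacobian \<Omega> v x = (\<chi> i j. weak_deriv \<Omega> [j] v x $ i)"

definition divergence :: "(real^'d) set \<Rightarrow> (real^'d \<Rightarrow> real^'d) \<Rightarrow> real^'d \<Rightarrow> real" where
  "divergence \<Omega> v x = (\<Sum>i\<in>UNIV. weak_deriv \<Omega> [i] v x $ i)"

definition Laplacian :: "(real^'d) set \<Rightarrow> (real^'d \<Rightarrow> real^'d) \<Rightarrow> real^'d \<Rightarrow> real^'d" where
  "Laplacian \<Omega> v x = (\<Sum>i\<in>UNIV. weak_deriv \<Omega> [i, i] v x)"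


section \<open>The Stokes problem\<close>

definition V_space :: "(real^'d) set \<Rightarrow> (real^'d \<Rightarrow> real^'d) set" where
  "V_space \<Omega> = H10 \<Omega>"

definition Q_space :: "(real^'d) set \<Rightarrow> (real^'d \<Rightarrow> real) set" where
  "Q_space \<Omega> = {q \<in> L2 \<Omega>. (LINT x|lebesgue_on \<Omega>. q x) = 0}"

definition V_div :: "(real^'d) set \<Rightarrow> (real^'d \<Rightarrow> real^'d) set" where
  "V_div \<Omega> = {v \<in> V_space \<Omega>. \<forall>q\<in>Q_space \<Omega>. L2_inner \<Omega> (divergence \<Omega> v) q = 0}"

text \<open>
  The pairings \<open>\<langle>A\<^sub>h u, v\<rangle>\<close>, \<open>\<langle>B\<^sub>h v, q\<rangle>\<close> and \<open>\<langle>B\<^sub>h' q, v\<rangle>\<close>; the last two have the same value \<open>b_form \<Omega> v q\<close>.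
\<close>

definition a_form :: "(real^'d) set \<Rightarrow> (real^'d \<Rightarrow> real^'d) \<Rightarrow> (real^'d \<Rightarrow> real^'d) \<Rightarrow> real" where
  "a_form \<Omega> u v = L2_inner \<Omega> (Jacobian \<Omega> u) (Jacobian \<Omega> v)"

definition b_form :: "(real^'d) set \<Rightarrow> (real^'d \<Rightarrow> real^'d) \<Rightarrow> (real^'d \<Rightarrow> real) \<Rightarrow> real" where
  "b_form \<Omega> v q = - L2_inner \<Omega> (divergence \<Omega> v) q"

definition stationary_solution ::
    "(real^'d) set \<Rightarrow> (real^'d \<Rightarrow> real^'d) \<Rightarrow> (real^'d \<Rightarrow> real^'d) \<Rightarrow> (real^'d \<Rightarrow> real) \<Rightarrow> bool" where
  "stationary_solution \<Omega> g w s \<longleftrightarrow> w \<in> V_div \<Omega> \<and> s \<in> Q_space \<Omega> \<and>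
     (\<forall>v\<in>V_space \<Omega>. a_form \<Omega> w v + b_form \<Omega> v s = L2_inner \<Omega> g v)"

definition Stokes_H2_regular :: "(real^'d) set \<Rightarrow> bool" where
  "Stokes_H2_regular \<Omega> \<longleftrightarrow>
     (\<exists>C. \<forall>g\<in>L2 \<Omega>.
        (\<exists>w s. stationary_solution \<Omega> g w s) \<and>
        (\<forall>w s. stationary_solution \<Omega> g w s \<longrightarrow>
           w \<in> H_space \<Omega> 2 \<and> s \<in> H_space \<Omega> 1 \<and>
           H_norm \<Omega> 2 w + H_norm \<Omega> 1 s \<le> C * L2_norm \<Omega> g))"

text \<open>\<open>w \<in> C\<^sup>k([0,T]; H\<^sup>m(\<Omega>))\<close>; \<open>W j\<close> is the \<open>j\<close>-th time derivative, one-sided at the end points.\<close>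

definition C_time ::
    "(real^'d) set \<Rightarrow> real \<Rightarrow> nat \<Rightarrow> nat \<Rightarrow> (real \<Rightarrow> real^'d \<Rightarrow> 'b::euclidean_space) \<Rightarrow> bool" where
  "C_time \<Omega> T k m w \<longleftrightarrow>
     (\<exists>W. W 0 = w \<and>
        (\<forall>j\<le>k. \<forall>t\<in>{0..T}. W j t \<in> H_space \<Omega> m \<and>
           ((\<lambda>s. H_norm \<Omega> m (\<lambda>x. W j s x - W j t x)) \<longlongrightarrow> 0) (at t within {0..T})) \<and>
        (\<forall>j<k. \<forall>t\<in>{0..T}.
           ((\<lambda>s. H_norm \<Omega> m (\<lambda>x. (W j s x - W j t x) /\<^sub>R (s - t) - W (Suc j) t x)) \<longlongrightarrow> 0)
             (at t within {0..T})))"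

text \<open>
  The time derivative at \<open>t\<close>, relative to the time interval \<open>J\<close>, as limit of difference quotients
  in \<open>L\<^sup>2(\<Omega>)\<close>; determined up to a null set whenever it exists.
\<close>

definition time_deriv ::
    "('a::euclidean_space) set \<Rightarrow> real set \<Rightarrow> (real \<Rightarrow> 'a \<Rightarrow> 'b::euclidean_space) \<Rightarrow> real \<Rightarrow> 'a \<Rightarrow> 'b" where
  "time_deriv \<Omega> J w t = (SOME g. g \<in> L2 \<Omega> \<and>
     ((\<lambda>s. L2_norm \<Omega> (\<lambda>x. (w s x - w t x) /\<^sub>R (s - t) - g x)) \<longlongrightarrow> 0) (at t within J))"

definition nonstationary_solution ::
    "(real^'d) set \<Rightarrow> real \<Rightarrow> (real \<Rightarrow> real^'d \<Rightarrow> real^'d) \<Rightarrow> (real^'d \<Rightarrow> real^'d) \<Rightarrow>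
     (real \<Rightarrow> real^'d \<Rightarrow> real^'d) \<Rightarrow> (real \<Rightarrow> real^'d \<Rightarrow> real) \<Rightarrow> bool" where
  "nonstationary_solution \<Omega> T f u\<^sub>0 u p \<longleftrightarrow>
     (\<forall>t\<in>{0..T}. u t \<in> V_div \<Omega> \<and> p t \<in> Q_space \<Omega>) \<and>
     (\<forall>t\<in>{0<..T}. AE x in lebesgue_on \<Omega>.
        time_deriv \<Omega> {0..T} u t x - Laplacian \<Omega> (u t) x + gradient \<Omega> (p t) x = f t x \<and>
        divergence \<Omega> (u t) x = 0) \<and>
     (AE x in lebesgue_on \<Omega>. u 0 x = u\<^sub>0 x)"


section \<open>Finite element spaces\<close>

text \<open>
  A mesh together with its local spaces. Each cell \<open>K\<close> is the image of the reference cell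
  \<open>ref_cell \<D> K\<close> under \<open>ref_map \<D> K\<close>. Members of the local spaces are only relevant on \<open>K\<close>.
\<close>

record ('d::finite) discretization =
  cells :: "(real^'d) set set"
  ref_cell :: "(real^'d) set \<Rightarrow> (real^'d) set"
  ref_map :: "(real^'d) set \<Rightarrow> real^'d \<Rightarrow> real^'d"
  V_loc :: "(real^'d) set \<Rightarrow> (real^'d \<Rightarrow> real^'d) set"
  Q_loc :: "(real^'d) set \<Rightarrow> (real^'d \<Rightarrow> real) set"

definition is_mesh :: "(real^'d) set \<Rightarrow> 'd discretization \<Rightarrow> bool" where
  "is_mesh \<Omega> \<D> \<longleftrightarrow>
     finite (cells \<D>) \<and> \<Union> (cells \<D>) = closure \<Omega> \<and>
     (\<forall>K\<in>cells \<D>. \<forall>K'\<in>cells \<D>. K \<noteq> K' \<longrightarrow> interior K \<inter> interior K' = {}) \<and>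
     (\<forall>K\<in>cells \<D>.
        polytope (ref_cell \<D> K) \<and> interior (ref_cell \<D> K) \<noteq> {} \<and>
        continuous_on (ref_cell \<D> K) (ref_map \<D> K) \<and> inj_on (ref_map \<D> K) (ref_cell \<D> K) \<and>
        ref_map \<D> K ` ref_cell \<D> K = K \<and> negligible (frontier K))"

definition mesh_size :: "('d::finite) discretization \<Rightarrow> real" where
  "mesh_size \<D> = Max (diameter ` cells \<D>)"

definition shape_regular :: "real \<Rightarrow> ('d::finite) discretization \<Rightarrow> bool" where
  "shape_regular \<sigma> \<D> \<longleftrightarrow>
     (\<forall>K\<in>cells \<D>. \<exists>c \<rho>. 0 < \<rho> \<and> cball c \<rho> \<subseteq> K \<and> diameter K \<le> \<sigma> * (2 * \<rho>))"

definition polynomial_map :: "nat \<Rightarrow> (real^'d \<Rightarrow> 'b::euclidean_space) \<Rightarrow> bool" where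
  "polynomial_map l g \<longleftrightarrow>
     (\<exists>c. \<forall>x. g x = (\<Sum>\<alpha> | sum \<alpha> UNIV \<le> l. (\<Prod>i\<in>UNIV. (x $ i) ^ \<alpha> i) *\<^sub>R c \<alpha>))"

definition mapped_polynomial_space ::
    "nat \<Rightarrow> (real^'d) set \<Rightarrow> (real^'d \<Rightarrow> real^'d) \<Rightarrow> (real^'d \<Rightarrow> 'b::euclidean_space) set \<Rightarrow> bool" where
  "mapped_polynomial_space l K\<^sub>0 F S \<longleftrightarrow>
     (\<lambda>x. 0) \<in> S \<and> (\<forall>v\<in>S. \<forall>w\<in>S. (\<lambda>x. v x + w x) \<in> S) \<and> (\<forall>a. \<forall>v\<in>S. (\<lambda>x. a *\<^sub>R v x) \<in> S) \<and>
     (\<forall>v\<in>S. \<exists>g. polynomial_map l g \<and> (\<forall>y\<in>K\<^sub>0. v (F y) = g y))"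

definition local_spaces :: "nat \<Rightarrow> ('d::finite) discretization \<Rightarrow> bool" where
  "local_spaces l \<D> \<longleftrightarrow>
     (\<forall>K\<in>cells \<D>.
        mapped_polynomial_space l (ref_cell \<D> K) (ref_map \<D> K) (V_loc \<D> K) \<and>
        mapped_polynomial_space l (ref_cell \<D> K) (ref_map \<D> K) (Q_loc \<D> K))"

definition V_h :: "(real^'d) set \<Rightarrow> 'd discretization \<Rightarrow> (real^'d \<Rightarrow> real^'d) set" where
  "V_h \<Omega> \<D> = {v \<in> V_space \<Omega>. \<forall>K\<in>cells \<D>. \<exists>g\<in>V_loc \<D> K. AE x in lebesgue_on \<Omega>. x \<in> K \<longrightarrow> v x = g x}"

definition Q_h :: "(real^'d) set \<Rightarrow> 'd discretization \<Rightarrow> (real^'d \<Rightarrow> real) set" where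
  "Q_h \<Omega> \<D> = {q \<in> Q_space \<Omega>. \<forall>K\<in>cells \<D>. \<exists>g\<in>Q_loc \<D> K. AE x in lebesgue_on \<Omega>. x \<in> K \<longrightarrow> q x = g x}"

definition V_h_div :: "(real^'d) set \<Rightarrow> 'd discretization \<Rightarrow> (real^'d \<Rightarrow> real^'d) set" where
  "V_h_div \<Omega> \<D> = {v \<in> V_h \<Omega> \<D>. \<forall>q\<in>Q_h \<Omega> \<D>. L2_inner \<Omega> (divergence \<Omega> v) q = 0}"

text \<open>
  Infimum and supremum are taken in the extended reals, so that they have the usual meaning
  also for empty index sets.
\<close>

definition inf_sup_condition :: "real \<Rightarrow> (real^'d) set \<Rightarrow> 'd discretization \<Rightarrow> bool" where
  "inf_sup_condition \<beta> \<Omega> \<D> \<longleftrightarrow>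
     ereal \<beta> \<le> (INF q \<in> {q \<in> Q_h \<Omega> \<D>. L2_norm \<Omega> q \<noteq> 0}.
                  SUP v \<in> {v \<in> V_h \<Omega> \<D>. L2_norm \<Omega> v \<noteq> 0}.
                    ereal (- L2_inner \<Omega> (divergence \<Omega> v) q / (H_norm \<Omega> 1 v * L2_norm \<Omega> q)))"

definition approximation_property :: "real \<Rightarrow> nat \<Rightarrow> (real^'d) set \<Rightarrow> 'd discretization \<Rightarrow> bool" where
  "approximation_property C r \<Omega> \<D> \<longleftrightarrow>
     (\<forall>v\<in>V_space \<Omega> \<inter> H_space \<Omega> (r + 1). \<exists>w\<in>V_h \<Omega> \<D>.
        L2_norm \<Omega> (\<lambda>x. v x - w x) + mesh_size \<D> * L2_norm \<Omega> (Jacobian \<Omega> (\<lambda>x. v x - w x))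
          \<le> C * mesh_size \<D> ^ (r + 1) * H_norm \<Omega> (r + 1) v) \<and>
     (\<forall>q\<in>Q_space \<Omega> \<inter> H_space \<Omega> r. \<exists>s\<in>Q_h \<Omega> \<D>.
        L2_norm \<Omega> (\<lambda>x. q x - s x) \<le> C * mesh_size \<D> ^ r * H_norm \<Omega> r q)"

text \<open>
  The constants \<open>\<sigma>, l, \<beta>, C\<close> are uniform over the family. The family is an arbitrary set, so it
  may contain several discretizations with the same mesh size.
\<close>

definition finite_element_family :: "(real^'d) set \<Rightarrow> nat \<Rightarrow> 'd discretization set \<Rightarrow> bool" where
  "finite_element_family \<Omega> r \<F> \<longleftrightarrow>
     (\<forall>\<D>\<in>\<F>. is_mesh \<Omega> \<D>) \<and>
     (\<exists>\<sigma>. \<forall>\<D>\<in>\<F>. shape_regular \<sigma> \<D>) \<and>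
     (\<exists>l. \<forall>\<D>\<in>\<F>. local_spaces l \<D>) \<and>
     (\<exists>\<beta>>0. \<forall>\<D>\<in>\<F>. inf_sup_condition \<beta> \<Omega> \<D>) \<and>
     (\<exists>C. \<forall>\<D>\<in>\<F>. approximation_property C r \<Omega> \<D>)"

text \<open>
  The defining equations determine both components up to null sets, whence the choice operator.
\<close>

definition Stokes_projection ::
    "(real^'d) set \<Rightarrow> 'd discretization \<Rightarrow> (real^'d \<Rightarrow> real^'d) \<Rightarrow> (real^'d \<Rightarrow> real) \<Rightarrow>
     (real^'d \<Rightarrow> real^'d) \<times> (real^'d \<Rightarrow> real)" where
  "Stokes_projection \<Omega> \<D> w s = (SOME (w\<^sub>h, s\<^sub>h).
     w\<^sub>h \<in> V_h \<Omega> \<D> \<and> s\<^sub>h \<in> Q_h \<Omega> \<D> \<and>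
     (\<forall>v\<in>V_h \<Omega> \<D>. a_form \<Omega> w\<^sub>h v + b_form \<Omega> v s\<^sub>h = a_form \<Omega> w v + b_form \<Omega> v s) \<and>
     (\<forall>q\<in>Q_h \<Omega> \<D>. b_form \<Omega> w\<^sub>h q = 0))"


section \<open>Time discretization\<close>

definition time_mesh :: "real \<Rightarrow> nat \<Rightarrow> (nat \<Rightarrow> real) \<Rightarrow> bool" where
  "time_mesh T N t \<longleftrightarrow> 1 \<le> N \<and> t 0 = 0 \<and> t N = T \<and> (\<forall>n<N. t n < t (Suc n))"

definition step :: "(nat \<Rightarrow> real) \<Rightarrow> nat \<Rightarrow> real" where
  "step t n = t n - t (n - 1)"

definition max_step :: "nat \<Rightarrow> (nat \<Rightarrow> real) \<Rightarrow> real" where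
  "max_step N t = Max (step t ` {1..N})"

definition midpt :: "(nat \<Rightarrow> real) \<Rightarrow> nat \<Rightarrow> real" where
  "midpt t n = (t (n - 1) + t n) / 2"

definition poly_in_time ::
    "('a::euclidean_space) set \<Rightarrow> nat \<Rightarrow> real set \<Rightarrow> ('a \<Rightarrow> 'b::euclidean_space) set \<Rightarrow>
     (real \<Rightarrow> 'a \<Rightarrow> 'b) \<Rightarrow> bool" where
  "poly_in_time \<Omega> k J X w \<longleftrightarrow>
     (\<exists>c. (\<forall>j\<le>k. c j \<in> X) \<and>
          (\<forall>s\<in>J. AE x in lebesgue_on \<Omega>. w s x = (\<Sum>j\<le>k. s ^ j *\<^sub>R c j x)))"

definition has_right_limit ::
    "('a::euclidean_space) set \<Rightarrow> (real \<Rightarrow> 'a \<Rightarrow> 'b::euclidean_space) \<Rightarrow> real \<Rightarrow> ('a \<Rightarrow> 'b) \<Rightarrow> bool" where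
  "has_right_limit \<Omega> w t l \<longleftrightarrow> ((\<lambda>s. L2_norm \<Omega> (\<lambda>x. w s x - l x)) \<longlongrightarrow> 0) (at_right t)"

definition scheme_solution ::
    "(real^'d) set \<Rightarrow> 'd discretization \<Rightarrow> nat \<Rightarrow> (nat \<Rightarrow> real) \<Rightarrow> (real \<Rightarrow> real^'d \<Rightarrow> real^'d) \<Rightarrow>
     (real^'d \<Rightarrow> real^'d) \<Rightarrow> (real \<Rightarrow> real^'d \<Rightarrow> real^'d) \<Rightarrow> (real \<Rightarrow> real^'d \<Rightarrow> real) \<Rightarrow> bool" where
  "scheme_solution \<Omega> \<D> N t f u\<^sub>0\<^sub>h u\<^sub>h p\<^sub>h \<longleftrightarrow>
     (AE x in lebesgue_on \<Omega>. u\<^sub>h 0 x = u\<^sub>0\<^sub>h x) \<and>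
     (\<forall>n\<in>{1..N}. let I\<^sub>n = {t (n - 1)<..t n} in
        poly_in_time \<Omega> 1 I\<^sub>n (V_h \<Omega> \<D>) u\<^sub>h \<and>
        poly_in_time \<Omega> 1 I\<^sub>n (Q_h \<Omega> \<D>) p\<^sub>h \<and>
        has_right_limit \<Omega> u\<^sub>h (t (n - 1)) (u\<^sub>h (t (n - 1))) \<and>
        (\<forall>v\<in>V_h \<Omega> \<D>.
           (LINT s:I\<^sub>n|lborel. L2_inner \<Omega> (time_deriv \<Omega> I\<^sub>n u\<^sub>h s) v
                               + a_form \<Omega> (u\<^sub>h s) v + b_form \<Omega> v (p\<^sub>h s))
           = step t n / 2 * L2_inner \<Omega> (\<lambda>x. f (t (n - 1)) x + f (t n) x) v) \<and>
        (\<forall>q\<in>Q_h \<Omega> \<D>. (LINT s:I\<^sub>n|lborel. b_form \<Omega> (u\<^sub>h s) q) = 0))"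

definition quadratic_interpolant ::
    "real \<Rightarrow> real \<Rightarrow> (real \<Rightarrow> 'a \<Rightarrow> 'b::real_normed_vector) \<Rightarrow> real \<Rightarrow> 'a \<Rightarrow> 'b" where
  "quadratic_interpolant a b v s x = (let c = (a + b) / 2 in
     ((s - c) * (s - b) / ((a - c) * (a - b))) *\<^sub>R v a x +
     ((s - a) * (s - b) / ((c - a) * (c - b))) *\<^sub>R v c x +
     ((s - a) * (s - c) / ((b - a) * (b - c))) *\<^sub>R v b x)"

text \<open>For \<open>0 < s \<le> T\<close>, the least \<open>n\<close> with \<open>s \<le> t\<^sub>n\<close> is the index of the interval \<open>I\<^sub>n\<close> containing \<open>s\<close>.\<close>

definition R1_interpolant ::
    "(nat \<Rightarrow> real) \<Rightarrow> (real \<Rightarrow> 'a \<Rightarrow> 'b::real_normed_vector) \<Rightarrow> real \<Rightarrow> 'a \<Rightarrow> 'b" where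
  "R1_interpolant t v s x =
     (if s = 0 then v 0 x
      else let n = (LEAST n. s \<le> t n) in
        v (t (n - 1)) x + (s - t (n - 1)) *\<^sub>R
          vector_derivative (\<lambda>y. quadratic_interpolant (t (n - 1)) (t n) v y x) (at (midpt t n)))"

definition u_hat ::
    "(real^'d) set \<Rightarrow> 'd discretization \<Rightarrow> (nat \<Rightarrow> real) \<Rightarrow> (real \<Rightarrow> real^'d \<Rightarrow> real^'d) \<Rightarrow>
     (real \<Rightarrow> real^'d \<Rightarrow> real) \<Rightarrow> real \<Rightarrow> real^'d \<Rightarrow> real^'d" where
  "u_hat \<Omega> \<D> t u p s = fst (Stokes_projection \<Omega> \<D> (R1_interpolant t u s) (R1_interpolant t p s))"

end

theory Submission
  imports Defs "HOL-Computational_Algebra.Polynomial"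
begin

text \<open>
  Integrating the scheme over a time interval, on which the discrete velocity and pressure are
  affine, turns it into the Crank--Nicolson method for the nodal velocities \<open>U\<^sub>n\<close> and the midpoint
  pressures \<open>P\<^sub>n\<close> (\<open>scheme_nodal_values\<close>). The exact solution is compared with its Stokes
  projections \<open>(w\<^sub>n, \<pi>\<^sub>n)\<close> at the mesh points. At the initial time this comparison function is
  \<open>u_hat\<close>, because the interpolant \<open>R1_interpolant\<close> keeps the value at time 0.

  Averaging the momentum equation over the two end points of a time interval and subtracting the
  scheme gives, for \<open>e\<^sub>n = w\<^sub>n - U\<^sub>n\<close> and \<open>z\<^sub>n = (\<pi>\<^sub>n + \<pi>\<^sub>n\<^sub>-\<^sub>1) / 2 - P\<^sub>n\<close>,
  \<open>\<langle>(e\<^sub>n - e\<^sub>n\<^sub>-\<^sub>1) / \<tau>\<^sub>n, v\<rangle> + \<langle>\<nabla>(e\<^sub>n + e\<^sub>n\<^sub>-\<^sub>1) / 2, \<nabla>v\<rangle> - \<langle>div v, z\<^sub>n\<rangle> = \<langle>\<rho>\<^sub>n, v\<rangle>\<close>,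
  where \<open>\<rho>\<^sub>n\<close> is the difference quotient of \<open>w\<close> minus the average of \<open>\<partial>\<^sub>t u\<close> over the end points.
  The test function \<open>v = (e\<^sub>n - e\<^sub>n\<^sub>-\<^sub>1) / \<tau>\<^sub>n\<close> is discretely divergence free. So the pressure term
  drops out, and the squared norms of the difference quotients of \<open>e\<close>, weighted with \<open>\<tau>\<^sub>n\<close>, add up to
  at most \<open>\<parallel>\<nabla>e\<^sub>0\<parallel>\<^sup>2\<close> plus the weighted sum of \<open>\<parallel>\<rho>\<^sub>n\<parallel>\<^sup>2\<close>; the same holds for each \<open>\<parallel>\<nabla>e\<^sub>n\<parallel>\<^sup>2\<close>. The
  inf-sup condition reads off a bound of \<open>z\<^sub>n\<close> from the equation
  (\<open>Crank_Nicolson_pressure_bound\<close>).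

  It remains to see that \<open>\<rho>\<^sub>n\<close> and the difference of \<open>p\<close> at the midpoint and \<open>(\<pi>\<^sub>n + \<pi>\<^sub>n\<^sub>-\<^sub>1) / 2\<close> are
  of order \<open>\<tau>\<^sup>2 + h\<^sup>r\<close>. The powers of \<open>\<tau>\<close> come from the trapezoidal and the midpoint rule. The powers of
  \<open>h\<close> come from the quasi-optimality of the Stokes projection in the energy norm
  (\<open>Stokes_proj_error\<close>), applied to difference quotients of \<open>(u, p)\<close>, and from Poincare's inequality,
  which carries the order \<open>h\<^sup>r\<close> over from the gradient of the projection error to its \<open>L\<^sup>2\<close> norm.

  Three parts of the argument concern the foundations. Functions modulo null sets form an inner
  product space (type \<open>l2\<close>), in which the estimates above take place. Weak derivatives are unique up
  to null sets (\<open>fundamental_lemma\<close>), so that they act linearly on this space although they are chosen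
  by a choice operator; members of \<open>H\<^sup>1\<^sub>0\<close> are limits of test functions there, which gives the weak
  form of the momentum equation and Poincare's inequality. Finally, the finite element spaces have
  finite dimension modulo null sets (\<open>piecewise_polynomials_finite_dimensional\<close>), so uniqueness of the
  Stokes projection yields its existence (\<open>Stokes_proj_exists\<close>).
\<close>

section \<open>Square-integrable functions as an inner product space\<close>

lemma L2_UNIV_iff:
  "f \<in> L2 UNIV \<longleftrightarrow> f \<in> borel_measurable lebesgue \<and> integrable lebesgue (\<lambda>x. (norm (f x))\<^sup>2)"
  by (simp add: L2_def lebesgue_on_UNIV_eq)

lemma L2_measurable: "f \<in> L2 \<Omega> \<Longrightarrow> f \<in> borel_measurable (lebesgue_on \<Omega>)"
  by (simp add: L2_def)

lemma L2_scaleR: "f \<in> L2 \<Omega> \<Longrightarrow> (\<lambda>x. c *\<^sub>R f x) \<in> L2 \<Omega>"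
  by (auto simp: L2_def power_mult_distrib)

lemma L2_add:
  assumes "f \<in> L2 \<Omega>" "g \<in> L2 \<Omega>"
  shows "(\<lambda>x. f x + g x) \<in> L2 \<Omega>"
proof -
  note [measurable] = assms[THEN L2_measurable]
  have *: "(norm (a + b))\<^sup>2 \<le> 2 * (norm a)\<^sup>2 + 2 * (norm b)\<^sup>2" for a b :: 'b
    using power_mono[OF norm_triangle_ineq[of a b], of 2] sum_squares_bound[of "norm a" "norm b"]
    by (simp add: power2_sum)
  have "integrable (lebesgue_on \<Omega>) (\<lambda>x. 2 * (norm (f x))\<^sup>2 + 2 * (norm (g x))\<^sup>2)"
    using assms by (auto simp: L2_def)
  then have "integrable (lebesgue_on \<Omega>) (\<lambda>x. (norm (f x + g x))\<^sup>2)"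
    by (rule Bochner_Integration.integrable_bound) (use * in auto)
  then show ?thesis
    by (simp add: L2_def)
qed

lemma L2_zero: "(\<lambda>x. 0) \<in> L2 \<Omega>"
  by (simp add: L2_def)

lemma L2_diff: "f \<in> L2 \<Omega> \<Longrightarrow> g \<in> L2 \<Omega> \<Longrightarrow> (\<lambda>x. f x - g x) \<in> L2 \<Omega>"
  using L2_add[of f \<Omega> "\<lambda>x. (-1) *\<^sub>R g x"] L2_scaleR[of g \<Omega> "-1"] by simp

lemma L2_sum: "(\<And>i. i \<in> A \<Longrightarrow> f i \<in> L2 \<Omega>) \<Longrightarrow> (\<lambda>x. \<Sum>i\<in>A. f i x) \<in> L2 \<Omega>"
  by (induction A rule: infinite_finite_induct) (auto simp: L2_zero intro: L2_add)

lemma L2_integrable_inner: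
  assumes "f \<in> L2 \<Omega>" "g \<in> L2 \<Omega>"
  shows "integrable (lebesgue_on \<Omega>) (\<lambda>x. f x \<bullet> g x)"
proof -
  note [measurable] = assms[THEN L2_measurable]
  have *: "norm (a \<bullet> b) \<le> norm ((norm a)\<^sup>2 + (norm b)\<^sup>2)" for a b :: 'b
  proof -
    have "\<bar>a \<bullet> b\<bar> \<le> norm a * norm b"
      by (rule Cauchy_Schwarz_ineq2)
    moreover have "2 * (norm a * norm b) \<le> (norm a)\<^sup>2 + (norm b)\<^sup>2"
      using sum_squares_bound[of "norm a" "norm b"] by simp
    moreover have "0 \<le> norm a * norm b" by simp
    ultimately show ?thesis unfolding real_norm_def by arith
  qed
  have "integrable (lebesgue_on \<Omega>) (\<lambda>x. (norm (f x))\<^sup>2 + (norm (g x))\<^sup>2)"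
    using assms by (auto simp: L2_def)
  then show ?thesis
    by (rule Bochner_Integration.integrable_bound) (use * in auto)
qed

lemma L2_AE_cong:
  assumes "f \<in> L2 \<Omega>" "g \<in> L2 \<Omega>" "f' \<in> L2 \<Omega>" "g' \<in> L2 \<Omega>"
    and "AE x in lebesgue_on \<Omega>. f x = f' x" "AE x in lebesgue_on \<Omega>. g x = g' x"
  shows "L2_inner \<Omega> f g = L2_inner \<Omega> f' g'"
  unfolding L2_inner_def
  by (rule integral_cong_AE)
     (use assms in \<open>auto intro!: borel_measurable_integrable L2_integrable_inner\<close>)

lemma L2_inner_self_eq_0:
  assumes "f \<in> L2 \<Omega>"
  shows "L2_inner \<Omega> f f = 0 \<longleftrightarrow> (AE x in lebesgue_on \<Omega>. f x = 0)"
  unfolding L2_inner_def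
  by (subst integral_nonneg_eq_0_iff_AE) (use assms in \<open>auto intro: L2_integrable_inner\<close>)

definition l2_rel :: "('a::euclidean_space \<Rightarrow> 'b::euclidean_space) \<Rightarrow> ('a \<Rightarrow> 'b) \<Rightarrow> bool" where
  "l2_rel f g \<longleftrightarrow> f \<in> L2 UNIV \<and> g \<in> L2 UNIV \<and> (AE x in lebesgue_on UNIV. f x = g x)"

text \<open>
  The inner product space of square-integrable functions on the whole space modulo null sets.
  Functions on a domain enter it through extension by zero (\<open>l2_class\<close>); this makes the
  general theory of inner product spaces applicable, with one type for all domains.
\<close>

quotient_type (overloaded) ('a, 'b) l2 =
  "'a::euclidean_space \<Rightarrow> 'b::euclidean_space" / partial: l2_rel
proof (rule part_equivpI)
  show "\<exists>x. l2_rel x x"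
    by (rule exI[of _ "\<lambda>x. 0"]) (simp add: l2_rel_def L2_zero)
  show "symp l2_rel"
    by (auto simp: symp_def l2_rel_def eq_commute)
  show "transp l2_rel"
    unfolding transp_def l2_rel_def by (auto elim: eventually_elim2)
qed

instantiation l2 :: (euclidean_space, euclidean_space) real_vector
begin

lift_definition zero_l2 :: "('a, 'b) l2" is "\<lambda>x. 0"
  by (simp add: l2_rel_def L2_zero)

lift_definition plus_l2 :: "('a, 'b) l2 \<Rightarrow> ('a, 'b) l2 \<Rightarrow> ('a, 'b) l2" is "\<lambda>f g x. f x + g x"
  unfolding l2_rel_def by (auto intro: L2_add elim: eventually_elim2)

lift_definition minus_l2 :: "('a, 'b) l2 \<Rightarrow> ('a, 'b) l2 \<Rightarrow> ('a, 'b) l2" is "\<lambda>f g x. f x - g x"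
  unfolding l2_rel_def by (auto intro: L2_diff elim: eventually_elim2)

lift_definition uminus_l2 :: "('a, 'b) l2 \<Rightarrow> ('a, 'b) l2" is "\<lambda>f x. - f x"
  unfolding l2_rel_def using L2_scaleR[where c="-1"] by (auto elim: eventually_mono)

lift_definition scaleR_l2 :: "real \<Rightarrow> ('a, 'b) l2 \<Rightarrow> ('a, 'b) l2" is "\<lambda>c f x. c *\<^sub>R f x"
  unfolding l2_rel_def by (auto intro: L2_scaleR elim: eventually_mono)

instance
proof
  fix f g h :: "('a, 'b) l2" and c d :: real
  show "f + g + h = f + (g + h)"
    by transfer (auto simp: l2_rel_def add.assoc intro!: L2_add)
  show "f + g = g + f"
    by transfer (auto simp: l2_rel_def add.commute intro!: L2_add)
  show "0 + f = f"
    by transfer (auto simp: l2_rel_def)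
  show "- f + f = 0"
    by transfer (use L2_scaleR[where c="-1"] in \<open>auto simp: l2_rel_def intro!: L2_zero L2_add\<close>)
  show "f - g = f + - g"
    by transfer (use L2_scaleR[where c="-1"] in \<open>auto simp: l2_rel_def intro!: L2_diff L2_add\<close>)
  show "c *\<^sub>R (f + g) = c *\<^sub>R f + c *\<^sub>R g"
    by transfer (auto simp: l2_rel_def scaleR_add_right intro!: L2_scaleR L2_add)
  show "(c + d) *\<^sub>R f = c *\<^sub>R f + d *\<^sub>R f"
    by transfer (auto simp: l2_rel_def scaleR_add_left intro!: L2_scaleR L2_add)
  show "c *\<^sub>R d *\<^sub>R f = (c * d) *\<^sub>R f"
    by transfer (auto simp: l2_rel_def intro!: L2_scaleR)
  show "1 *\<^sub>R f = f"
    by transfer (auto simp: l2_rel_def)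
qed

end

instantiation l2 :: (euclidean_space, euclidean_space) real_inner
begin

lift_definition inner_l2 :: "('a, 'b) l2 \<Rightarrow> ('a, 'b) l2 \<Rightarrow> real" is "L2_inner UNIV"
  unfolding l2_rel_def by (auto intro: L2_AE_cong)

definition norm_l2 :: "('a, 'b) l2 \<Rightarrow> real" where
  "norm_l2 f = sqrt (f \<bullet> f)"

definition dist_l2 :: "('a, 'b) l2 \<Rightarrow> ('a, 'b) l2 \<Rightarrow> real" where
  "dist_l2 f g = norm (f - g)"

definition sgn_l2 :: "('a, 'b) l2 \<Rightarrow> ('a, 'b) l2" where
  "sgn_l2 f = f /\<^sub>R norm f"

definition uniformity_l2 :: "(('a, 'b) l2 \<times> ('a, 'b) l2) filter" where
  "uniformity_l2 = (INF e\<in>{0<..}. principal {(x, y). dist x y < e})"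

definition open_l2 :: "('a, 'b) l2 set \<Rightarrow> bool" where
  "open_l2 U \<longleftrightarrow> (\<forall>x\<in>U. \<forall>\<^sub>F (x', y) in uniformity. x' = x \<longrightarrow> y \<in> U)"

instance
proof
  fix f g h :: "('a, 'b) l2" and c d :: real
  show "f \<bullet> g = g \<bullet> f"
    by transfer (simp add: L2_inner_def inner_commute)
  show "(f + g) \<bullet> h = f \<bullet> h + g \<bullet> h"
    by transfer (auto simp: l2_rel_def L2_inner_def inner_add_left
        intro!: Bochner_Integration.integral_add L2_integrable_inner)
  show "(c *\<^sub>R f) \<bullet> g = c * (f \<bullet> g)"
    by transfer (simp add: L2_inner_def)
  show "0 \<le> f \<bullet> f"
    by transfer (simp add: L2_inner_def)
  show "f \<bullet> f = 0 \<longleftrightarrow> f = 0"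
    by transfer (auto simp: l2_rel_def L2_inner_self_eq_0 L2_zero)
  show "norm f = sqrt (f \<bullet> f)" by (rule norm_l2_def)
  show "dist f g = norm (f - g)" by (rule dist_l2_def)
  show "sgn f = f /\<^sub>R norm f" by (rule sgn_l2_def)
  show "(uniformity :: (('a, 'b) l2 \<times> _) filter) = (INF e\<in>{0<..}. principal {(x, y). dist x y < e})"
    by (rule uniformity_l2_def)
  show "open U \<longleftrightarrow> (\<forall>x\<in>U. \<forall>\<^sub>F (x', y) in uniformity. x' = x \<longrightarrow> y \<in> U)" for U :: "('a, 'b) l2 set"
    by (rule open_l2_def)
qed

end

definition zero_ext :: "'a set \<Rightarrow> ('a::euclidean_space \<Rightarrow> 'b::euclidean_space) \<Rightarrow> 'a \<Rightarrow> 'b" where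
  "zero_ext \<Omega> f x = indicator \<Omega> x *\<^sub>R f x"

definition l2_class ::
    "'a set \<Rightarrow> ('a::euclidean_space \<Rightarrow> 'b::euclidean_space) \<Rightarrow> ('a, 'b) l2" where
  "l2_class \<Omega> f = abs_l2 (zero_ext \<Omega> f)"

lemma zero_ext_L2:
  assumes "\<Omega> \<in> sets lebesgue"
  shows "zero_ext \<Omega> f \<in> L2 UNIV \<longleftrightarrow> f \<in> L2 \<Omega>"
proof -
  have *: "(norm (zero_ext \<Omega> f x))\<^sup>2 = indicator \<Omega> x *\<^sub>R (norm (f x))\<^sup>2" for x
    by (auto simp: indicator_def zero_ext_def)
  have "f \<in> borel_measurable (lebesgue_on \<Omega>) \<longleftrightarrow> zero_ext \<Omega> f \<in> borel_measurable lebesgue"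
    using assms by (subst borel_measurable_restrict_space_iff) (auto simp: zero_ext_def[abs_def])
  then show ?thesis
    using assms by (simp only: L2_def mem_Collect_eq * lebesgue_on_UNIV_eq)
       (subst integrable_restrict_space, auto)
qed

lemma l2_rel_zero_ext:
  assumes "\<Omega> \<in> sets lebesgue"
  shows "l2_rel (zero_ext \<Omega> f) (zero_ext \<Omega> g) \<longleftrightarrow>
    f \<in> L2 \<Omega> \<and> g \<in> L2 \<Omega> \<and> (AE x in lebesgue_on \<Omega>. f x = g x)"
proof -
  have "(AE x in lebesgue_on \<Omega>. f x = g x) \<longleftrightarrow> (AE x in lebesgue. x \<in> \<Omega> \<longrightarrow> f x = g x)"
    using assms by (subst AE_restrict_space_iff) auto
  also have "\<dots> \<longleftrightarrow> (AE x in lebesgue. zero_ext \<Omega> f x = zero_ext \<Omega> g x)"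
    by (auto simp: zero_ext_def indicator_def intro!: arg_cong[where f="\<lambda>P. eventually P _"])
  finally show ?thesis
    using assms unfolding l2_rel_def lebesgue_on_UNIV_eq by (simp add: zero_ext_L2)
qed

lemma l2_class_eq_iff:
  assumes "\<Omega> \<in> sets lebesgue" "f \<in> L2 \<Omega>" "g \<in> L2 \<Omega>"
  shows "l2_class \<Omega> f = l2_class \<Omega> g \<longleftrightarrow> (AE x in lebesgue_on \<Omega>. f x = g x)"
proof -
  have "l2_rel (zero_ext \<Omega> h) (zero_ext \<Omega> h)" if "h \<in> L2 \<Omega>" for h :: "'a \<Rightarrow> 'b"
    using assms that by (simp add: l2_rel_zero_ext)
  then have "l2_class \<Omega> f = l2_class \<Omega> g \<longleftrightarrow> l2_rel (zero_ext \<Omega> f) (zero_ext \<Omega> g)"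
    unfolding l2_class_def using assms Quotient3_rel[OF Quotient3_l2] by blast
  with assms show ?thesis by (simp add: l2_rel_zero_ext)
qed

lemma l2_class_ops:
  assumes \<Omega>: "\<Omega> \<in> sets lebesgue" and f: "f \<in> L2 \<Omega>" and g: "g \<in> L2 \<Omega>"
  shows l2_class_add: "l2_class \<Omega> (\<lambda>x. f x + g x) = l2_class \<Omega> f + l2_class \<Omega> g"
    and l2_class_diff: "l2_class \<Omega> (\<lambda>x. f x - g x) = l2_class \<Omega> f - l2_class \<Omega> g"
    and l2_class_scaleR: "l2_class \<Omega> (\<lambda>x. c *\<^sub>R f x) = c *\<^sub>R l2_class \<Omega> f"
    and inner_l2_class: "l2_class \<Omega> f \<bullet> l2_class \<Omega> g = L2_inner \<Omega> f g"
proof -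
  have rel: "l2_rel (zero_ext \<Omega> f) (zero_ext \<Omega> f)" "l2_rel (zero_ext \<Omega> g) (zero_ext \<Omega> g)"
    using assms by (auto simp: l2_rel_zero_ext)
  have ext: "zero_ext \<Omega> (\<lambda>x. f x + g x) = (\<lambda>x. zero_ext \<Omega> f x + zero_ext \<Omega> g x)"
    "zero_ext \<Omega> (\<lambda>x. f x - g x) = (\<lambda>x. zero_ext \<Omega> f x - zero_ext \<Omega> g x)"
    "zero_ext \<Omega> (\<lambda>x. c *\<^sub>R f x) = (\<lambda>x. c *\<^sub>R zero_ext \<Omega> f x)"
    by (auto simp: zero_ext_def algebra_simps)
  show "l2_class \<Omega> (\<lambda>x. f x + g x) = l2_class \<Omega> f + l2_class \<Omega> g"
    using rel unfolding l2_class_def ext by (simp add: plus_l2.abs_eq)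
  show "l2_class \<Omega> (\<lambda>x. f x - g x) = l2_class \<Omega> f - l2_class \<Omega> g"
    using rel unfolding l2_class_def ext by (simp add: minus_l2.abs_eq)
  show "l2_class \<Omega> (\<lambda>x. c *\<^sub>R f x) = c *\<^sub>R l2_class \<Omega> f"
    using rel unfolding l2_class_def ext by (simp add: scaleR_l2.abs_eq)
  have "l2_class \<Omega> f \<bullet> l2_class \<Omega> g = L2_inner UNIV (zero_ext \<Omega> f) (zero_ext \<Omega> g)"
    using rel unfolding l2_class_def by (simp add: inner_l2.abs_eq)
  also have "\<dots> = L2_inner \<Omega> f g"
    using \<Omega> unfolding L2_inner_def
    by (subst integral_restrict_space)
       (auto simp: zero_ext_def indicator_def lebesgue_on_UNIV_eq intro!: Bochner_Integration.integral_cong)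
  finally show "l2_class \<Omega> f \<bullet> l2_class \<Omega> g = L2_inner \<Omega> f g" .
qed

lemma norm_l2_class:
  "\<Omega> \<in> sets lebesgue \<Longrightarrow> f \<in> L2 \<Omega> \<Longrightarrow> norm (l2_class \<Omega> f) = L2_norm \<Omega> f"
  by (simp add: norm_eq_sqrt_inner inner_l2_class L2_norm_def)

lemma l2_class_zero: "l2_class \<Omega> (\<lambda>x. 0) = 0"
  by (simp add: l2_class_def zero_ext_def[abs_def] zero_l2_def)

lemma l2_class_sum:
  assumes "\<Omega> \<in> sets lebesgue" "\<And>i. i \<in> A \<Longrightarrow> f i \<in> L2 \<Omega>"
  shows "l2_class \<Omega> (\<lambda>x. \<Sum>i\<in>A. f i x) = (\<Sum>i\<in>A. l2_class \<Omega> (f i))"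
  using assms(2)
  by (induction A rule: infinite_finite_induct)
     (auto simp: l2_class_zero l2_class_add[OF assms(1)] L2_sum)

text \<open>
  Lebesgue measure is complete: every subset of a null set is measurable.
\<close>

lemma measurable_lebesgue_on_AE_cong:
  fixes f g :: "'a::euclidean_space \<Rightarrow> 'b::euclidean_space"
  assumes \<Omega>: "\<Omega> \<in> sets lebesgue" and f: "f \<in> borel_measurable (lebesgue_on \<Omega>)"
    and ae: "AE x in lebesgue_on \<Omega>. f x = g x"
  shows "g \<in> borel_measurable (lebesgue_on \<Omega>)"
proof -
  have f': "zero_ext \<Omega> f \<in> borel_measurable lebesgue"
    using \<Omega> f by (subst (asm) borel_measurable_restrict_space_iff) (auto simp: zero_ext_def[abs_def])
  have ae': "AE x in lebesgue. zero_ext \<Omega> f x = zero_ext \<Omega> g x"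
    using ae \<Omega> by (subst (asm) AE_restrict_space_iff) (auto simp: zero_ext_def indicator_def elim: eventually_mono)
  have "zero_ext \<Omega> g \<in> borel_measurable lebesgue"
  proof (rule borel_measurableI)
    fix S :: "'b set" assume "open S"
    show "zero_ext \<Omega> g -` S \<inter> space lebesgue \<in> sets lebesgue"
    proof (rule completion.in_sets_AE)
      show "zero_ext \<Omega> f -` S \<inter> space lebesgue \<in> sets lebesgue"
        using f' \<open>open S\<close> by (intro measurable_sets) auto
      show "AE x in lebesgue. x \<in> zero_ext \<Omega> f -` S \<inter> space lebesgue \<longleftrightarrow> x \<in> zero_ext \<Omega> g -` S \<inter> space lebesgue"
        using ae' by eventually_elim auto
    qed auto
  qed
  then show ?thesis
    using \<Omega> by (subst borel_measurable_restrict_space_iff) (auto simp: zero_ext_def[abs_def])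
qed

lemma L2_AE_closed:
  assumes \<Omega>: "\<Omega> \<in> sets lebesgue" and f: "f \<in> L2 \<Omega>" and ae: "AE x in lebesgue_on \<Omega>. f x = g x"
  shows "g \<in> L2 \<Omega>"
proof -
  have [measurable]: "g \<in> borel_measurable (lebesgue_on \<Omega>)"
    using measurable_lebesgue_on_AE_cong[OF \<Omega> _ ae] f by (simp add: L2_def)
  have "integrable (lebesgue_on \<Omega>) (\<lambda>x. (norm (f x))\<^sup>2) \<longleftrightarrow> integrable (lebesgue_on \<Omega>) (\<lambda>x. (norm (g x))\<^sup>2)"
    by (rule integrable_cong_AE) (use f ae in \<open>auto simp: L2_def elim: eventually_mono\<close>)
  with f show ?thesis by (simp add: L2_def)
qed

section \<open>Smooth functions of compact support\<close>

text \<open>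
  Time derivatives are defined as limits of difference quotients in norm. This connects them with
  the derivatives of curves in normed spaces.
\<close>

lemma has_vector_derivative_iff_quotient:
  fixes f :: "real \<Rightarrow> 'a::real_normed_vector"
  shows "(f has_vector_derivative f') (at t within S) \<longleftrightarrow>
    ((\<lambda>s. norm ((f s - f t) /\<^sub>R (s - t) - f')) \<longlongrightarrow> 0) (at t within S)"
proof -
  have "norm (f s - f t - (s - t) *\<^sub>R f') / norm (s - t) = norm ((f s - f t) /\<^sub>R (s - t) - f')"
    if "s \<noteq> t" for s
  proof -
    have "(f s - f t) /\<^sub>R (s - t) - f' = (f s - f t - (s - t) *\<^sub>R f') /\<^sub>R (s - t)"
      using that by (simp add: scaleR_diff_right)
    then show ?thesis by (simp add: divide_inverse mult.commute)
  qed
  then have "((\<lambda>s. norm (f s - f t - (s - t) *\<^sub>R f') / norm (s - t)) \<longlongrightarrow> 0) (at t within S) \<longleftrightarrow>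
      ((\<lambda>s. norm ((f s - f t) /\<^sub>R (s - t) - f')) \<longlongrightarrow> 0) (at t within S)"
    by (intro filterlim_cong refl) (auto simp: eventually_at_filter)
  then show ?thesis
    by (simp add: has_vector_derivative_def has_derivative_iff_norm bounded_linear_scaleR_left)
qed

lemma vector_derivative_bound:
  fixes f :: "real \<Rightarrow> 'a::real_normed_vector"
  assumes "convex S" "\<And>t. t \<in> S \<Longrightarrow> (f has_vector_derivative f' t) (at t within S)"
    and "\<And>t. t \<in> S \<Longrightarrow> norm (f' t) \<le> B" "x \<in> S" "y \<in> S"
  shows "norm (f x - f y) \<le> B * \<bar>x - y\<bar>"
proof -
  have "onorm (\<lambda>h. h *\<^sub>R f' t) \<le> B" if "t \<in> S" for t
    using mult_left_mono[OF assms(3)[OF that]] by (intro onorm_le) (simp add: mult.commute[of B])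
  then have "norm (f x - f y) \<le> B * norm (x - y)"
    using assms by (intro differentiable_bound[where f'="\<lambda>t h. h *\<^sub>R f' t"])
      (auto simp: has_vector_derivative_def)
  then show ?thesis by simp
qed

lemma partial_deriv_eqI:
  "(f has_derivative f') (at x) \<Longrightarrow> partial_deriv i f x = f' (axis i 1)"
  by (simp add: partial_deriv_def frechet_derivative_at[symmetric])

lemma C_diff_continuous: "C_diff k f \<Longrightarrow> continuous_on UNIV f"
  by (cases k) (auto simp: continuous_on_eq_continuous_within intro: differentiable_imp_continuous_within)

lemma C_diff_lower: "C_diff (Suc k) f \<Longrightarrow> C_diff k f"
proof (induction k arbitrary: f)
  case 0
  then show ?case using C_diff_continuous[of "Suc 0" f] by simp
next
  case (Suc k)
  then show ?case by (auto simp del: C_diff.simps(1))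
qed

lemma C_diff_const: "C_diff k (\<lambda>x :: real^'d. c)"
proof (induction k arbitrary: c)
  case (Suc k)
  have "partial_deriv i (\<lambda>x :: real^'d. c) = (\<lambda>x. 0)" for i
    by (rule ext) (simp add: partial_deriv_def)
  with Suc show ?case by simp
qed simp

lemma C_diff_add:
  "C_diff k f \<Longrightarrow> C_diff k g \<Longrightarrow> C_diff k (\<lambda>x. f x + g x)"
proof (induction k arbitrary: f g)
  case 0
  then show ?case by (auto intro: continuous_on_add)
next
  case (Suc k)
  have "partial_deriv i (\<lambda>x. f x + g x) = (\<lambda>x. partial_deriv i f x + partial_deriv i g x)" for i
  proof
    fix x
    have "(f has_derivative frechet_derivative f (at x)) (at x)"
      "(g has_derivative frechet_derivative g (at x)) (at x)"
      using Suc.prems by (auto simp: frechet_derivative_works)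
    from partial_deriv_eqI[OF has_derivative_add[OF this]]
    show "partial_deriv i (\<lambda>x. f x + g x) x = partial_deriv i f x + partial_deriv i g x"
      by (simp add: partial_deriv_def)
  qed
  with Suc show ?case by auto
qed

lemma partial_deriv_scaleR:
  fixes f :: "real^'d \<Rightarrow> real"
  assumes "f differentiable (at x)" "g differentiable (at x)"
  shows "partial_deriv i (\<lambda>x. f x *\<^sub>R g x) x = f x *\<^sub>R partial_deriv i g x + partial_deriv i f x *\<^sub>R g x"
proof -
  have "(f has_derivative frechet_derivative f (at x)) (at x)"
    "(g has_derivative frechet_derivative g (at x)) (at x)"
    using assms by (auto simp: frechet_derivative_works)
  from partial_deriv_eqI[OF has_derivative_scaleR[OF this]] show ?thesis
    by (simp add: partial_deriv_def)
qed

lemma C_diff_scaleR: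
  fixes f :: "real^'d \<Rightarrow> real"
  shows "C_diff k f \<Longrightarrow> C_diff k g \<Longrightarrow> C_diff k (\<lambda>x. f x *\<^sub>R g x)"
proof (induction k arbitrary: f g)
  case 0
  then show ?case by (auto intro: continuous_on_scaleR)
next
  case (Suc k)
  have "partial_deriv i (\<lambda>x. f x *\<^sub>R g x) =
      (\<lambda>x. f x *\<^sub>R partial_deriv i g x + partial_deriv i f x *\<^sub>R g x)" for i
    using Suc.prems by (auto intro!: ext partial_deriv_scaleR)
  moreover have "C_diff k f" "C_diff k g"
    using Suc.prems C_diff_lower by blast+
  ultimately show ?case
    using Suc by (auto intro!: C_diff_add)
qed

lemma C_diff_prod:
  fixes f :: "'i \<Rightarrow> real^'d \<Rightarrow> real"
  shows "(\<And>j. j \<in> A \<Longrightarrow> C_diff k (f j)) \<Longrightarrow> C_diff k (\<lambda>x. \<Prod>j\<in>A. f j x)"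
proof (induction A rule: infinite_finite_induct)
  case (insert j A)
  then have "C_diff k (\<lambda>x. f j x *\<^sub>R (\<Prod>j\<in>A. f j x))"
    by (intro C_diff_scaleR) auto
  with insert show ?case by simp
qed (auto simp: C_diff_const)

lemma partial_deriv_linear:
  assumes "bounded_linear L" "f differentiable (at x)"
  shows "partial_deriv i (\<lambda>x. L (f x)) x = L (partial_deriv i f x)"
proof -
  have "(f has_derivative frechet_derivative f (at x)) (at x)"
    using assms by (auto simp: frechet_derivative_works)
  from partial_deriv_eqI[OF bounded_linear.has_derivative[OF assms(1) this]] show ?thesis
    by (simp add: partial_deriv_def)
qed

lemma C_diff_linear:
  assumes L: "bounded_linear L"
  shows "C_diff k f \<Longrightarrow> C_diff k (\<lambda>x. L (f x))"
proof (induction k arbitrary: f)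
  case 0
  then show ?case by (auto intro: bounded_linear.continuous_on[OF L])
next
  case (Suc k)
  have "partial_deriv i (\<lambda>x. L (f x)) = (\<lambda>x. L (partial_deriv i f x))" for i
    using Suc.prems by (auto intro!: ext partial_deriv_linear[OF L])
  with Suc show ?case
    by (auto intro: differentiable_compose[OF bounded_linear_imp_differentiable[OF L], unfolded o_def])
qed

text \<open>
  The standard functions that vanish to infinite order at 0. The polynomial factor makes the
  family closed under differentiation (\<open>DERIV_flat\<close>), so smoothness needs no formula for the
  higher derivatives of \<open>exp (-1/t)\<close>.
\<close>

definition flat :: "real poly \<Rightarrow> real \<Rightarrow> real" where
  "flat P t = (if t > 0 then poly P (1 / t) * exp (- 1 / t) else 0)"

lemma poly_exp_tendsto_0: "((\<lambda>y. poly P y * exp (- y)) \<longlongrightarrow> (0::real)) at_top"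
proof -
  have "((\<lambda>y. \<Sum>i\<le>degree P. coeff P i * (y ^ i / exp y)) \<longlongrightarrow> (\<Sum>i\<le>degree P. coeff P i * 0)) at_top"
    by (intro tendsto_intros tendsto_power_div_exp_0)
  moreover have "(\<lambda>y. \<Sum>i\<le>degree P. coeff P i * (y ^ i / exp y)) = (\<lambda>y. poly P y * exp (- y))"
    by (auto simp: poly_altdef sum_distrib_right exp_minus divide_inverse mult.assoc)
  ultimately show ?thesis by simp
qed

lemma flat_tendsto_0: "(flat P \<longlongrightarrow> 0) (at_right 0)"
proof -
  have "((\<lambda>t. poly P (inverse t) * exp (- inverse t)) \<longlongrightarrow> 0) (at_right 0)"
    by (rule filterlim_compose[OF poly_exp_tendsto_0 filterlim_inverse_at_top_right])
  then show ?thesis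
    by (rule Lim_transform_eventually)
       (auto simp: eventually_at_filter flat_def inverse_eq_divide)
qed

lemma DERIV_flat:
  "(flat P has_real_derivative flat (pCons 0 (pCons 0 (P - pderiv P))) t) (at t)"
proof (rule linorder_cases[of t 0])
  assume t: "t < 0"
  have "((\<lambda>t. 0) has_real_derivative 0) (at t)" by simp
  then have "(flat P has_real_derivative 0) (at t)"
    by (rule DERIV_cong_ev[THEN iffD2, rotated -1, OF _ refl _ refl])
       (use t in \<open>auto simp: flat_def intro!: eventually_mono[OF eventually_nhds_in_open[of "{..<0}"]]\<close>)
  with t show ?thesis by (simp add: flat_def)
next
  assume t: "t > 0"
  have "((\<lambda>t. poly P (1 / t) * exp (- 1 / t)) has_real_derivative
      flat (pCons 0 (pCons 0 (P - pderiv P))) t) (at t)"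
    using t by (auto simp: flat_def field_simps power2_eq_square
        intro!: derivative_eq_intros DERIV_chain2[OF poly_DERIV])
  then show ?thesis
    by (rule DERIV_cong_ev[THEN iffD2, rotated -1, OF _ refl _ refl])
       (use t in \<open>auto simp: flat_def intro!: eventually_mono[OF eventually_nhds_in_open[of "{0<..}"]]\<close>)
next
  assume t: "t = 0"
  have "((\<lambda>h. (flat P (0 + h) - flat P 0) / h) \<longlongrightarrow> 0) (at 0)"
    unfolding filterlim_at_split
  proof
    show "((\<lambda>h. (flat P (0 + h) - flat P 0) / h) \<longlongrightarrow> 0) (at_left 0)"
      by (rule Lim_transform_eventually[OF tendsto_const])
         (auto simp: eventually_at_filter flat_def)
    show "((\<lambda>h. (flat P (0 + h) - flat P 0) / h) \<longlongrightarrow> 0) (at_right 0)"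
      by (rule Lim_transform_eventually[OF flat_tendsto_0[of "pCons 0 P"]])
         (auto simp: eventually_at_filter flat_def)
  qed
  with t show ?thesis
    by (simp add: DERIV_def flat_def)
qed

lemma C_diff_flat: "C_diff k (\<lambda>x. flat P (c * x $ i + d))"
proof (induction k arbitrary: P)
  case 0
  have "continuous_on UNIV (flat P)"
    using DERIV_flat by (auto simp: continuous_on_eq_continuous_within intro: DERIV_isCont)
  then show ?case
    by (auto intro!: continuous_intros elim!: continuous_on_compose2)
next
  case (Suc k)
  let ?Q = "pCons 0 (pCons 0 (P - pderiv P))"
  have deriv: "((\<lambda>x. flat P (c * x $ i + d)) has_derivative (\<lambda>h. flat ?Q (c * x $ i + d) * (c * h $ i))) (at x)" for x
  proof -
    have "((\<lambda>x. c * x $ i + d) has_derivative (\<lambda>h. c * h $ i)) (at x)"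
      by (auto intro!: derivative_eq_intros bounded_linear.has_derivative[OF bounded_linear_vec_nth])
    from diff_chain_at[OF this DERIV_flat[unfolded has_field_derivative_def]] show ?thesis
      by (simp add: o_def)
  qed
  have "partial_deriv j (\<lambda>x. flat P (c * x $ i + d)) =
      (\<lambda>x. (c * axis j 1 $ i) *\<^sub>R flat ?Q (c * x $ i + d))" for j
    by (auto simp: partial_deriv_eqI[OF deriv])
  then show ?case
    using C_diff_scaleR[OF C_diff_const Suc.IH[of ?Q]] deriv by (auto intro: differentiableI)
qed

lemma test_functionsD:
  assumes "\<phi> \<in> test_functions \<Omega>"
  shows "\<phi> differentiable (at x)" "continuous_on UNIV \<phi>" "C_diff k \<phi>" "x \<notin> \<Omega> \<Longrightarrow> \<phi> x = 0"
    "continuous_on UNIV (partial_deriv i \<phi>)"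
proof -
  have C: "C_diff k \<phi>" for k using assms by (simp add: test_functions_def)
  show "\<phi> differentiable (at x)" "continuous_on UNIV \<phi>" "continuous_on UNIV (partial_deriv i \<phi>)"
    using C[of "Suc 0"] C_diff_continuous[OF C] by auto
  show "C_diff k \<phi>" by (rule C)
  show "\<phi> x = 0" if "x \<notin> \<Omega>"
    using assms that closure_subset[of "{x. \<phi> x \<noteq> 0}"] by (auto simp: test_functions_def)
qed

lemma test_functionsI:
  assumes "\<And>k. C_diff k \<phi>" "compact K" "K \<subseteq> \<Omega>" "\<And>x. x \<notin> K \<Longrightarrow> \<phi> x = 0"
  shows "\<phi> \<in> test_functions \<Omega>"
proof -
  have "closure {x. \<phi> x \<noteq> 0} \<subseteq> K"
    using assms by (intro closure_minimal) (auto intro: compact_imp_closed)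
  with assms show ?thesis
    unfolding test_functions_def
    by (auto simp: compact_closure intro: bounded_subset[OF compact_imp_bounded[OF assms(2)]])
qed

lemma test_functionsE:
  assumes "\<phi> \<in> test_functions \<Omega>"
  obtains K where "compact K" "K \<subseteq> \<Omega>" "\<And>x. x \<notin> K \<Longrightarrow> \<phi> x = 0"
proof
  show "compact (closure {x. \<phi> x \<noteq> 0})" "closure {x. \<phi> x \<noteq> 0} \<subseteq> \<Omega>"
    using assms by (auto simp: test_functions_def)
  show "\<And>x. x \<notin> closure {x. \<phi> x \<noteq> 0} \<Longrightarrow> \<phi> x = 0"
    using closure_subset[of "{x. \<phi> x \<noteq> 0}"] by blast
qed

lemma partial_deriv_eq_0:
  assumes "closed K" "\<And>x. x \<notin> K \<Longrightarrow> f x = 0" "x \<notin> K"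
  shows "partial_deriv i f x = 0"
proof -
  have "((\<lambda>x. 0) has_derivative (\<lambda>h. 0)) (at x)" by simp
  then have "(f has_derivative (\<lambda>h. 0)) (at x)"
    by (rule has_derivative_transform_within_open[of _ _ _ _ "- K"]) (use assms in auto)
  from partial_deriv_eqI[OF this] show ?thesis by simp
qed

lemma test_functions_partial_deriv:
  assumes "\<phi> \<in> test_functions \<Omega>"
  shows "partial_deriv i \<phi> \<in> test_functions \<Omega>"
proof -
  obtain K where K: "compact K" "K \<subseteq> \<Omega>" "\<And>x. x \<notin> K \<Longrightarrow> \<phi> x = 0"
    using test_functionsE[OF assms] by blast
  have "C_diff k (partial_deriv i \<phi>)" for k
    using test_functionsD(3)[OF assms, of "Suc k"] by simp
  with K show ?thesis
    by (intro test_functionsI[of _ K]) (auto intro: partial_deriv_eq_0 compact_imp_closed)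
qed

lemma test_functions_linear:
  assumes "\<phi> \<in> test_functions \<Omega>" "bounded_linear L"
  shows "(\<lambda>x. L (\<phi> x)) \<in> test_functions \<Omega>"
proof -
  obtain K where K: "compact K" "K \<subseteq> \<Omega>" "\<And>x. x \<notin> K \<Longrightarrow> \<phi> x = 0"
    using test_functionsE[OF assms(1)] by blast
  with assms show ?thesis
    by (intro test_functionsI[of _ K])
       (auto intro: C_diff_linear test_functionsD(3) simp: linear_0[OF bounded_linear.linear])
qed

lemma test_functions_add:
  assumes "\<phi> \<in> test_functions \<Omega>" "\<psi> \<in> test_functions \<Omega>"
  shows "(\<lambda>x. \<phi> x + \<psi> x) \<in> test_functions \<Omega>"
proof -
  obtain K where K: "compact K" "K \<subseteq> \<Omega>" "\<And>x. x \<notin> K \<Longrightarrow> \<phi> x = 0"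
    using test_functionsE[OF assms(1)] by blast
  obtain K' where K': "compact K'" "K' \<subseteq> \<Omega>" "\<And>x. x \<notin> K' \<Longrightarrow> \<psi> x = 0"
    using test_functionsE[OF assms(2)] by blast
  from K K' assms show ?thesis
    by (intro test_functionsI[of _ "K \<union> K'"]) (auto intro: C_diff_add test_functionsD(3))
qed

lemma test_functions_zero: "(\<lambda>x. 0) \<in> test_functions \<Omega>"
  by (rule test_functionsI[of _ "{}"]) (auto simp: C_diff_const)

lemma integrable_continuous_compact_support:
  fixes g :: "'a::euclidean_space \<Rightarrow> 'b::euclidean_space"
  assumes "continuous_on UNIV g" "compact K" "\<And>x. x \<notin> K \<Longrightarrow> g x = 0"
  shows "integrable lborel g"
proof -
  have "set_integrable lborel K g"
    unfolding set_integrable_def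
    by (rule borel_integrable_compact) (use assms in \<open>auto intro: continuous_on_subset\<close>)
  moreover have "(\<lambda>x. indicat_real K x *\<^sub>R g x) = g"
    using assms(3) by (auto simp: indicator_def)
  ultimately show ?thesis by (simp add: set_integrable_def)
qed

lemma test_function_L2:
  assumes "\<phi> \<in> test_functions \<Omega>" "\<Omega> \<in> sets lebesgue"
  shows "\<phi> \<in> L2 \<Omega>"
proof -
  obtain K where K: "compact K" "K \<subseteq> \<Omega>" "\<And>x. x \<notin> K \<Longrightarrow> \<phi> x = 0"
    using test_functionsE[OF assms(1)] by blast
  note c = test_functionsD(2)[OF assms(1)]
  have m: "\<phi> \<in> borel_measurable borel"
    using c by (rule borel_measurable_continuous_onI)
  have "zero_ext \<Omega> \<phi> = \<phi>"
    using K by (auto simp: zero_ext_def indicator_def fun_eq_iff)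
  moreover have "integrable lborel (\<lambda>x. (norm (\<phi> x))\<^sup>2)"
    by (rule integrable_continuous_compact_support[of _ K])
       (use K c in \<open>auto intro!: continuous_intros\<close>)
  then have "\<phi> \<in> L2 UNIV"
    using m by (auto simp: L2_UNIV_iff intro!: integrable_completion[THEN iffD2] measurable_completion)
  ultimately show ?thesis
    using zero_ext_L2[OF assms(2), of \<phi>] by simp
qed

text \<open>
  The difference quotients of \<open>g\<close> have integral 0 because Lebesgue measure is translation
  invariant, and they converge boundedly to the derivative.
\<close>

lemma integral_partial_deriv_eq_0:
  fixes g :: "real^'d \<Rightarrow> 'b::euclidean_space"
  assumes diff: "\<And>x. g differentiable (at x)" and cont: "continuous_on UNIV (partial_deriv i g)"
    and K: "compact K" "\<And>x. x \<notin> K \<Longrightarrow> g x = 0"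
  shows "integral\<^sup>L lborel (partial_deriv i g) = 0"
proof -
  define e :: "real^'d" where "e = axis i 1"
  have e: "norm e = 1" by (simp add: e_def)
  have g_cont: "continuous_on UNIV g"
    using diff by (auto simp: continuous_on_eq_continuous_within intro: differentiable_imp_continuous_within)
  have pd0: "x \<notin> K \<Longrightarrow> partial_deriv i g x = 0" for x
    by (rule partial_deriv_eq_0[OF compact_imp_closed[OF K(1)] K(2)])
  have "bounded (partial_deriv i g ` K)"
    by (intro compact_imp_bounded compact_continuous_image K continuous_on_subset[OF cont]) auto
  then obtain B where "\<forall>x\<in>K. norm (partial_deriv i g x) \<le> B"
    by (auto simp: bounded_iff)
  then have B: "norm (partial_deriv i g x) \<le> \<bar>B\<bar>" for x
    using pd0[of x] by (cases "x \<in> K") auto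
  obtain R where R: "\<And>x. x \<in> K \<Longrightarrow> norm x \<le> R"
    using compact_imp_bounded[OF K(1)] by (auto simp: bounded_iff)
  have line: "((\<lambda>t. g (x + t *\<^sub>R e)) has_vector_derivative partial_deriv i g (x + t *\<^sub>R e)) (at t within S)" for x t S
  proof -
    have "((\<lambda>t. x + t *\<^sub>R e) has_derivative (\<lambda>h. h *\<^sub>R e)) (at t within S)"
      by (auto intro!: derivative_eq_intros)
    from has_derivative_in_compose[OF this, of g "frechet_derivative g (at (x + t *\<^sub>R e))"]
    have "((\<lambda>t. g (x + t *\<^sub>R e)) has_derivative (\<lambda>h. frechet_derivative g (at (x + t *\<^sub>R e)) (h *\<^sub>R e))) (at t within S)"
      using diff by (auto simp: frechet_derivative_works intro: has_derivative_at_withinI)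
    moreover have "frechet_derivative g (at y) (h *\<^sub>R e) = h *\<^sub>R partial_deriv i g y" for h y
      using linear_frechet_derivative[OF diff] by (simp add: partial_deriv_def e_def linear_cmul)
    ultimately show ?thesis by (simp add: has_vector_derivative_def)
  qed
  define q where "q n x = (g (x + (1 / real (Suc n)) *\<^sub>R e) - g x) /\<^sub>R (1 / real (Suc n))" for n x
  have q_lim: "(\<lambda>n. q n x) \<longlonglongrightarrow> partial_deriv i g x" for x
  proof -
    have "((\<lambda>t. (g (x + t *\<^sub>R e) - g x) /\<^sub>R t) \<longlongrightarrow> partial_deriv i g x) (at 0)"
      using line[of x 0 UNIV] unfolding has_vector_derivative_iff_quotient
      by (simp add: tendsto_norm_zero_iff LIM_zero_iff)
    moreover have "filterlim (\<lambda>n. 1 / real (Suc n)) (at 0) sequentially"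
      using LIMSEQ_Suc[OF lim_1_over_n] by (simp add: filterlim_at)
    ultimately show ?thesis
      unfolding q_def by (rule filterlim_compose)
  qed
  have q_int: "integral\<^sup>L lborel (q n) = 0" for n
  proof -
    let ?c = "(1 / real (Suc n)) *\<^sub>R e"
    have g_int: "integrable lborel g"
      by (rule integrable_continuous_compact_support[OF g_cont K])
    have g_m: "g \<in> borel_measurable borel"
      using g_cont by (rule borel_measurable_continuous_onI)
    have sh: "integral\<^sup>L lborel (\<lambda>x. g (?c + x)) = integral\<^sup>L lborel g"
      using g_m by (subst (2) lborel_distr_plus[of ?c, symmetric]) (simp add: integral_distr)
    have sh_int: "integrable lborel (\<lambda>x. g (?c + x))"
      using g_int g_m by (subst (asm) lborel_distr_plus[of ?c, symmetric]) (simp add: integrable_distr_eq)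
    show ?thesis
      using g_int sh sh_int unfolding q_def by (simp add: add.commute)
  qed
  have bound: "norm (q n x) \<le> \<bar>B\<bar> * indicator (cball 0 (R + 1)) x" for n x
  proof (cases "x \<in> cball 0 (R + 1)")
    case True
    have "norm (g (x + (1 / real (Suc n)) *\<^sub>R e) - g (x + 0 *\<^sub>R e)) \<le> \<bar>B\<bar> * \<bar>1 / real (Suc n) - 0\<bar>"
      by (rule vector_derivative_bound[where S=UNIV and f'="\<lambda>t. partial_deriv i g (x + t *\<^sub>R e)"])
         (use line B in auto)
    then have "norm (q n x) \<le> \<bar>B\<bar>"
      unfolding q_def norm_scaleR by (simp add: field_simps)
    with True show ?thesis by simp
  next
    case False
    then have x: "norm x > R + 1" by simp
    have "norm (x + (1 / real (Suc n)) *\<^sub>R e) \<ge> norm x - norm ((1 / real (Suc n)) *\<^sub>R e)"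
      using norm_triangle_ineq4[of "x + (1 / real (Suc n)) *\<^sub>R e" "(1 / real (Suc n)) *\<^sub>R e"] by simp
    moreover have "norm ((1 / real (Suc n)) *\<^sub>R e) \<le> 1"
      using e by simp
    ultimately have "norm (x + (1 / real (Suc n)) *\<^sub>R e) > R"
      using x by linarith
    then have "g (x + (1 / real (Suc n)) *\<^sub>R e) = 0" "g x = 0"
      using R x by (force intro!: K(2))+
    then show ?thesis by (simp add: q_def)
  qed
  have "(\<lambda>n. integral\<^sup>L lborel (q n)) \<longlonglongrightarrow> integral\<^sup>L lborel (partial_deriv i g)"
  proof (rule integral_dominated_convergence[where w="\<lambda>x. \<bar>B\<bar> * indicator (cball 0 (R + 1)) x"])
    show "partial_deriv i g \<in> borel_measurable lborel"
      using borel_measurable_continuous_onI[OF cont] by simp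
    show "q n \<in> borel_measurable lborel" for n
    proof -
      have "continuous_on UNIV (q n)"
        unfolding q_def by (intro continuous_intros continuous_on_compose2[OF g_cont]) auto
      then show ?thesis using borel_measurable_continuous_onI by simp
    qed
    show "integrable lborel (\<lambda>x. \<bar>B\<bar> * indicator (cball 0 (R + 1)) x :: real)"
      by (intro integrable_mult_right integrable_real_indicator emeasure_bounded_finite) auto
  qed (use q_lim bound in auto)
  then show ?thesis
    by (simp add: q_int LIMSEQ_const_iff)
qed

section \<open>Uniqueness of weak derivatives\<close>

text \<open>
  The positive and the negative part of \<open>h\<close> are densities of two finite measures. They agree on
  boxes, which form a generator of the Borel sets that is closed under intersection.
\<close>

lemma AE_0_if_box_integrals_0:
  fixes h :: "'a::euclidean_space \<Rightarrow> real"
  assumes h: "integrable lborel h"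
    and 0: "\<And>a b. (LINT x|lborel. indicator (box a b) x * h x) = 0"
  shows "AE x in lborel. h x = 0"
proof -
  let ?M = "density lborel (\<lambda>x. ennreal (h x))" and ?N = "density lborel (\<lambda>x. ennreal (- h x))"
  have [measurable]: "h \<in> borel_measurable borel"
    using h by auto
  have "?M = ?N"
  proof (rule measure_eqI_generator_eq)
    let ?E = "range (\<lambda>(a, b). box a b :: 'a set)"
    let ?A = "\<lambda>n::nat. box (- (real n *\<^sub>R One)) (real n *\<^sub>R One) :: 'a set"
    show "Int_stable ?E"
      by (auto simp: Int_stable_def box_Int_box)
    show "?E \<subseteq> Pow UNIV" "sets ?M = sigma_sets UNIV ?E" "sets ?N = sigma_sets UNIV ?E"
      by (simp_all add: borel_eq_box)
    show "range ?A \<subseteq> ?E" "(\<Union>i. ?A i) = UNIV"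
      unfolding UN_box_eq_UNIV by auto
    have fin: "(\<integral>\<^sup>+x. ennreal (h x) * indicator X x \<partial>lborel) < \<infinity>"
      "(\<integral>\<^sup>+x. ennreal (- h x) * indicator X x \<partial>lborel) < \<infinity>" for X :: "'a set"
    proof -
      have fin: "(\<integral>\<^sup>+x. ennreal \<bar>h x\<bar> \<partial>lborel) < \<infinity>"
        using h by (simp add: integrable_iff_bounded)
      show "(\<integral>\<^sup>+x. ennreal (h x) * indicator X x \<partial>lborel) < \<infinity>"
        by (rule le_less_trans[OF nn_integral_mono fin]) (auto simp: indicator_def ennreal_leI)
      show "(\<integral>\<^sup>+x. ennreal (- h x) * indicator X x \<partial>lborel) < \<infinity>"
        by (rule le_less_trans[OF nn_integral_mono fin]) (auto simp: indicator_def ennreal_leI)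
    qed
    show "emeasure ?M (?A i) \<noteq> \<infinity>" for i
      using fin(1)[of "?A i"] by (auto simp: emeasure_density)
    show "emeasure ?M X = emeasure ?N X" if "X \<in> ?E" for X
    proof -
      from that obtain a b where X: "X = box a b" by auto
      have int: "integrable lborel (\<lambda>x. indicator X x * h x)"
        using integrable_real_mult_indicator[OF _ h, of X] X by (simp add: mult.commute)
      have eq: "ennreal (indicator X x * h x) = ennreal (h x) * indicator X x"
        "ennreal (- (indicator X x * h x)) = ennreal (- h x) * indicator X x" for x
        by (auto simp: indicator_def)
      have M: "emeasure ?M X = (\<integral>\<^sup>+x. ennreal (indicator X x * h x) \<partial>lborel)"
        "emeasure ?N X = (\<integral>\<^sup>+x. ennreal (- (indicator X x * h x)) \<partial>lborel)"
        unfolding eq using X by (simp_all add: emeasure_density)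
      have "enn2real (emeasure ?M X) - enn2real (emeasure ?N X) = 0"
        using 0[of a b, folded X] real_lebesgue_integral_def[OF int] unfolding M by simp
      moreover have "emeasure ?M X < \<infinity>" "emeasure ?N X < \<infinity>"
        using fin[of X] unfolding M eq by auto
      ultimately show ?thesis
        by (metis ennreal_enn2real eq_iff_diff_eq_0 infinity_ennreal_def)
    qed
  qed
  then have "AE x in lborel. ennreal (h x) = ennreal (- h x)"
    by (subst (asm) sigma_finite_measure.density_unique_iff[OF sigma_finite_lborel]) auto
  then show ?thesis
  proof eventually_elim
    case (elim x)
    then show ?case
      by (cases "h x" "0 :: real" rule: linorder_cases)
         (auto simp: ennreal_neg ennreal_eq_0_iff dest: sym)
  qed
qed

lemma C_diff_mult:
  fixes f g :: "real^'d \<Rightarrow> real"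
  shows "C_diff k f \<Longrightarrow> C_diff k g \<Longrightarrow> C_diff k (\<lambda>x. f x * g x)"
  using C_diff_scaleR[of k f g] by simp

text \<open>
  Scaling the argument of \<open>flat 1\<close>, i.e. of \<open>exp (-1/t)\<close> for \<open>t > 0\<close>, by \<open>n\<close> makes it tend to the
  indicator of the positive half line without exceeding 1.
\<close>

lemma box_indicator_limit_of_test_functions:
  assumes "cbox a b \<subseteq> \<Omega>"
  obtains \<phi> :: "nat \<Rightarrow> real^'d \<Rightarrow> real" where
    "\<And>n. \<phi> n \<in> test_functions \<Omega>" "\<And>n x. \<bar>\<phi> n x\<bar> \<le> 1"
    "\<And>x. (\<lambda>n. \<phi> n x) \<longlonglongrightarrow> indicator (box a b) x"
proof
  define \<phi> where "\<phi> n x = (\<Prod>i\<in>UNIV. flat 1 (real n * x $ i + - real n * a $ i) *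
      flat 1 (- real n * x $ i + real n * b $ i))" for n and x :: "real^'d"
  have flat1: "0 \<le> flat 1 t" "flat 1 t \<le> 1" for t
    by (auto simp: flat_def)
  have flat_lim: "(\<lambda>n. flat 1 (real n * s)) \<longlonglongrightarrow> indicator {0<..} s" for s
  proof (cases "s > 0")
    case True
    have "(\<lambda>n. exp (- (1 / s) * (1 / real n))) \<longlonglongrightarrow> exp (- (1 / s) * 0)"
      by (intro tendsto_intros lim_1_over_n)
    then have "(\<lambda>n. flat 1 (real n * s)) \<longlonglongrightarrow> exp (- (1 / s) * 0)"
      by (rule Lim_transform_eventually)
         (use True in \<open>auto simp: flat_def field_simps intro!: eventually_mono[OF eventually_gt_at_top[of 0]]\<close>)
    with True show ?thesis by simp
  next
    case False
    then have "flat 1 (real n * s) = 0" for n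
      by (auto simp: flat_def zero_less_mult_iff)
    with False show ?thesis by simp
  qed
  have eq: "real n * x $ i + - real n * a $ i = real n * (x $ i - a $ i)"
    "- real n * x $ i + real n * b $ i = real n * (b $ i - x $ i)" for n i and x :: "real^'d"
    by (simp_all add: algebra_simps)
  show "\<phi> n \<in> test_functions \<Omega>" for n
  proof (rule test_functionsI)
    show "C_diff k (\<phi> n)" for k
      unfolding \<phi>_def
      by (intro C_diff_prod C_diff_mult C_diff_flat)
    show "\<phi> n x = 0" if "x \<notin> cbox a b" for x
    proof -
      from that obtain i where "x $ i < a $ i \<or> b $ i < x $ i"
        by (auto simp: mem_box_cart not_le)
      then show ?thesis
        unfolding \<phi>_def eq by (intro prod_zero bexI[of _ i]) (auto simp: flat_def zero_less_mult_iff)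
    qed
  qed (use assms in auto)
  show "\<bar>\<phi> n x\<bar> \<le> 1" for n x
  proof -
    have "0 \<le> \<phi> n x" "\<phi> n x \<le> 1"
      unfolding \<phi>_def by (auto intro!: prod_nonneg prod_le_1 mult_nonneg_nonneg mult_le_one simp: flat1)
    then show ?thesis by simp
  qed
  show "(\<lambda>n. \<phi> n x) \<longlonglongrightarrow> indicator (box a b) x" for x
  proof -
    have "(\<lambda>n. \<phi> n x) \<longlonglongrightarrow> (\<Prod>i\<in>UNIV. indicator {0<..} (x $ i - a $ i) * indicator {0<..} (b $ i - x $ i))"
      unfolding \<phi>_def eq by (intro tendsto_prod tendsto_mult flat_lim)
    also have "(\<Prod>i\<in>UNIV. indicator {0<..} (x $ i - a $ i) * indicator {0<..} (b $ i - x $ i)) =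
        (indicator (box a b) x :: real)"
    proof (cases "x \<in> box a b")
      case False
      then obtain i where "\<not> (a $ i < x $ i \<and> x $ i < b $ i)"
        by (auto simp: mem_box_cart)
      then have "indicator {0<..} (x $ i - a $ i) * indicator {0<..} (b $ i - x $ i) = (0 :: real)"
        by (auto simp: indicator_def)
      then have "(\<Prod>i\<in>UNIV. indicator {0<..} (x $ i - a $ i) * indicator {0<..} (b $ i - x $ i)) = (0 :: real)"
        by (intro prod_zero) auto
      with False show ?thesis by simp
    qed (auto simp: mem_box_cart)
    finally show ?thesis .
  qed
qed

lemma L2_integrable:
  assumes "f \<in> L2 \<Omega>" "bounded \<Omega>" "\<Omega> \<in> sets lebesgue"
  shows "integrable (lebesgue_on \<Omega>) f"
proof -
  note [measurable] = L2_measurable[OF assms(1)]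
  have "\<Omega> \<in> lmeasurable"
    using assms bounded_set_imp_lmeasurable by blast
  then have "integrable (lebesgue_on \<Omega>) (\<lambda>x. 1 + (norm (f x))\<^sup>2)"
    using assms(1) by (auto simp: L2_def intro!: finite_measure.integrable_const finite_measure_lebesgue_on)
  then show ?thesis
  proof (rule Bochner_Integration.integrable_bound)
    have "norm v \<le> norm (1 + (norm v)\<^sup>2)" for v :: 'b
    proof -
      have "2 * norm v \<le> (norm v)\<^sup>2 + 1"
        using sum_squares_bound[of "norm v" 1] by simp
      moreover have "0 \<le> norm v" by simp
      ultimately have "norm v \<le> 1 + (norm v)\<^sup>2" by linarith
      then show ?thesis by simp
    qed
    then show "AE x in lebesgue_on \<Omega>. norm (f x) \<le> norm (1 + (norm (f x))\<^sup>2)" by simp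
  qed simp
qed

text \<open>
  Testing with functions that approximate the indicator of a box shows that the integral of \<open>g\<close> over
  every box compactly contained in the domain vanishes. Countably many such boxes cover the domain;
  on each of them the previous criterion applies to the components of \<open>g\<close>.
\<close>

lemma fundamental_lemma:
  fixes g :: "real^'d \<Rightarrow> 'b::euclidean_space"
  assumes \<Omega>: "open \<Omega>" "bounded \<Omega>" and g: "g \<in> L2 \<Omega>"
    and 0: "\<And>\<phi>. \<phi> \<in> test_functions \<Omega> \<Longrightarrow> (LINT x|lebesgue_on \<Omega>. \<phi> x *\<^sub>R g x) = 0"
  shows "AE x in lebesgue_on \<Omega>. g x = 0"
proof -
  have \<Omega>_sets: "\<Omega> \<in> sets lebesgue" using \<Omega> by auto
  have g_int: "integrable (lebesgue_on \<Omega>) g"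
    by (rule L2_integrable[OF g \<Omega>(2) \<Omega>_sets])
  note [measurable] = L2_measurable[OF g]
  have box_0: "(LINT x|lebesgue_on \<Omega>. indicator (box a b) x *\<^sub>R g x) = 0" if ab: "cbox a b \<subseteq> \<Omega>" for a b
  proof -
    obtain \<phi> :: "nat \<Rightarrow> real^'d \<Rightarrow> real" where \<phi>: "\<And>n. \<phi> n \<in> test_functions \<Omega>" "\<And>n x. \<bar>\<phi> n x\<bar> \<le> 1"
      "\<And>x. (\<lambda>n. \<phi> n x) \<longlonglongrightarrow> indicator (box a b) x"
      using box_indicator_limit_of_test_functions[OF ab] by blast
    have [measurable]: "\<phi> n \<in> borel_measurable (lebesgue_on \<Omega>)" for n
      using test_function_L2[OF \<phi>(1) \<Omega>_sets] by (rule L2_measurable)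
    have "(\<lambda>n. LINT x|lebesgue_on \<Omega>. \<phi> n x *\<^sub>R g x) \<longlonglongrightarrow> (LINT x|lebesgue_on \<Omega>. indicator (box a b) x *\<^sub>R g x)"
    proof (rule integral_dominated_convergence[where w="\<lambda>x. norm (g x)"])
      have "indicat_real (box a b) \<in> borel_measurable (lebesgue_on \<Omega>)"
        by (intro measurable_restrict_space1 measurable_completion borel_measurable_indicator) simp
      then show "(\<lambda>x. indicat_real (box a b) x *\<^sub>R g x) \<in> borel_measurable (lebesgue_on \<Omega>)"
        by measurable
      show "AE x in lebesgue_on \<Omega>. norm (\<phi> n x *\<^sub>R g x) \<le> norm (g x)" for n
        using \<phi>(2) by (intro AE_I2) (simp add: mult_left_le_one_le)
    qed (use g_int \<phi>(3) in \<open>auto intro!: tendsto_intros\<close>)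
    then show ?thesis
      using 0[OF \<phi>(1)] by (simp add: LIMSEQ_const_iff)
  qed
  have comp_0: "AE x in lebesgue. x \<in> box a b \<longrightarrow> g x \<bullet> e = 0" if ab: "cbox a b \<subseteq> \<Omega>" for a b e
  proof -
    have ab': "box a b \<subseteq> \<Omega>" using ab box_subset_cbox by blast
    define h where "h x = indicator (box a b) x * (g x \<bullet> e)" for x
    have gi: "integrable lebesgue (\<lambda>x. indicator \<Omega> x *\<^sub>R g x)"
      using g_int \<Omega>_sets by (subst (asm) integrable_restrict_space) auto
    have h_int: "integrable lebesgue h"
    proof -
      have "integrable lebesgue (\<lambda>x. indicator (box a b) x *\<^sub>R (indicator \<Omega> x *\<^sub>R g x) \<bullet> e)"
        by (intro integrable_inner_left integrable_mult_indicator gi) simp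
      moreover have "(\<lambda>x. indicator (box a b) x *\<^sub>R (indicator \<Omega> x *\<^sub>R g x) \<bullet> e) = h"
        using ab' by (auto simp: h_def indicator_def fun_eq_iff)
      ultimately show ?thesis by simp
    qed
    \<comment> \<open>The criterion for boxes needs a Borel representative.\<close>
    obtain k where k: "k \<in> borel_measurable lborel" "AE x in lborel. h x = k x"
      using completion_ex_borel_measurable_real[of h lborel] h_int by auto
    have kh: "AE x in lebesgue. h x = k x"
      using k(2) by (rule AE_completion)
    have km: "k \<in> borel_measurable lebesgue"
      using k(1) by (rule measurable_completion)
    have k_int: "integrable lborel k"
    proof -
      have "integrable lebesgue k"
        using integrable_cong_AE[of h lebesgue k] h_int km kh by auto
      then show ?thesis using k(1) by (simp add: integrable_completion)
    qed
    have "AE x in lborel. k x = 0"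
    proof (rule AE_0_if_box_integrals_0[OF k_int])
      fix c d :: "real^'d"
      obtain p q where pq: "box a b \<inter> box c d = box p q" "cbox a b \<inter> cbox c d = cbox p q"
        using box_Int_box[of a b c d] Int_interval[of a b c d] by blast
      then have pq': "cbox p q \<subseteq> \<Omega>" using ab by blast
      have "(LINT x|lborel. indicator (box c d) x * k x) = (LINT x|lebesgue. indicator (box c d) x * k x)"
        using k(1) by (intro integral_completion[symmetric]) auto
      also have "\<dots> = (LINT x|lebesgue. indicator (box c d) x * h x)"
        by (rule integral_cong_AE)
           (use kh km h_int in \<open>auto intro!: borel_measurable_times borel_measurable_indicator elim: eventually_mono\<close>)
      also have "\<dots> = (LINT x|lebesgue. indicator \<Omega> x *\<^sub>R (indicator (box p q) x *\<^sub>R g x) \<bullet> e)"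
        using ab' unfolding pq(1)[symmetric]
        by (intro Bochner_Integration.integral_cong) (auto simp: h_def indicator_def)
      also have "\<dots> = (LINT x|lebesgue. indicator \<Omega> x *\<^sub>R (indicator (box p q) x *\<^sub>R g x)) \<bullet> e"
      proof (rule integral_inner_left)
        have "(\<lambda>x. indicator \<Omega> x *\<^sub>R indicator (box p q) x *\<^sub>R g x) = (\<lambda>x. indicator (box p q) x *\<^sub>R indicator \<Omega> x *\<^sub>R g x)"
          by (auto simp: fun_eq_iff)
        moreover have "integrable lebesgue (\<lambda>x. indicator (box p q) x *\<^sub>R indicator \<Omega> x *\<^sub>R g x)"
          by (intro integrable_mult_indicator gi) simp
        ultimately show "integrable lebesgue (\<lambda>x. indicator \<Omega> x *\<^sub>R indicator (box p q) x *\<^sub>R g x)" by simp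
      qed
      also have "(LINT x|lebesgue. indicator \<Omega> x *\<^sub>R (indicator (box p q) x *\<^sub>R g x)) = 0"
        using box_0[OF pq'] \<Omega>_sets by (subst (asm) integral_restrict_space) auto
      finally show "(LINT x|lborel. indicator (box c d) x * k x) = 0" by simp
    qed
    then have "AE x in lebesgue. k x = 0" by (rule AE_completion)
    with kh show ?thesis
      by eventually_elim (auto simp: h_def)
  qed
  obtain \<D> where \<D>: "countable \<D>" "\<D> \<subseteq> Pow \<Omega>" "\<And>X. X \<in> \<D> \<Longrightarrow> \<exists>a b. X = cbox a b" "\<Union>\<D> = \<Omega>"
    using open_countable_Union_open_cbox[OF \<Omega>(1)] by blast
  have "AE x in lebesgue. \<forall>X\<in>\<D>. x \<in> X \<longrightarrow> g x = 0"
    unfolding AE_ball_countable[OF \<D>(1)]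
  proof
    fix X assume X: "X \<in> \<D>"
    then obtain a b where ab: "X = cbox a b" using \<D>(3) by blast
    have "AE x in lebesgue. \<forall>e\<in>Basis. x \<in> box a b \<longrightarrow> g x \<bullet> e = 0"
      using X ab \<D>(2) by (intro AE_finite_allI comp_0) auto
    moreover have "AE x in lebesgue. x \<notin> cbox a b - box a b"
    proof -
      have "negligible (cbox a b - box a b)"
        by (rule negligible_frontier_interval)
      then show ?thesis unfolding negligible_iff_null_sets by (rule AE_not_in)
    qed
    ultimately show "AE x in lebesgue. x \<in> X \<longrightarrow> g x = 0"
      by eventually_elim (auto simp: ab euclidean_all_zero_iff)
  qed
  then have "AE x in lebesgue. x \<in> \<Omega> \<longrightarrow> g x = 0"
    by eventually_elim (use \<D>(4) in auto)
  then show ?thesis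
    using \<Omega>_sets by (subst AE_restrict_space_iff) auto
qed

lemma L2_integrable_scaleR:
  fixes f :: "'a::euclidean_space \<Rightarrow> real"
  assumes "f \<in> L2 \<Omega>" "g \<in> L2 \<Omega>"
  shows "integrable (lebesgue_on \<Omega>) (\<lambda>x. f x *\<^sub>R g x)"
proof -
  note [measurable] = assms[THEN L2_measurable]
  have *: "norm (a *\<^sub>R b) \<le> norm ((norm a)\<^sup>2 + (norm b)\<^sup>2)" for a :: real and b :: 'b
  proof -
    have "2 * (\<bar>a\<bar> * norm b) \<le> (norm a)\<^sup>2 + (norm b)\<^sup>2"
      using sum_squares_bound[of "\<bar>a\<bar>" "norm b"] by simp
    moreover have "0 \<le> \<bar>a\<bar> * norm b" by simp
    ultimately have "\<bar>a\<bar> * norm b \<le> (norm a)\<^sup>2 + (norm b)\<^sup>2" by linarith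
    then show ?thesis by simp
  qed
  have "integrable (lebesgue_on \<Omega>) (\<lambda>x. (norm (f x))\<^sup>2 + (norm (g x))\<^sup>2)"
    using assms by (auto simp: L2_def)
  then show ?thesis
    by (rule Bochner_Integration.integrable_bound) (use * in auto)
qed

lemma L2_linear:
  assumes "bounded_linear L" "f \<in> L2 \<Omega>"
  shows "(\<lambda>x. L (f x)) \<in> L2 \<Omega>"
proof -
  obtain K where K: "\<And>v. norm (L v) \<le> norm v * K"
    using bounded_linear.bounded[OF assms(1)] by blast
  note [measurable] = L2_measurable[OF assms(2)]
  have [measurable]: "L \<in> borel_measurable borel"
    by (intro borel_measurable_continuous_onI linear_continuous_on assms(1))
  have "integrable (lebesgue_on \<Omega>) (\<lambda>x. K\<^sup>2 * (norm (f x))\<^sup>2)"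
    using assms(2) by (auto simp: L2_def)
  then have "integrable (lebesgue_on \<Omega>) (\<lambda>x. (norm (L (f x)))\<^sup>2)"
  proof (rule Bochner_Integration.integrable_bound)
    have "(norm (L v))\<^sup>2 \<le> K\<^sup>2 * (norm v)\<^sup>2" for v
      using power_mono[OF K[of v] norm_ge_zero, of 2] by (simp add: power_mult_distrib mult.commute)
    then show "AE x in lebesgue_on \<Omega>. norm ((norm (L (f x)))\<^sup>2) \<le> norm (K\<^sup>2 * (norm (f x))\<^sup>2)"
      by simp
  qed measurable
  then show ?thesis by (simp add: L2_def)
qed

lemma partials_test_functions:
  "\<phi> \<in> test_functions \<Omega> \<Longrightarrow> partials is \<phi> \<in> test_functions \<Omega>"
  by (induction "is") (auto simp: partials_def intro: test_functions_partial_deriv)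

lemma finite_multiindices: "finite {is :: 'd::finite list. length is \<le> m}"
  using finite_lists_length_le[of "UNIV :: 'd set" m] by simp

locale bounded_open_set =
  fixes \<Omega> :: "(real^'d) set"
  assumes open_\<Omega>: "open \<Omega>" and bounded_\<Omega>: "bounded \<Omega>"
begin

lemma sets_\<Omega>: "\<Omega> \<in> sets lebesgue"
  using open_\<Omega> by auto

abbreviation cls :: "(real^'d \<Rightarrow> 'b::euclidean_space) \<Rightarrow> (real^'d, 'b) l2" where
  "cls \<equiv> l2_class \<Omega>"

lemmas cls_add = l2_class_add[OF sets_\<Omega>]
lemmas cls_diff = l2_class_diff[OF sets_\<Omega>]
lemmas cls_scaleR = l2_class_scaleR[OF sets_\<Omega> _ L2_zero]
lemmas inner_cls = inner_l2_class[OF sets_\<Omega>]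
lemmas norm_cls = norm_l2_class[OF sets_\<Omega>]
lemmas cls_eq_iff = l2_class_eq_iff[OF sets_\<Omega>]
lemmas cls_sum = l2_class_sum[OF sets_\<Omega>]
lemmas test_L2 = test_function_L2[OF _ sets_\<Omega>]

lemma weak_deriv_unique:
  assumes "is_weak_deriv \<Omega> is v g" "is_weak_deriv \<Omega> is v g'" "g \<in> L2 \<Omega>" "g' \<in> L2 \<Omega>"
  shows "AE x in lebesgue_on \<Omega>. g x = g' x"
proof -
  have "AE x in lebesgue_on \<Omega>. g x - g' x = 0"
  proof (rule fundamental_lemma[OF open_\<Omega> bounded_\<Omega>])
    show "(\<lambda>x. g x - g' x) \<in> L2 \<Omega>" using assms by (intro L2_diff)
    fix \<phi> :: "real^'d \<Rightarrow> real" assume \<phi>: "\<phi> \<in> test_functions \<Omega>"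
    have "(LINT x|lebesgue_on \<Omega>. \<phi> x *\<^sub>R g x) = (LINT x|lebesgue_on \<Omega>. \<phi> x *\<^sub>R g' x)"
    proof -
      have "(-1) ^ length is *\<^sub>R (LINT x|lebesgue_on \<Omega>. \<phi> x *\<^sub>R g x) =
          ((-1) ^ length is :: real) *\<^sub>R (LINT x|lebesgue_on \<Omega>. \<phi> x *\<^sub>R g' x)"
        using bspec[OF assms(1)[unfolded is_weak_deriv_def] \<phi>] bspec[OF assms(2)[unfolded is_weak_deriv_def] \<phi>]
        by (rule trans[OF sym])
      then show ?thesis by simp
    qed
    then show "(LINT x|lebesgue_on \<Omega>. \<phi> x *\<^sub>R (g x - g' x)) = 0"
      using assms \<phi> by (simp add: scaleR_diff_right L2_integrable_scaleR test_L2)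
  qed
  then show ?thesis by simp
qed

lemma weak_deriv_spec:
  assumes "v \<in> H_space \<Omega> m" "length is \<le> m"
  shows weak_deriv_L2: "weak_deriv \<Omega> is v \<in> L2 \<Omega>"
    and is_weak_deriv_weak_deriv: "is_weak_deriv \<Omega> is v (weak_deriv \<Omega> is v)"
proof -
  have "\<exists>g. g \<in> L2 \<Omega> \<and> is_weak_deriv \<Omega> is v g"
    using assms by (auto simp: H_space_def)
  from someI_ex[OF this] show "weak_deriv \<Omega> is v \<in> L2 \<Omega>" "is_weak_deriv \<Omega> is v (weak_deriv \<Omega> is v)"
    by (auto simp: weak_deriv_def)
qed

lemma H_space_L2: "v \<in> H_space \<Omega> m \<Longrightarrow> v \<in> L2 \<Omega>"
  by (simp add: H_space_def)

lemma H_space_mono: "v \<in> H_space \<Omega> m \<Longrightarrow> k \<le> m \<Longrightarrow> v \<in> H_space \<Omega> k"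
  by (auto simp: H_space_def)

text \<open>
  The derivative that the choice operator picks is only determined up to a null set; its class
  is canonical, and linear in the function (\<open>D_combination\<close>).
\<close>

definition D :: "'d list \<Rightarrow> (real^'d \<Rightarrow> 'b::euclidean_space) \<Rightarrow> (real^'d, 'b) l2" where
  "D is v = cls (weak_deriv \<Omega> is v)"

lemma weak_deriv_AE_eqI:
  assumes "g \<in> L2 \<Omega>" "is_weak_deriv \<Omega> is v g"
  shows "AE x in lebesgue_on \<Omega>. weak_deriv \<Omega> is v x = g x"
proof -
  have "\<exists>g. g \<in> L2 \<Omega> \<and> is_weak_deriv \<Omega> is v g"
    using assms by auto
  from someI_ex[OF this] show ?thesis
    using assms by (intro weak_deriv_unique[of "is" v]) (auto simp: weak_deriv_def)
qed

lemma is_weak_deriv_combination: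
  fixes v w g h :: "real^'d \<Rightarrow> 'b::euclidean_space"
  assumes "v \<in> L2 \<Omega>" "w \<in> L2 \<Omega>" "g \<in> L2 \<Omega>" "h \<in> L2 \<Omega>"
    and "is_weak_deriv \<Omega> is v g" "is_weak_deriv \<Omega> is w h"
  shows "is_weak_deriv \<Omega> is (\<lambda>x. a *\<^sub>R v x + b *\<^sub>R w x) (\<lambda>x. a *\<^sub>R g x + b *\<^sub>R h x)"
  unfolding is_weak_deriv_def
proof
  fix \<phi> :: "real^'d \<Rightarrow> real" assume \<phi>: "\<phi> \<in> test_functions \<Omega>"
  have comb: "(LINT x|lebesgue_on \<Omega>. \<psi> x *\<^sub>R (a *\<^sub>R k x + b *\<^sub>R l x)) =
      a *\<^sub>R (LINT x|lebesgue_on \<Omega>. \<psi> x *\<^sub>R k x) + b *\<^sub>R (LINT x|lebesgue_on \<Omega>. \<psi> x *\<^sub>R l x)"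
    if "\<psi> \<in> test_functions \<Omega>" "k \<in> L2 \<Omega>" "l \<in> L2 \<Omega>" for \<psi> :: "real^'d \<Rightarrow> real" and k l :: "real^'d \<Rightarrow> 'b"
  proof -
    have "(LINT x|lebesgue_on \<Omega>. \<psi> x *\<^sub>R (a *\<^sub>R k x + b *\<^sub>R l x)) =
        (LINT x|lebesgue_on \<Omega>. a *\<^sub>R (\<psi> x *\<^sub>R k x) + b *\<^sub>R (\<psi> x *\<^sub>R l x))"
      by (simp add: scaleR_add_right mult.commute)
    also have "\<dots> = a *\<^sub>R (LINT x|lebesgue_on \<Omega>. \<psi> x *\<^sub>R k x) + b *\<^sub>R (LINT x|lebesgue_on \<Omega>. \<psi> x *\<^sub>R l x)"
      unfolding integral_scaleR_right[symmetric]
      by (intro Bochner_Integration.integral_add integrable_scaleR_right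
          L2_integrable_scaleR[OF test_L2[OF that(1)]] that)
    finally show ?thesis .
  qed
  show "(LINT x|lebesgue_on \<Omega>. partials is \<phi> x *\<^sub>R (a *\<^sub>R v x + b *\<^sub>R w x)) =
      (-1) ^ length is *\<^sub>R (LINT x|lebesgue_on \<Omega>. \<phi> x *\<^sub>R (a *\<^sub>R g x + b *\<^sub>R h x))"
    unfolding comb[OF \<phi> assms(3,4)] comb[OF partials_test_functions[OF \<phi>] assms(1,2)]
    using bspec[OF assms(5)[unfolded is_weak_deriv_def] \<phi>] bspec[OF assms(6)[unfolded is_weak_deriv_def] \<phi>]
    by (simp add: scaleR_add_right mult.commute)
qed

lemma H_space_combination:
  assumes "v \<in> H_space \<Omega> m" "w \<in> H_space \<Omega> m"
  shows "(\<lambda>x. a *\<^sub>R v x + b *\<^sub>R w x) \<in> H_space \<Omega> m"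
  unfolding H_space_def
proof (intro CollectI conjI allI impI)
  show "(\<lambda>x. a *\<^sub>R v x + b *\<^sub>R w x) \<in> L2 \<Omega>"
    using assms by (intro L2_add L2_scaleR H_space_L2)
  fix "is" :: "'d list" assume "length is \<le> m"
  with assms show "\<exists>g\<in>L2 \<Omega>. is_weak_deriv \<Omega> is (\<lambda>x. a *\<^sub>R v x + b *\<^sub>R w x) g"
    by (intro bexI[of _ "\<lambda>x. a *\<^sub>R weak_deriv \<Omega> is v x + b *\<^sub>R weak_deriv \<Omega> is w x"]
        is_weak_deriv_combination L2_add L2_scaleR weak_deriv_L2 is_weak_deriv_weak_deriv H_space_L2)
qed

lemma H_space_diff: "v \<in> H_space \<Omega> m \<Longrightarrow> w \<in> H_space \<Omega> m \<Longrightarrow> (\<lambda>x. v x - w x) \<in> H_space \<Omega> m"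
  using H_space_combination[of v m w 1 "-1"] by simp

lemma H_space_scaleR: "v \<in> H_space \<Omega> m \<Longrightarrow> (\<lambda>x. a *\<^sub>R v x) \<in> H_space \<Omega> m"
  using H_space_combination[of v m v a 0] by simp

lemma weak_deriv_combination:
  assumes "v \<in> H_space \<Omega> m" "w \<in> H_space \<Omega> m" "length is \<le> m"
  shows "AE x in lebesgue_on \<Omega>. weak_deriv \<Omega> is (\<lambda>x. a *\<^sub>R v x + b *\<^sub>R w x) x =
    a *\<^sub>R weak_deriv \<Omega> is v x + b *\<^sub>R weak_deriv \<Omega> is w x"
  using assms
  by (intro weak_deriv_AE_eqI is_weak_deriv_combination L2_add L2_scaleR weak_deriv_L2
      is_weak_deriv_weak_deriv H_space_L2)

lemma D_combination:
  assumes "v \<in> H_space \<Omega> m" "w \<in> H_space \<Omega> m" "length is \<le> m"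
  shows "D is (\<lambda>x. a *\<^sub>R v x + b *\<^sub>R w x) = a *\<^sub>R D is v + b *\<^sub>R D is w"
proof -
  have L2: "weak_deriv \<Omega> is v \<in> L2 \<Omega>" "weak_deriv \<Omega> is w \<in> L2 \<Omega>"
    "weak_deriv \<Omega> is (\<lambda>x. a *\<^sub>R v x + b *\<^sub>R w x) \<in> L2 \<Omega>"
    using assms H_space_combination by (auto intro!: weak_deriv_L2)
  then have "D is (\<lambda>x. a *\<^sub>R v x + b *\<^sub>R w x) = cls (\<lambda>x. a *\<^sub>R weak_deriv \<Omega> is v x + b *\<^sub>R weak_deriv \<Omega> is w x)"
    unfolding D_def by (subst cls_eq_iff) (auto intro!: L2_add L2_scaleR weak_deriv_combination[OF assms])
  also have "\<dots> = a *\<^sub>R D is v + b *\<^sub>R D is w"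
    using L2 by (simp add: D_def cls_add cls_scaleR L2_scaleR)
  finally show ?thesis .
qed

lemma D_diff: "v \<in> H_space \<Omega> m \<Longrightarrow> w \<in> H_space \<Omega> m \<Longrightarrow> length is \<le> m \<Longrightarrow>
    D is (\<lambda>x. v x - w x) = D is v - D is w"
  using D_combination[of v m w "is" 1 "-1"] by simp

lemma D_scaleR: "v \<in> H_space \<Omega> m \<Longrightarrow> length is \<le> m \<Longrightarrow> D is (\<lambda>x. a *\<^sub>R v x) = a *\<^sub>R D is v"
  using D_combination[of v m v "is" a 0] by simp

lemma D_Nil: "v \<in> L2 \<Omega> \<Longrightarrow> D [] v = cls v"
proof -
  assume v: "v \<in> L2 \<Omega>"
  have wd: "is_weak_deriv \<Omega> [] v v"
    by (simp add: is_weak_deriv_def partials_def)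
  have "v \<in> H_space \<Omega> 0"
    using v wd by (auto simp: H_space_def)
  then have "weak_deriv \<Omega> [] v \<in> L2 \<Omega>"
    by (auto intro: weak_deriv_L2)
  then show ?thesis
    unfolding D_def using v weak_deriv_AE_eqI[OF v wd] by (subst cls_eq_iff) auto
qed

text \<open>
  Integrals do not change on null sets, so almost equal functions have the same set of weak
  derivatives, and the choice operator picks the same one.
\<close>

lemma is_weak_deriv_AE_cong:
  assumes "v \<in> L2 \<Omega>" "AE x in lebesgue_on \<Omega>. v x = w x"
  shows "is_weak_deriv \<Omega> is v = is_weak_deriv \<Omega> is w"
proof -
  have w: "w \<in> L2 \<Omega>" using L2_AE_closed[OF sets_\<Omega> assms] .
  have "(LINT x|lebesgue_on \<Omega>. partials is \<phi> x *\<^sub>R v x) = (LINT x|lebesgue_on \<Omega>. partials is \<phi> x *\<^sub>R w x)"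
    if "\<phi> \<in> test_functions \<Omega>" for \<phi> :: "real^'d \<Rightarrow> real"
  proof (rule integral_cong_AE)
    have "partials is \<phi> \<in> L2 \<Omega>" using that by (intro test_L2 partials_test_functions)
    then show "(\<lambda>x. partials is \<phi> x *\<^sub>R v x) \<in> borel_measurable (lebesgue_on \<Omega>)"
      "(\<lambda>x. partials is \<phi> x *\<^sub>R w x) \<in> borel_measurable (lebesgue_on \<Omega>)"
      using assms(1) w by (auto intro!: borel_measurable_scaleR simp: L2_def)
    show "AE x in lebesgue_on \<Omega>. partials is \<phi> x *\<^sub>R v x = partials is \<phi> x *\<^sub>R w x"
      using assms(2) by eventually_elim simp
  qed
  then show ?thesis
    by (auto simp: is_weak_deriv_def fun_eq_iff)
qed

lemma weak_deriv_AE_cong: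
  assumes "v \<in> L2 \<Omega>" "AE x in lebesgue_on \<Omega>. v x = w x"
  shows "weak_deriv \<Omega> is v = weak_deriv \<Omega> is w"
  by (simp add: weak_deriv_def is_weak_deriv_AE_cong[OF assms])

lemma H_space_AE_closed:
  assumes "v \<in> H_space \<Omega> m" "AE x in lebesgue_on \<Omega>. v x = w x"
  shows "w \<in> H_space \<Omega> m"
  using assms L2_AE_closed[OF sets_\<Omega> H_space_L2[OF assms(1)] assms(2)]
    is_weak_deriv_AE_cong[OF H_space_L2[OF assms(1)] assms(2)]
  by (auto simp: H_space_def)

lemma H_norm_eq:
  assumes "v \<in> H_space \<Omega> m"
  shows "H_norm \<Omega> m v = sqrt (\<Sum>is | length is \<le> m. (norm (D is v))\<^sup>2)"
  unfolding H_norm_def D_def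
  by (intro arg_cong[where f=sqrt] sum.cong) (auto simp: norm_cls weak_deriv_L2[OF assms])

lemma norm_D_le_H_norm:
  assumes "v \<in> H_space \<Omega> m" "length is \<le> m"
  shows "norm (D is v) \<le> H_norm \<Omega> m v"
proof -
  have "(norm (D is v))\<^sup>2 \<le> (\<Sum>is | length is \<le> m. (norm (D is v))\<^sup>2)"
    using assms(2) by (intro member_le_sum) (auto simp: finite_multiindices)
  then show ?thesis
    unfolding H_norm_eq[OF assms(1)] by (rule real_le_rsqrt)
qed

lemma H_norm_le_sum:
  assumes "v \<in> H_space \<Omega> m"
  shows "H_norm \<Omega> m v \<le> (\<Sum>is | length is \<le> m. norm (D is v))"
  using L2_set_le_sum[of "{is. length is \<le> m}" "\<lambda>is. norm (D is v)"]
  by (simp add: H_norm_eq[OF assms] L2_set_def)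

lemma H_norm_1:
  assumes "v \<in> H_space \<Omega> 1"
  shows "(H_norm \<Omega> 1 v)\<^sup>2 = (norm (cls v))\<^sup>2 + (\<Sum>i\<in>UNIV. (norm (D [i] v))\<^sup>2)"
proof -
  have *: "{is :: 'd list. length is \<le> 1} = insert [] (range (\<lambda>i. [i]))"
  proof -
    have "length is \<le> 1 \<longleftrightarrow> is = [] \<or> (\<exists>i. is = [i])" for "is" :: "'d list"
      by (cases "is") auto
    then show ?thesis unfolding image_def by blast
  qed
  have "(H_norm \<Omega> 1 v)\<^sup>2 = (\<Sum>is | length is \<le> 1. (norm (D is v))\<^sup>2)"
    unfolding H_norm_eq[OF assms] by (rule real_sqrt_pow2) (simp add: sum_nonneg)
  also have "\<dots> = (norm (D [] v))\<^sup>2 + (\<Sum>is\<in>range (\<lambda>i. [i]). (norm (D is v))\<^sup>2)"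
    unfolding * by (subst sum.insert) auto
  also have "(\<Sum>is\<in>range (\<lambda>i. [i]). (norm (D is v))\<^sup>2) = (\<Sum>i\<in>UNIV. (norm (D [i] v))\<^sup>2)"
    by (subst sum.reindex) (auto simp: inj_on_def)
  finally show ?thesis
    using H_space_L2[OF assms] by (simp add: D_Nil)
qed

subsection \<open>Jacobian and divergence\<close>

abbreviation grad :: "(real^'d \<Rightarrow> real^'d) \<Rightarrow> (real^'d, real^'d^'d) l2" where
  "grad v \<equiv> cls (Jacobian \<Omega> v)"

abbreviation dv :: "(real^'d \<Rightarrow> real^'d) \<Rightarrow> (real^'d, real) l2" where
  "dv v \<equiv> cls (divergence \<Omega> v)"

lemma Jacobian_L2:
  assumes "v \<in> H_space \<Omega> 1"
  shows "Jacobian \<Omega> v \<in> L2 \<Omega>"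
proof -
  define L :: "'d \<Rightarrow> real^'d \<Rightarrow> real^'d^'d" where "L j w = (\<chi> i k. if k = j then w $ i else 0)" for j w
  have "linear (L j)" for j
    by (auto simp: L_def linear_iff vec_eq_iff)
  then have L: "bounded_linear (L j)" for j
    by (simp add: linear_conv_bounded_linear)
  have "(\<lambda>x. \<Sum>j\<in>UNIV. L j (weak_deriv \<Omega> [j] v x)) \<in> L2 \<Omega>"
    by (intro L2_sum L2_linear[OF L] weak_deriv_L2[OF assms]) simp
  moreover have "Jacobian \<Omega> v = (\<lambda>x. \<Sum>j\<in>UNIV. L j (weak_deriv \<Omega> [j] v x))"
    by (auto simp: Jacobian_def L_def vec_eq_iff fun_eq_iff sum_component)
  ultimately show ?thesis by simp
qed

lemma divergence_L2:
  assumes "v \<in> H_space \<Omega> 1"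
  shows "divergence \<Omega> v \<in> L2 \<Omega>"
  unfolding divergence_def[abs_def]
  by (intro L2_sum L2_linear[OF bounded_linear_vec_nth] weak_deriv_L2[OF assms]) simp

lemma inner_grad:
  assumes "v \<in> H_space \<Omega> 1" "w \<in> H_space \<Omega> 1"
  shows "grad v \<bullet> grad w = (\<Sum>i\<in>UNIV. D [i] v \<bullet> D [i] w)"
proof -
  have L2: "weak_deriv \<Omega> [i] v \<in> L2 \<Omega>" "weak_deriv \<Omega> [i] w \<in> L2 \<Omega>" for i
    using assms by (auto intro!: weak_deriv_L2)
  have "grad v \<bullet> grad w = (LINT x|lebesgue_on \<Omega>. (\<Sum>i\<in>UNIV. weak_deriv \<Omega> [i] v x \<bullet> weak_deriv \<Omega> [i] w x))"
    unfolding inner_cls[OF Jacobian_L2[OF assms(1)] Jacobian_L2[OF assms(2)]] L2_inner_def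
    by (intro Bochner_Integration.integral_cong refl) (simp add: Jacobian_def inner_vec_def, rule sum.swap)
  also have "\<dots> = (\<Sum>i\<in>UNIV. (LINT x|lebesgue_on \<Omega>. weak_deriv \<Omega> [i] v x \<bullet> weak_deriv \<Omega> [i] w x))"
    using L2 by (intro Bochner_Integration.integral_sum L2_integrable_inner)
  finally show ?thesis
    using L2 by (simp add: D_def inner_cls L2_inner_def)
qed

lemma norm_grad:
  assumes "v \<in> H_space \<Omega> 1"
  shows "(norm (grad v))\<^sup>2 = (\<Sum>i\<in>UNIV. (norm (D [i] v))\<^sup>2)"
  using inner_grad[OF assms assms] by (simp add: dot_square_norm)

lemma H_norm_1_grad:
  assumes "v \<in> H_space \<Omega> 1"
  shows "(H_norm \<Omega> 1 v)\<^sup>2 = (norm (cls v))\<^sup>2 + (norm (grad v))\<^sup>2"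
  using H_norm_1[OF assms] norm_grad[OF assms] by simp

lemma H_norm_nonneg: "0 \<le> H_norm \<Omega> m v"
  by (auto simp: H_norm_def intro!: sum_nonneg)

lemma norm_D_le_grad:
  assumes "v \<in> H_space \<Omega> 1"
  shows "norm (D [i] v) \<le> norm (grad v)"
proof -
  have "(norm (D [i] v))\<^sup>2 \<le> (\<Sum>i\<in>UNIV. (norm (D [i] v))\<^sup>2)"
    by (intro member_le_sum) auto
  then show ?thesis
    unfolding norm_grad[OF assms, symmetric] by (rule power2_le_imp_le) simp
qed

lemma norm_cls_linear_le:
  assumes "bounded_linear L" "\<And>v. norm (L v) \<le> norm v" "f \<in> L2 \<Omega>"
  shows "norm (cls (\<lambda>x. L (f x))) \<le> norm (cls f)"
proof -
  have "L2_inner \<Omega> (\<lambda>x. L (f x)) (\<lambda>x. L (f x)) \<le> L2_inner \<Omega> f f"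
    unfolding L2_inner_def
    by (intro Bochner_Integration.integral_mono L2_integrable_inner L2_linear[OF assms(1)] assms(3))
       (auto simp: dot_square_norm intro!: power_mono assms(2))
  then show ?thesis
    using assms by (simp add: norm_cls L2_linear L2_norm_def)
qed

text \<open>
  The divergence is a sum of \<open>d\<close> components of first derivatives.
\<close>

lemma norm_dv_le:
  assumes "v \<in> H_space \<Omega> 1"
  shows "norm (dv v) \<le> real CARD('d) * norm (grad v)"
proof -
  have L2: "weak_deriv \<Omega> [i] v \<in> L2 \<Omega>" for i
    using assms by (auto intro!: weak_deriv_L2)
  have "dv v = (\<Sum>i\<in>UNIV. cls (\<lambda>x. weak_deriv \<Omega> [i] v x $ i))"
    unfolding divergence_def[abs_def]
    by (rule cls_sum) (rule L2_linear[OF bounded_linear_vec_nth L2])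
  also have "norm \<dots> \<le> (\<Sum>i\<in>(UNIV :: 'd set). norm (grad v))"
  proof (rule sum_norm_le)
    fix i
    have "norm (cls (\<lambda>x. weak_deriv \<Omega> [i] v x $ i)) \<le> norm (D [i] v)"
      unfolding D_def by (rule norm_cls_linear_le[OF bounded_linear_vec_nth _ L2]) (simp add: component_le_norm_cart)
    also note norm_D_le_grad[OF assms]
    finally show "norm (cls (\<lambda>x. weak_deriv \<Omega> [i] v x $ i)) \<le> norm (grad v)" .
  qed
  finally show ?thesis by simp
qed

lemma Jacobian_combination:
  assumes "v \<in> H_space \<Omega> 1" "w \<in> H_space \<Omega> 1"
  shows grad_combination: "grad (\<lambda>x. a *\<^sub>R v x + b *\<^sub>R w x) = a *\<^sub>R grad v + b *\<^sub>R grad w"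
    and dv_combination: "dv (\<lambda>x. a *\<^sub>R v x + b *\<^sub>R w x) = a *\<^sub>R dv v + b *\<^sub>R dv w"
proof -
  let ?u = "\<lambda>x. a *\<^sub>R v x + b *\<^sub>R w x"
  have u: "?u \<in> H_space \<Omega> 1" by (rule H_space_combination[OF assms])
  note L2 = Jacobian_L2[OF u] Jacobian_L2[OF assms(1)] Jacobian_L2[OF assms(2)]
    divergence_L2[OF u] divergence_L2[OF assms(1)] divergence_L2[OF assms(2)]
  have ae: "AE x in lebesgue_on \<Omega>. \<forall>i\<in>UNIV. weak_deriv \<Omega> [i] ?u x =
      a *\<^sub>R weak_deriv \<Omega> [i] v x + b *\<^sub>R weak_deriv \<Omega> [i] w x"
    by (intro AE_finite_allI weak_deriv_combination[OF assms]) auto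
  have "grad ?u = cls (\<lambda>x. a *\<^sub>R Jacobian \<Omega> v x + b *\<^sub>R Jacobian \<Omega> w x)"
  proof (subst cls_eq_iff)
    show "AE x in lebesgue_on \<Omega>. Jacobian \<Omega> ?u x = a *\<^sub>R Jacobian \<Omega> v x + b *\<^sub>R Jacobian \<Omega> w x"
      using ae by eventually_elim (simp add: Jacobian_def vec_eq_iff)
  qed (use L2 in \<open>auto intro: L2_add L2_scaleR\<close>)
  with L2 show "grad ?u = a *\<^sub>R grad v + b *\<^sub>R grad w"
    by (simp add: cls_add cls_scaleR L2_scaleR)
  have "dv ?u = cls (\<lambda>x. a *\<^sub>R divergence \<Omega> v x + b *\<^sub>R divergence \<Omega> w x)"
  proof (subst cls_eq_iff)
    show "AE x in lebesgue_on \<Omega>. divergence \<Omega> ?u x = a *\<^sub>R divergence \<Omega> v x + b *\<^sub>R divergence \<Omega> w x"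
      using ae by eventually_elim (simp add: divergence_def sum.distrib sum_distrib_left)
  qed (intro L2_add L2_scaleR L2)+
  also have "\<dots> = a *\<^sub>R dv v + b *\<^sub>R dv w"
    unfolding cls_scaleR[OF L2(5), symmetric] cls_scaleR[OF L2(6), symmetric]
    by (intro cls_add L2_scaleR L2)
  finally show "dv ?u = a *\<^sub>R dv v + b *\<^sub>R dv w" .
qed

end

section \<open>The space \<open>H\<^sup>1\<^sub>0\<close>\<close>

context bounded_open_set
begin

(* Keeps the order 1 in H_space \<Omega> 1 and H_norm \<Omega> 1 from being rewritten to Suc 0. *)
declare One_nat_def [simp del]

lemma integral_\<Omega>_eq_lborel:
  fixes g :: "real^'d \<Rightarrow> 'b::euclidean_space"
  assumes "continuous_on UNIV g" "\<And>x. x \<notin> \<Omega> \<Longrightarrow> g x = 0"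
  shows "(LINT x|lebesgue_on \<Omega>. g x) = integral\<^sup>L lborel g"
proof -
  have "(LINT x|lebesgue_on \<Omega>. g x) = (LINT x|lebesgue. indicator \<Omega> x *\<^sub>R g x)"
    using sets_\<Omega> by (subst integral_restrict_space) auto
  also have "(\<lambda>x. indicator \<Omega> x *\<^sub>R g x) = g"
    using assms(2) by (auto simp: fun_eq_iff indicator_def)
  also have "integral\<^sup>L lebesgue g = integral\<^sup>L lborel g"
    using borel_measurable_continuous_onI[OF assms(1)] by (intro integral_completion) simp
  finally show ?thesis .
qed

text \<open>
  Integration by parts for smooth functions: the derivative of the compactly supported product
  \<open>\<psi> \<phi>\<close> has integral 0.
\<close>

lemma is_weak_deriv_test_function:
  fixes \<phi> :: "real^'d \<Rightarrow> 'b::euclidean_space"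
  assumes "\<phi> \<in> test_functions \<Omega>"
  shows "is_weak_deriv \<Omega> [i] \<phi> (partial_deriv i \<phi>)"
  unfolding is_weak_deriv_def
proof
  fix \<psi> :: "real^'d \<Rightarrow> real" assume \<psi>: "\<psi> \<in> test_functions \<Omega>"
  note \<phi>D = test_functionsD[OF assms] and \<psi>D = test_functionsD[OF \<psi>]
  obtain K where K: "compact K" "K \<subseteq> \<Omega>" "\<And>x. x \<notin> K \<Longrightarrow> \<phi> x = 0"
    using test_functionsE[OF assms] by blast
  note dK = partial_deriv_eq_0[OF compact_imp_closed[OF K(1)] K(3)]
  let ?g = "\<lambda>x. \<psi> x *\<^sub>R \<phi> x"
  have pd: "partial_deriv i ?g = (\<lambda>x. \<psi> x *\<^sub>R partial_deriv i \<phi> x + partial_deriv i \<psi> x *\<^sub>R \<phi> x)"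
    by (rule ext, rule partial_deriv_scaleR[OF \<psi>D(1) \<phi>D(1)])
  have c1: "continuous_on UNIV (\<lambda>x. \<psi> x *\<^sub>R partial_deriv i \<phi> x)"
    by (intro continuous_on_scaleR \<psi>D \<phi>D)
  have c2: "continuous_on UNIV (\<lambda>x. partial_deriv i \<psi> x *\<^sub>R \<phi> x)"
    by (intro continuous_on_scaleR \<psi>D \<phi>D)
  have "integral\<^sup>L lborel (partial_deriv i ?g) = 0"
  proof (rule integral_partial_deriv_eq_0)
    show "(\<lambda>x. \<psi> x *\<^sub>R \<phi> x) differentiable at x" for x
      by (intro differentiable_scaleR \<psi>D \<phi>D)
    show "continuous_on UNIV (partial_deriv i ?g)"
      unfolding pd by (intro continuous_on_add c1 c2)
  qed (use K in auto)
  moreover have "integrable lborel (\<lambda>x. \<psi> x *\<^sub>R partial_deriv i \<phi> x)"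
    by (rule integrable_continuous_compact_support[OF c1 K(1)]) (simp add: dK)
  moreover have "integrable lborel (\<lambda>x. partial_deriv i \<psi> x *\<^sub>R \<phi> x)"
    by (rule integrable_continuous_compact_support[OF c2 K(1)]) (simp add: K)
  ultimately have "(LINT x|lborel. \<psi> x *\<^sub>R partial_deriv i \<phi> x) + (LINT x|lborel. partial_deriv i \<psi> x *\<^sub>R \<phi> x) = 0"
    unfolding pd by simp
  moreover have "(LINT x|lebesgue_on \<Omega>. \<psi> x *\<^sub>R partial_deriv i \<phi> x) = (LINT x|lborel. \<psi> x *\<^sub>R partial_deriv i \<phi> x)"
    by (rule integral_\<Omega>_eq_lborel[OF c1]) (simp add: \<psi>D)
  moreover have "(LINT x|lebesgue_on \<Omega>. partial_deriv i \<psi> x *\<^sub>R \<phi> x) = (LINT x|lborel. partial_deriv i \<psi> x *\<^sub>R \<phi> x)"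
    by (rule integral_\<Omega>_eq_lborel[OF c2]) (simp add: \<phi>D)
  ultimately show "(LINT x|lebesgue_on \<Omega>. partials [i] \<psi> x *\<^sub>R \<phi> x) =
      (-1) ^ length [i] *\<^sub>R (LINT x|lebesgue_on \<Omega>. \<psi> x *\<^sub>R partial_deriv i \<phi> x)"
    by (simp add: partials_def add_eq_0_iff2)
qed

lemma test_function_H1:
  assumes "\<phi> \<in> test_functions \<Omega>"
  shows "\<phi> \<in> H_space \<Omega> 1"
proof -
  have "\<exists>g\<in>L2 \<Omega>. is_weak_deriv \<Omega> is \<phi> g" if "length is \<le> 1" for "is"
  proof (cases "is")
    case Nil
    then show ?thesis
      using test_L2[OF assms] by (intro bexI[of _ \<phi>]) (auto simp: is_weak_deriv_def partials_def)
  next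
    case (Cons i js)
    with that show ?thesis
      using is_weak_deriv_test_function[OF assms, of i] test_L2[OF test_functions_partial_deriv[OF assms]]
      by auto
  qed
  then show ?thesis
    using test_L2[OF assms] by (simp add: H_space_def)
qed

lemma weak_deriv_test_function:
  assumes "\<phi> \<in> test_functions \<Omega>"
  shows "AE x in lebesgue_on \<Omega>. weak_deriv \<Omega> [i] \<phi> x = partial_deriv i \<phi> x"
  by (intro weak_deriv_AE_eqI is_weak_deriv_test_function test_L2 test_functions_partial_deriv assms)

lemma D_test_function:
  assumes "\<phi> \<in> test_functions \<Omega>"
  shows "D [i] \<phi> = cls (partial_deriv i \<phi>)"
  unfolding D_def
  using weak_deriv_test_function[OF assms] weak_deriv_L2[OF test_function_H1[OF assms], of "[i]"]
    test_L2[OF test_functions_partial_deriv[OF assms]]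
  by (subst cls_eq_iff) auto

text \<open>
  A velocity field together with its first derivatives. The divergence is listed separately only
  for convenience; it is bounded by the Jacobian (\<open>norm_dv_le\<close>).
\<close>

definition jet :: "(real^'d \<Rightarrow> real^'d) \<Rightarrow> (real^'d, real^'d) l2 \<times> (real^'d, real^'d^'d) l2 \<times> (real^'d, real) l2" where
  "jet v = (cls v, grad v, dv v)"

lemma jet_combination:
  assumes "v \<in> H_space \<Omega> 1" "w \<in> H_space \<Omega> 1"
  shows "jet (\<lambda>x. a *\<^sub>R v x + b *\<^sub>R w x) = a *\<^sub>R jet v + b *\<^sub>R jet w"
proof -
  have "cls (\<lambda>x. a *\<^sub>R v x + b *\<^sub>R w x) = a *\<^sub>R cls v + b *\<^sub>R cls w"
    using H_space_L2[OF assms(1)] H_space_L2[OF assms(2)] by (simp add: cls_add cls_scaleR L2_scaleR)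
  then show ?thesis
    unfolding jet_def grad_combination[OF assms] dv_combination[OF assms] by simp
qed

lemma jet_diff:
  assumes "v \<in> H_space \<Omega> 1" "w \<in> H_space \<Omega> 1"
  shows "jet (\<lambda>x. v x - w x) = jet v - jet w"
  using jet_combination[OF assms, of 1 "-1"] by simp

lemma jet_AE_cong:
  assumes "v \<in> H_space \<Omega> 1" "AE x in lebesgue_on \<Omega>. v x = w x"
  shows "jet v = jet w"
proof -
  note wd = weak_deriv_AE_cong[OF H_space_L2[OF assms(1)] assms(2)]
  have "cls v = cls w"
    using assms(2) H_space_L2[OF assms(1)] L2_AE_closed[OF sets_\<Omega> H_space_L2[OF assms(1)] assms(2)]
    by (subst cls_eq_iff)
  then show ?thesis
    by (simp add: jet_def Jacobian_def[abs_def] divergence_def[abs_def] wd)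
qed

lemma H_norm_le_norm_jet:
  assumes "v \<in> H_space \<Omega> 1"
  shows "H_norm \<Omega> 1 v \<le> norm (jet v)"
proof (rule power2_le_imp_le)
  show "(H_norm \<Omega> 1 v)\<^sup>2 \<le> (norm (jet v))\<^sup>2"
    unfolding H_norm_1_grad[OF assms] by (simp add: jet_def norm_Pair)
qed simp

lemma norm_cls_le_H_norm:
  assumes "v \<in> H_space \<Omega> 1"
  shows "norm (cls v) \<le> H_norm \<Omega> 1 v" "norm (grad v) \<le> H_norm \<Omega> 1 v"
  by (rule power2_le_imp_le[OF _ H_norm_nonneg], simp add: H_norm_1_grad[OF assms])+

lemma norm_jet_le_H_norm:
  assumes "v \<in> H_space \<Omega> 1"
  shows "norm (jet v) \<le> (2 + real CARD('d)) * H_norm \<Omega> 1 v"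
proof -
  have "norm (jet v) \<le> norm (cls v) + (norm (grad v) + norm (dv v))"
    unfolding jet_def using norm_Pair_le[of "cls v" "(grad v, dv v)"] norm_Pair_le[of "grad v" "dv v"] by linarith
  moreover have "norm (dv v) \<le> real CARD('d) * H_norm \<Omega> 1 v"
    using norm_dv_le[OF assms] mult_left_mono[OF norm_cls_le_H_norm(2)[OF assms], of "real CARD('d)"] by linarith
  ultimately show ?thesis
    using norm_cls_le_H_norm[OF assms] by (simp add: algebra_simps)
qed

text \<open>
  Membership in \<open>H\<^sup>1\<^sub>0\<close> as a closure in an inner product space: \<open>norm (jet v)\<close> is equivalent to
  \<open>\<parallel>v\<parallel>\<^sub>1\<close>.
\<close>

lemma V_space_iff:
  "v \<in> V_space \<Omega> \<longleftrightarrow> v \<in> H_space \<Omega> 1 \<and> jet v \<in> closure (jet ` test_functions \<Omega>)"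
proof -
  have "(\<forall>\<epsilon>>0. \<exists>\<phi>\<in>test_functions \<Omega>. H_norm \<Omega> 1 (\<lambda>x. v x - \<phi> x) < \<epsilon>) \<longleftrightarrow>
      (\<forall>\<epsilon>>0. \<exists>\<phi>\<in>test_functions \<Omega>. dist (jet \<phi>) (jet v) < \<epsilon>)" (is "?L \<longleftrightarrow> ?R")
    if v: "v \<in> H_space \<Omega> 1"
  proof -
    have diff: "(\<lambda>x. v x - \<phi> x) \<in> H_space \<Omega> 1" "dist (jet \<phi>) (jet v) = norm (jet (\<lambda>x. v x - \<phi> x))"
      if "\<phi> \<in> test_functions \<Omega>" for \<phi>
      using H_space_diff[OF v test_function_H1[OF that]] jet_diff[OF v test_function_H1[OF that]]
      by (simp_all add: dist_norm norm_minus_commute)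
    show ?thesis
    proof
      assume R: ?R
      show ?L
      proof (intro allI impI)
        fix \<epsilon> :: real assume "\<epsilon> > 0"
        with R obtain \<phi> where \<phi>: "\<phi> \<in> test_functions \<Omega>" "dist (jet \<phi>) (jet v) < \<epsilon>" by blast
        have "H_norm \<Omega> 1 (\<lambda>x. v x - \<phi> x) < \<epsilon>"
          using H_norm_le_norm_jet[OF diff(1)[OF \<phi>(1)]] \<phi>(2) unfolding diff(2)[OF \<phi>(1)] by linarith
        with \<phi>(1) show "\<exists>\<phi>\<in>test_functions \<Omega>. H_norm \<Omega> 1 (\<lambda>x. v x - \<phi> x) < \<epsilon>" by blast
      qed
    next
      assume L: ?L
      show ?R
      proof (intro allI impI)
        fix \<epsilon> :: real assume "\<epsilon> > 0"
        then have "0 < \<epsilon> / (2 + real CARD('d))" by (intro divide_pos_pos add_pos_nonneg) auto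
        with L obtain \<phi> where \<phi>: "\<phi> \<in> test_functions \<Omega>"
          "H_norm \<Omega> 1 (\<lambda>x. v x - \<phi> x) < \<epsilon> / (2 + real CARD('d))" by blast
        then have "(2 + real CARD('d)) * H_norm \<Omega> 1 (\<lambda>x. v x - \<phi> x) < \<epsilon>"
          by (simp add: field_simps add_pos_nonneg)
        then have "dist (jet \<phi>) (jet v) < \<epsilon>"
          using norm_jet_le_H_norm[OF diff(1)[OF \<phi>(1)]] unfolding diff(2)[OF \<phi>(1)] by linarith
        with \<phi>(1) show "\<exists>\<phi>\<in>test_functions \<Omega>. dist (jet \<phi>) (jet v) < \<epsilon>" by blast
      qed
    qed
  qed
  then show ?thesis
    unfolding V_space_def H10_def closure_approachable by auto
qed

lemma V_space_H1: "v \<in> V_space \<Omega> \<Longrightarrow> v \<in> H_space \<Omega> 1"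
  by (simp add: V_space_iff)

lemma V_space_combination:
  assumes "v \<in> V_space \<Omega>" "w \<in> V_space \<Omega>"
  shows "(\<lambda>x. a *\<^sub>R v x + b *\<^sub>R w x) \<in> V_space \<Omega>"
proof -
  have H1: "v \<in> H_space \<Omega> 1" "w \<in> H_space \<Omega> 1" using assms by (auto intro: V_space_H1)
  obtain X where X: "\<And>n. X n \<in> jet ` test_functions \<Omega>" "X \<longlonglongrightarrow> jet v"
    using assms(1) by (auto simp: V_space_iff closure_sequential)
  obtain Y where Y: "\<And>n. Y n \<in> jet ` test_functions \<Omega>" "Y \<longlonglongrightarrow> jet w"
    using assms(2) by (auto simp: V_space_iff closure_sequential)
  have "a *\<^sub>R X n + b *\<^sub>R Y n \<in> jet ` test_functions \<Omega>" for n
  proof -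
    obtain \<phi> \<psi> where *: "\<phi> \<in> test_functions \<Omega>" "X n = jet \<phi>" "\<psi> \<in> test_functions \<Omega>" "Y n = jet \<psi>"
      using X(1)[of n] Y(1)[of n] by blast
    then have "(\<lambda>x. a *\<^sub>R \<phi> x + b *\<^sub>R \<psi> x) \<in> test_functions \<Omega>"
      by (intro test_functions_add test_functions_linear[OF _ bounded_linear_scaleR_right])
    moreover have "a *\<^sub>R X n + b *\<^sub>R Y n = jet (\<lambda>x. a *\<^sub>R \<phi> x + b *\<^sub>R \<psi> x)"
      using * by (simp add: jet_combination test_function_H1)
    ultimately show ?thesis by blast
  qed
  moreover have "(\<lambda>n. a *\<^sub>R X n + b *\<^sub>R Y n) \<longlonglongrightarrow> jet (\<lambda>x. a *\<^sub>R v x + b *\<^sub>R w x)"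
    unfolding jet_combination[OF H1] by (intro tendsto_intros X Y)
  ultimately have "jet (\<lambda>x. a *\<^sub>R v x + b *\<^sub>R w x) \<in> closure (jet ` test_functions \<Omega>)"
    unfolding closure_sequential by (intro exI[of _ "\<lambda>n. a *\<^sub>R X n + b *\<^sub>R Y n"]) auto
  then show ?thesis
    using H_space_combination[OF H1] by (simp add: V_space_iff)
qed

lemma V_space_diff: "v \<in> V_space \<Omega> \<Longrightarrow> w \<in> V_space \<Omega> \<Longrightarrow> (\<lambda>x. v x - w x) \<in> V_space \<Omega>"
  using V_space_combination[of v w 1 "-1"] by simp

text \<open>
  The principle for extending Poincare's inequality and integration by parts from test functions to
  \<open>H\<^sup>1\<^sub>0\<close>.
\<close>

lemma closed_property_V_space:
  assumes "closed {x. P x}" "\<And>\<phi>. \<phi> \<in> test_functions \<Omega> \<Longrightarrow> P (jet \<phi>)" "v \<in> V_space \<Omega>"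
  shows "P (jet v)"
  using closure_minimal[of "jet ` test_functions \<Omega>" "{x. P x}"] assms by (auto simp: V_space_iff)

text \<open>
  Poincare's inequality: integrating \<open>\<partial>\<^sub>i (x\<^sub>i |\<phi>|\<^sup>2) = |\<phi>|\<^sup>2 + 2 x\<^sub>i (\<phi> \<bullet> \<partial>\<^sub>i \<phi>)\<close> gives
  \<open>\<parallel>\<phi>\<parallel>\<^sup>2 \<le> 2 R \<parallel>\<phi>\<parallel> \<parallel>\<partial>\<^sub>i \<phi>\<parallel>\<close> as soon as \<open>\<bar>x\<^sub>i\<bar> \<le> R\<close> on the domain.
\<close>

lemma Poincare_test_function:
  fixes \<phi> :: "real^'d \<Rightarrow> real^'d"
  assumes \<phi>: "\<phi> \<in> test_functions \<Omega>" and R: "\<And>x. x \<in> \<Omega> \<Longrightarrow> norm x \<le> R" "R > 0"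
  shows "norm (cls \<phi>) \<le> 2 * R * norm (grad \<phi>)"
proof -
  fix i0 :: 'd
  define i where "i = i0"
  note \<phi>D = test_functionsD[OF \<phi>]
  obtain K where K: "compact K" "K \<subseteq> \<Omega>" "\<And>x. x \<notin> K \<Longrightarrow> \<phi> x = 0"
    using test_functionsE[OF \<phi>] by blast
  let ?g = "\<lambda>x. x $ i * (\<phi> x \<bullet> \<phi> x)"
  have der: "(?g has_derivative (\<lambda>h. x $ i * (2 * (\<phi> x \<bullet> frechet_derivative \<phi> (at x) h)) + h $ i * (\<phi> x \<bullet> \<phi> x))) (at x)" for x
  proof -
    have "(\<phi> has_derivative frechet_derivative \<phi> (at x)) (at x)"
      using \<phi>D(1) by (simp add: frechet_derivative_works)
    then show ?thesis
      by (auto intro!: derivative_eq_intros bounded_linear.has_derivative[OF bounded_linear_vec_nth] simp: inner_commute)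
  qed
  have pd: "partial_deriv i ?g = (\<lambda>x. x $ i * (2 * (\<phi> x \<bullet> partial_deriv i \<phi> x)) + \<phi> x \<bullet> \<phi> x)"
    by (rule ext) (simp add: partial_deriv_eqI[OF der] partial_deriv_def[of i \<phi>])
  have c1: "continuous_on UNIV (\<lambda>x. x $ i * (2 * (\<phi> x \<bullet> partial_deriv i \<phi> x)))"
    by (intro continuous_intros \<phi>D)
  have c2: "continuous_on UNIV (\<lambda>x. \<phi> x \<bullet> \<phi> x)"
    by (intro continuous_intros \<phi>D)
  have "integral\<^sup>L lborel (partial_deriv i ?g) = 0"
  proof (rule integral_partial_deriv_eq_0)
    show "?g differentiable at x" for x
      using der by (rule differentiableI)
    show "continuous_on UNIV (partial_deriv i ?g)"
      unfolding pd by (intro continuous_on_add c1 c2)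
  qed (use K in auto)
  moreover have "integrable lborel (\<lambda>x. x $ i * (2 * (\<phi> x \<bullet> partial_deriv i \<phi> x)))"
    by (rule integrable_continuous_compact_support[OF c1 K(1)]) (simp add: K)
  moreover have "integrable lborel (\<lambda>x. \<phi> x \<bullet> \<phi> x)"
    by (rule integrable_continuous_compact_support[OF c2 K(1)]) (simp add: K)
  ultimately have "(LINT x|lborel. x $ i * (2 * (\<phi> x \<bullet> partial_deriv i \<phi> x))) + (LINT x|lborel. \<phi> x \<bullet> \<phi> x) = 0"
    unfolding pd by simp
  moreover have "(LINT x|lebesgue_on \<Omega>. x $ i * (2 * (\<phi> x \<bullet> partial_deriv i \<phi> x))) = (LINT x|lborel. x $ i * (2 * (\<phi> x \<bullet> partial_deriv i \<phi> x)))"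
    by (rule integral_\<Omega>_eq_lborel[OF c1]) (simp add: \<phi>D)
  moreover have "(LINT x|lebesgue_on \<Omega>. \<phi> x \<bullet> \<phi> x) = (LINT x|lborel. \<phi> x \<bullet> \<phi> x)"
    by (rule integral_\<Omega>_eq_lborel[OF c2]) (simp add: \<phi>D)
  ultimately have eq: "(LINT x|lebesgue_on \<Omega>. \<phi> x \<bullet> \<phi> x) = - (LINT x|lebesgue_on \<Omega>. x $ i * (2 * (\<phi> x \<bullet> partial_deriv i \<phi> x)))"
    by simp
  let ?\<phi>i = "\<lambda>x. (x $ i / R) *\<^sub>R \<phi> x"
  have \<phi>i: "?\<phi>i \<in> L2 \<Omega>"
  proof -
    have "?\<phi>i \<in> borel_measurable (lebesgue_on \<Omega>)"
      using R(2) by (intro measurable_restrict_space1 measurable_completion)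
        (auto intro!: borel_measurable_continuous_onI continuous_intros \<phi>D)
    moreover have "integrable (lebesgue_on \<Omega>) (\<lambda>x. (norm (?\<phi>i x))\<^sup>2)"
    proof (rule Bochner_Integration.integrable_bound)
      show "integrable (lebesgue_on \<Omega>) (\<lambda>x. (norm (\<phi> x))\<^sup>2)" using test_L2[OF \<phi>] by (simp add: L2_def)
      show "(\<lambda>x. (norm (?\<phi>i x))\<^sup>2) \<in> borel_measurable (lebesgue_on \<Omega>)"
        by (intro borel_measurable_power measurable_compose[OF calculation borel_measurable_norm])
      show "AE x in lebesgue_on \<Omega>. norm ((norm (?\<phi>i x))\<^sup>2) \<le> norm ((norm (\<phi> x))\<^sup>2)"
      proof (rule AE_I2)
        fix x assume "x \<in> space (lebesgue_on \<Omega>)"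
        then have "\<bar>x $ i\<bar> \<le> R" using R(1)[of x] component_le_norm_cart[of x i] by auto
        then have "\<bar>x $ i / R\<bar> * norm (\<phi> x) \<le> norm (\<phi> x)"
          using R(2) by (intro mult_left_le_one_le) (auto simp: field_simps)
        then show "norm ((norm (?\<phi>i x))\<^sup>2) \<le> norm ((norm (\<phi> x))\<^sup>2)"
          by (simp add: power_mono del: abs_divide)
      qed
    qed
    ultimately show ?thesis by (simp add: L2_def)
  qed
  have d\<phi>: "partial_deriv i \<phi> \<in> L2 \<Omega>"
    by (intro test_L2 test_functions_partial_deriv \<phi>)
  have norm_\<phi>i: "norm (cls ?\<phi>i) \<le> norm (cls \<phi>)"
  proof -
    have "L2_inner \<Omega> ?\<phi>i ?\<phi>i \<le> L2_inner \<Omega> \<phi> \<phi>"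
      unfolding L2_inner_def
    proof (rule Bochner_Integration.integral_mono)
      fix x assume "x \<in> space (lebesgue_on \<Omega>)"
      then have "\<bar>x $ i\<bar> \<le> R" using R(1)[of x] component_le_norm_cart[of x i] by auto
      then have "\<bar>x $ i / R\<bar> * norm (\<phi> x) \<le> norm (\<phi> x)"
        using R(2) by (intro mult_left_le_one_le) (auto simp: field_simps)
      then show "?\<phi>i x \<bullet> ?\<phi>i x \<le> \<phi> x \<bullet> \<phi> x"
        unfolding dot_square_norm by (intro power_mono) (auto simp del: abs_divide)
    qed (intro L2_integrable_inner \<phi>i test_L2 \<phi>)+
    then show ?thesis
      by (simp add: norm_cls[OF \<phi>i] norm_cls[OF test_L2[OF \<phi>]] L2_norm_def)
  qed
  have "(norm (cls \<phi>))\<^sup>2 = - 2 * R * (cls ?\<phi>i \<bullet> cls (partial_deriv i \<phi>))"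
  proof -
    have "(norm (cls \<phi>))\<^sup>2 = (LINT x|lebesgue_on \<Omega>. \<phi> x \<bullet> \<phi> x)"
      using inner_cls[OF test_L2[OF \<phi>] test_L2[OF \<phi>]] by (simp add: dot_square_norm L2_inner_def)
    also have "\<dots> = - (LINT x|lebesgue_on \<Omega>. 2 * R * (?\<phi>i x \<bullet> partial_deriv i \<phi> x))"
      unfolding eq using R(2) by (intro arg_cong[where f=uminus] Bochner_Integration.integral_cong) auto
    also have "\<dots> = - 2 * R * (cls ?\<phi>i \<bullet> cls (partial_deriv i \<phi>))"
      using \<phi>i d\<phi> by (simp add: inner_cls L2_inner_def)
    finally show ?thesis .
  qed
  also have "\<dots> \<le> 2 * R * (norm (cls ?\<phi>i) * norm (cls (partial_deriv i \<phi>)))"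
  proof -
    have "- (cls ?\<phi>i \<bullet> cls (partial_deriv i \<phi>)) \<le> norm (cls ?\<phi>i) * norm (cls (partial_deriv i \<phi>))"
      using Cauchy_Schwarz_ineq2[of "cls ?\<phi>i" "cls (partial_deriv i \<phi>)"] by linarith
    moreover have "- 2 * R * a \<le> 2 * R * b" if "- a \<le> b" for a b
      using mult_left_mono[OF that, of "2 * R"] R(2) by simp
    ultimately show ?thesis by blast
  qed
  also have "\<dots> \<le> 2 * R * (norm (cls \<phi>) * norm (grad \<phi>))"
    using R(2) norm_D_le_grad[OF test_function_H1[OF \<phi>], of i, unfolded D_test_function[OF \<phi>]] norm_\<phi>i
    by (intro mult_left_mono mult_mono norm_ge_zero) simp_all
  finally have "norm (cls \<phi>) * norm (cls \<phi>) \<le> norm (cls \<phi>) * (2 * R * norm (grad \<phi>))"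
    by (simp only: power2_eq_square mult.left_commute mult.assoc)
  then have "norm (cls \<phi>) \<le> 2 * R * norm (grad \<phi>)" if "norm (cls \<phi>) > 0"
    using that by (rule mult_left_le_imp_le)
  then show ?thesis
    using R(2) norm_ge_zero[of "grad \<phi>"] by (cases "norm (cls \<phi>) > 0") (auto simp del: norm_ge_zero)
qed

lemma Poincare:
  obtains P where "P \<ge> 0" "\<And>v. v \<in> V_space \<Omega> \<Longrightarrow> norm (cls v) \<le> P * norm (grad v)"
proof -
  obtain R where R: "R > 0" "\<And>x. x \<in> \<Omega> \<Longrightarrow> norm x \<le> R"
    using bounded_\<Omega> by (auto simp: bounded_pos)
  have "norm (fst (jet v)) \<le> 2 * R * norm (fst (snd (jet v)))" if "v \<in> V_space \<Omega>" for v
    using that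
    by (rule closed_property_V_space[rotated 2])
       (auto intro!: closed_Collect_le continuous_intros simp: jet_def Poincare_test_function R)
  then show ?thesis
    using R(1) by (intro that[of "2 * R"]) (auto simp: jet_def)
qed

subsection \<open>Integration by parts\<close>

text \<open>
  The components of a vector-valued test function are scalar test functions, to which the
  definition of the weak derivative applies.
\<close>

lemma weak_deriv_pairing:
  fixes w g \<phi> :: "real^'d \<Rightarrow> 'b::euclidean_space"
  assumes wd: "is_weak_deriv \<Omega> [i] w g" and L2: "w \<in> L2 \<Omega>" "g \<in> L2 \<Omega>" and \<phi>: "\<phi> \<in> test_functions \<Omega>"
  shows "cls g \<bullet> cls \<phi> = - (cls w \<bullet> cls (partial_deriv i \<phi>))"
proof -
  have pair: "cls k \<bullet> cls \<psi> = (\<Sum>b\<in>Basis. (LINT x|lebesgue_on \<Omega>. (\<psi> x \<bullet> b) *\<^sub>R k x) \<bullet> b)"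
    if k: "k \<in> L2 \<Omega>" and \<psi>: "\<psi> \<in> test_functions \<Omega>" for k \<psi> :: "real^'d \<Rightarrow> 'b"
  proof -
    have \<psi>b: "(\<lambda>x. \<psi> x \<bullet> b) \<in> L2 \<Omega>" for b
      by (rule L2_linear[OF bounded_linear_inner_left test_L2[OF \<psi>]])
    have "cls k \<bullet> cls \<psi> = (LINT x|lebesgue_on \<Omega>. (\<Sum>b\<in>Basis. ((\<psi> x \<bullet> b) *\<^sub>R k x) \<bullet> b))"
      unfolding inner_cls[OF k test_L2[OF \<psi>]] L2_inner_def
      by (intro Bochner_Integration.integral_cong refl) (subst euclidean_inner, simp add: mult.commute)
    also have "\<dots> = (\<Sum>b\<in>Basis. (LINT x|lebesgue_on \<Omega>. ((\<psi> x \<bullet> b) *\<^sub>R k x) \<bullet> b))"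
      by (intro Bochner_Integration.integral_sum integrable_inner_left L2_integrable_scaleR \<psi>b k)
    also have "\<dots> = (\<Sum>b\<in>Basis. (LINT x|lebesgue_on \<Omega>. (\<psi> x \<bullet> b) *\<^sub>R k x) \<bullet> b)"
      by (intro sum.cong refl integral_inner_left L2_integrable_scaleR \<psi>b k)
    finally show ?thesis .
  qed
  have "(LINT x|lebesgue_on \<Omega>. (partial_deriv i \<phi> x \<bullet> b) *\<^sub>R w x) = - (LINT x|lebesgue_on \<Omega>. (\<phi> x \<bullet> b) *\<^sub>R g x)" for b
  proof -
    have "(\<lambda>x. \<phi> x \<bullet> b) \<in> test_functions \<Omega>"
      by (rule test_functions_linear[OF \<phi> bounded_linear_inner_left])
    moreover have "partial_deriv i (\<lambda>x. \<phi> x \<bullet> b) = (\<lambda>x. partial_deriv i \<phi> x \<bullet> b)"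
      by (rule ext) (intro partial_deriv_linear[OF bounded_linear_inner_left] test_functionsD[OF \<phi>])
    ultimately show ?thesis
      using wd by (auto simp: is_weak_deriv_def partials_def)
  qed
  then show ?thesis
    using pair[OF L2(2) \<phi>] pair[OF L2(1) test_functions_partial_deriv[OF \<phi>]] by (simp add: sum_negf)
qed

lemma Laplacian_L2:
  assumes "u \<in> H_space \<Omega> 2"
  shows "Laplacian \<Omega> u \<in> L2 \<Omega>"
  unfolding Laplacian_def[abs_def] by (intro L2_sum weak_deriv_L2[OF assms]) simp

lemma gradient_L2:
  assumes "q \<in> H_space \<Omega> 1"
  shows "gradient \<Omega> q \<in> L2 \<Omega>"
proof -
  have "gradient \<Omega> q = (\<lambda>x. \<Sum>i\<in>UNIV. weak_deriv \<Omega> [i] q x *\<^sub>R axis i 1)"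
    by (auto simp: gradient_def fun_eq_iff vec_eq_iff sum_component axis_def if_distrib cong: if_cong)
  moreover have "(\<lambda>x. \<Sum>i\<in>UNIV. weak_deriv \<Omega> [i] q x *\<^sub>R axis i 1) \<in> L2 \<Omega>"
    by (intro L2_sum L2_linear[OF bounded_linear_scaleR_left] weak_deriv_L2[OF assms]) simp
  ultimately show ?thesis by simp
qed

lemma Laplacian_pairing:
  assumes u: "u \<in> H_space \<Omega> 2" and v: "v \<in> V_space \<Omega>"
  shows "cls (Laplacian \<Omega> u) \<bullet> cls v = - (grad u \<bullet> grad v)"
proof -
  have u1: "u \<in> H_space \<Omega> 1" using u by (rule H_space_mono) simp
  have L2: "weak_deriv \<Omega> [i] u \<in> L2 \<Omega>" "weak_deriv \<Omega> [i, i] u \<in> L2 \<Omega>" for i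
    using u by (auto intro!: weak_deriv_L2)
  have wd: "is_weak_deriv \<Omega> [i] (weak_deriv \<Omega> [i] u) (weak_deriv \<Omega> [i, i] u)" for i
    unfolding is_weak_deriv_def
  proof
    fix \<phi> :: "real^'d \<Rightarrow> real" assume \<phi>: "\<phi> \<in> test_functions \<Omega>"
    have 1: "is_weak_deriv \<Omega> [i] u (weak_deriv \<Omega> [i] u)" and 2: "is_weak_deriv \<Omega> [i, i] u (weak_deriv \<Omega> [i, i] u)"
      using u by (auto intro!: is_weak_deriv_weak_deriv)
    show "(LINT x|lebesgue_on \<Omega>. partials [i] \<phi> x *\<^sub>R weak_deriv \<Omega> [i] u x) =
        (-1) ^ length [i] *\<^sub>R (LINT x|lebesgue_on \<Omega>. \<phi> x *\<^sub>R weak_deriv \<Omega> [i, i] u x)"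
      using bspec[OF 1[unfolded is_weak_deriv_def] test_functions_partial_deriv[OF \<phi>, of i]]
        bspec[OF 2[unfolded is_weak_deriv_def] \<phi>]
      by (auto simp: partials_def dest: sym)
  qed
  have "cls (Laplacian \<Omega> u) \<bullet> fst (jet v) = - (grad u \<bullet> fst (snd (jet v)))"
    using v
  proof (rule closed_property_V_space[rotated 2])
    show "closed {x :: (real^'d, real^'d) l2 \<times> (real^'d, real^'d^'d) l2 \<times> (real^'d, real) l2.
        cls (Laplacian \<Omega> u) \<bullet> fst x = - (grad u \<bullet> fst (snd x))}"
      by (intro closed_Collect_eq continuous_intros)
    fix \<phi> :: "real^'d \<Rightarrow> real^'d" assume \<phi>: "\<phi> \<in> test_functions \<Omega>"
    have "cls (Laplacian \<Omega> u) = (\<Sum>i\<in>UNIV. cls (weak_deriv \<Omega> [i, i] u))"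
      unfolding Laplacian_def[abs_def] by (rule cls_sum) (rule L2)
    then have "cls (Laplacian \<Omega> u) \<bullet> cls \<phi> = (\<Sum>i\<in>UNIV. - (cls (weak_deriv \<Omega> [i] u) \<bullet> cls (partial_deriv i \<phi>)))"
      using weak_deriv_pairing[OF wd L2 \<phi>] by (simp add: inner_sum_left)
    also have "\<dots> = - (grad u \<bullet> grad \<phi>)"
      unfolding inner_grad[OF u1 test_function_H1[OF \<phi>]] D_test_function[OF \<phi>] by (simp add: D_def sum_negf)
    finally show "cls (Laplacian \<Omega> u) \<bullet> fst (jet \<phi>) = - (grad u \<bullet> fst (snd (jet \<phi>)))"
      by (simp add: jet_def)
  qed
  then show ?thesis by (simp add: jet_def)
qed

lemma gradient_pairing:
  assumes q: "q \<in> H_space \<Omega> 1" and v: "v \<in> V_space \<Omega>"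
  shows "cls (gradient \<Omega> q) \<bullet> cls v = - (cls q \<bullet> dv v)"
proof -
  have L2: "weak_deriv \<Omega> [i] q \<in> L2 \<Omega>" for i
    using q by (auto intro!: weak_deriv_L2)
  have "cls (gradient \<Omega> q) \<bullet> fst (jet v) = - (cls q \<bullet> snd (snd (jet v)))"
    using v
  proof (rule closed_property_V_space[rotated 2])
    show "closed {x :: (real^'d, real^'d) l2 \<times> (real^'d, real^'d^'d) l2 \<times> (real^'d, real) l2.
        cls (gradient \<Omega> q) \<bullet> fst x = - (cls q \<bullet> snd (snd x))}"
      by (intro closed_Collect_eq continuous_intros)
    fix \<phi> :: "real^'d \<Rightarrow> real^'d" assume \<phi>: "\<phi> \<in> test_functions \<Omega>"
    have \<phi>i: "(\<lambda>x. \<phi> x $ i) \<in> test_functions \<Omega>" for i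
      by (rule test_functions_linear[OF \<phi> bounded_linear_vec_nth])
    have pd: "partial_deriv i (\<lambda>x. \<phi> x $ i) = (\<lambda>x. partial_deriv i \<phi> x $ i)" for i
      by (rule ext) (intro partial_deriv_linear[OF bounded_linear_vec_nth] test_functionsD[OF \<phi>])
    have "cls (gradient \<Omega> q) \<bullet> cls \<phi> = (LINT x|lebesgue_on \<Omega>. (\<Sum>i\<in>UNIV. weak_deriv \<Omega> [i] q x \<bullet> \<phi> x $ i))"
      unfolding inner_cls[OF gradient_L2[OF q] test_L2[OF \<phi>]] L2_inner_def
      by (simp add: gradient_def inner_vec_def)
    also have "\<dots> = (\<Sum>i\<in>UNIV. (LINT x|lebesgue_on \<Omega>. weak_deriv \<Omega> [i] q x \<bullet> \<phi> x $ i))"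
      by (intro Bochner_Integration.integral_sum L2_integrable_inner L2 test_L2 \<phi>i)
    also have "\<dots> = (\<Sum>i\<in>UNIV. cls (weak_deriv \<Omega> [i] q) \<bullet> cls (\<lambda>x. \<phi> x $ i))"
      by (intro sum.cong refl) (simp only: inner_cls[OF L2 test_L2[OF \<phi>i]] L2_inner_def)
    also have "\<dots> = (\<Sum>i\<in>UNIV. - (cls q \<bullet> cls (\<lambda>x. partial_deriv i \<phi> x $ i)))"
      using weak_deriv_pairing[OF is_weak_deriv_weak_deriv[OF q] H_space_L2[OF q] L2 \<phi>i]
      by (intro sum.cong refl) (simp add: pd)
    also have "\<dots> = - (cls q \<bullet> (\<Sum>i\<in>UNIV. cls (\<lambda>x. partial_deriv i \<phi> x $ i)))"
      by (simp add: inner_sum_right sum_negf)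
    also have "(\<Sum>i\<in>UNIV. cls (\<lambda>x. partial_deriv i \<phi> x $ i)) = dv \<phi>"
    proof -
      have "cls (\<lambda>x. partial_deriv i \<phi> x $ i) = cls (\<lambda>x. weak_deriv \<Omega> [i] \<phi> x $ i)" for i
      proof (subst cls_eq_iff)
        show "AE x in lebesgue_on \<Omega>. partial_deriv i \<phi> x $ i = weak_deriv \<Omega> [i] \<phi> x $ i"
          using weak_deriv_test_function[OF \<phi>, of i] by eventually_elim simp
        show "(\<lambda>x. partial_deriv i \<phi> x $ i) \<in> L2 \<Omega>"
          by (rule L2_linear[OF bounded_linear_vec_nth test_L2[OF test_functions_partial_deriv[OF \<phi>]]])
        show "(\<lambda>x. weak_deriv \<Omega> [i] \<phi> x $ i) \<in> L2 \<Omega>"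
          by (rule L2_linear[OF bounded_linear_vec_nth weak_deriv_L2[OF test_function_H1[OF \<phi>]]]) simp
      qed
      moreover have "dv \<phi> = (\<Sum>i\<in>UNIV. cls (\<lambda>x. weak_deriv \<Omega> [i] \<phi> x $ i))"
        unfolding divergence_def[abs_def]
        by (rule cls_sum) (rule L2_linear[OF bounded_linear_vec_nth weak_deriv_L2[OF test_function_H1[OF \<phi>]]], simp)
      ultimately show ?thesis by simp
    qed
    finally show "cls (gradient \<Omega> q) \<bullet> fst (jet \<phi>) = - (cls q \<bullet> snd (snd (jet \<phi>)))"
      by (simp add: jet_def)
  qed
  then show ?thesis by (simp add: jet_def)
qed

end

section \<open>Mixed methods in inner product spaces\<close>

text \<open>
  Fredholm's alternative for finitely many linear equations: a right-hand side that respects all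
  linear relations between the rows is attained. The family \<open>S\<close> consists of the values of the rows.
\<close>

lemma finite_linear_system_solvable:
  fixes S :: "('i \<Rightarrow> real) set"
  assumes "finite I" and "\<And>g h a. g \<in> S \<Longrightarrow> h \<in> S \<Longrightarrow> (\<lambda>i. g i + a * h i) \<in> S" and "S \<noteq> {}"
    and "\<And>c. (\<And>g. g \<in> S \<Longrightarrow> (\<Sum>i\<in>I. c i * g i) = 0) \<Longrightarrow> (\<Sum>i\<in>I. c i * F i) = 0"
  shows "\<exists>g\<in>S. \<forall>i\<in>I. g i = F i"
  using assms
proof (induction I arbitrary: S F rule: finite_induct)
  case empty
  then show ?case by auto
next
  case (insert j I)
  show ?case
  proof (cases "\<forall>g\<in>S. g j = 0")
    case True
    have sum: "(\<Sum>i\<in>insert j I. (c(j := 0)) i * g i) = (\<Sum>i\<in>I. c i * g i)" for c g :: "'i \<Rightarrow> real"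
      using insert.hyps by (auto intro!: sum.cong)
    have "\<exists>g\<in>S. \<forall>i\<in>I. g i = F i"
    proof (rule insert.IH[OF insert.prems(1,2)])
      fix c :: "'i \<Rightarrow> real" assume "\<And>g. g \<in> S \<Longrightarrow> (\<Sum>i\<in>I. c i * g i) = 0"
      then show "(\<Sum>i\<in>I. c i * F i) = 0"
        using insert.prems(3)[of "c(j := 0)"] by (simp only: sum)
    qed auto
    moreover have "F j = 0"
    proof -
      have "(\<Sum>i\<in>insert j I. (if i = j then 1 else 0) * g i) = g j" for g :: "'i \<Rightarrow> real"
        using insert.hyps by (subst sum.remove[of _ j]) (auto intro!: sum.neutral)
      then show ?thesis
        using insert.prems(3)[of "\<lambda>i. if i = j then 1 else 0"] True by simp
    qed
    ultimately show ?thesis using True by auto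
  next
    case False
    then obtain g1 where g1: "g1 \<in> S" "g1 j \<noteq> 0" by blast
    define g0 where "g0 i = g1 i + (1 / g1 j - 1) * g1 i" for i
    have g0: "g0 \<in> S" "g0 j = 1"
      using insert.prems(1)[OF g1(1) g1(1), of "1 / g1 j - 1"] g1(2)
      by (simp_all add: g0_def[abs_def] algebra_simps)
    let ?S = "{g \<in> S. g j = 0}"
    have red: "(\<lambda>i. g i - g j * g0 i) \<in> ?S" if "g \<in> S" for g
      using insert.prems(1)[OF that g0(1), of "- g j"] g0(2) by simp
    have "\<exists>g\<in>?S. \<forall>i\<in>I. g i = F i - F j * g0 i"
    proof (rule insert.IH)
      show "?S \<noteq> {}" using red[OF g0(1)] by blast
      show "(\<lambda>i. g i + a * h i) \<in> ?S" if "g \<in> ?S" "h \<in> ?S" for g h a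
        using insert.prems(1)[of g h a] that by simp
    next
      fix c :: "'i \<Rightarrow> real" assume c: "\<And>g. g \<in> ?S \<Longrightarrow> (\<Sum>i\<in>I. c i * g i) = 0"
      let ?c = "c(j := - (\<Sum>i\<in>I. c i * g0 i))"
      have sum: "(\<Sum>i\<in>insert j I. ?c i * g i) = (\<Sum>i\<in>I. c i * g i) - (\<Sum>i\<in>I. c i * g0 i) * g j" for g :: "'i \<Rightarrow> real"
        using insert.hyps by (simp, intro sum.cong) auto
      have "(\<Sum>i\<in>I. c i * g i) - (\<Sum>i\<in>I. c i * g0 i) * g j = 0" if "g \<in> S" for g
        using c[OF red[OF that]] by (simp add: algebra_simps sum_subtractf sum_distrib_left sum_distrib_right)
      then have "(\<Sum>i\<in>I. c i * F i) - (\<Sum>i\<in>I. c i * g0 i) * F j = 0"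
        using insert.prems(3)[of ?c] by (simp only: sum)
      then show "(\<Sum>i\<in>I. c i * (F i - F j * g0 i)) = 0"
        by (simp add: algebra_simps sum_subtractf sum_distrib_left sum_distrib_right)
    qed
    then obtain g where g: "g \<in> S" "g j = 0" "\<And>i. i \<in> I \<Longrightarrow> g i = F i - F j * g0 i" by blast
    have "(\<lambda>i. g i + F j * g0 i) \<in> S" by (rule insert.prems(1)[OF g(1) g0(1)])
    then show ?thesis
      using g(2,3) g0(2) by (intro bexI[of _ "\<lambda>i. g i + F j * g0 i"]) auto
  qed
qed

text \<open>
  Elements of \<open>Vh\<close> are triples of a velocity, its gradient and its divergence, elements of \<open>Qh\<close>
  are pressures. The inf-sup condition is used in the form: a bound for the functional
  \<open>v \<mapsto> \<langle>div v, q\<rangle>\<close> is a bound for \<open>q\<close>.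
\<close>

locale mixed_method =
  fixes Vh :: "('h::real_inner \<times> 'g::real_inner \<times> 'q::real_inner) set" and Qh :: "'q set"
    and \<beta> P K :: real
  assumes Vh: "subspace Vh" and Qh: "subspace Qh"
    and Vh_finite: "\<exists>B. finite B \<and> B \<subseteq> Vh \<and> Vh \<subseteq> span B"
    and Qh_finite: "\<exists>B. finite B \<and> B \<subseteq> Qh \<and> Qh \<subseteq> span B"
    and \<beta>: "\<beta> > 0" and P: "P \<ge> 0" and K: "K \<ge> 0"
    and Poincare: "\<And>x. x \<in> Vh \<Longrightarrow> norm (fst x) \<le> P * norm (fst (snd x))"
    and div_le: "\<And>x. x \<in> Vh \<Longrightarrow> norm (snd (snd x)) \<le> K * norm (fst (snd x))"
    and inf_sup: "\<And>q M. q \<in> Qh \<Longrightarrow> M \<ge> 0 \<Longrightarrow>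
      (\<And>x. x \<in> Vh \<Longrightarrow> snd (snd x) \<bullet> q \<le> M * (norm (fst x) + norm (fst (snd x)))) \<Longrightarrow> \<beta> * norm q \<le> M"
begin

abbreviation vel :: "'h \<times> 'g \<times> 'q \<Rightarrow> 'h" where "vel \<equiv> fst"
abbreviation gr :: "'h \<times> 'g \<times> 'q \<Rightarrow> 'g" where "gr x \<equiv> fst (snd x)"
abbreviation di :: "'h \<times> 'g \<times> 'q \<Rightarrow> 'q" where "di x \<equiv> snd (snd x)"

definition Stokes_proj :: "'h \<times> 'g \<times> 'q \<Rightarrow> 'q \<Rightarrow> 'h \<times> 'g \<times> 'q \<Rightarrow> 'q \<Rightarrow> bool" where
  "Stokes_proj w s x q \<longleftrightarrow> x \<in> Vh \<and> q \<in> Qh \<and>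
     (\<forall>v\<in>Vh. gr x \<bullet> gr v - di v \<bullet> q = gr w \<bullet> gr v - di v \<bullet> s) \<and> (\<forall>p\<in>Qh. di x \<bullet> p = 0)"

lemma Stokes_proj_combination:
  assumes "Stokes_proj w s x q" "Stokes_proj w' s' x' q'"
  shows "Stokes_proj (a *\<^sub>R w + b *\<^sub>R w') (a *\<^sub>R s + b *\<^sub>R s') (a *\<^sub>R x + b *\<^sub>R x') (a *\<^sub>R q + b *\<^sub>R q')"
  unfolding Stokes_proj_def
proof (intro conjI ballI)
  show "a *\<^sub>R x + b *\<^sub>R x' \<in> Vh" "a *\<^sub>R q + b *\<^sub>R q' \<in> Qh"
    using assms Vh Qh by (auto simp: Stokes_proj_def intro!: subspace_add subspace_scale)
  fix v assume "v \<in> Vh"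
  then have eq: "gr x \<bullet> gr v - di v \<bullet> q = gr w \<bullet> gr v - di v \<bullet> s"
    "gr x' \<bullet> gr v - di v \<bullet> q' = gr w' \<bullet> gr v - di v \<bullet> s'"
    using assms by (auto simp: Stokes_proj_def)
  have "gr (a *\<^sub>R x + b *\<^sub>R x') \<bullet> gr v - di v \<bullet> (a *\<^sub>R q + b *\<^sub>R q') =
      a * (gr x \<bullet> gr v - di v \<bullet> q) + b * (gr x' \<bullet> gr v - di v \<bullet> q')"
    by (simp add: inner_add_left inner_add_right algebra_simps)
  also have "\<dots> = gr (a *\<^sub>R w + b *\<^sub>R w') \<bullet> gr v - di v \<bullet> (a *\<^sub>R s + b *\<^sub>R s')"
    unfolding eq by (simp add: inner_add_left inner_add_right algebra_simps)
  finally show "gr (a *\<^sub>R x + b *\<^sub>R x') \<bullet> gr v - di v \<bullet> (a *\<^sub>R q + b *\<^sub>R q') =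
      gr (a *\<^sub>R w + b *\<^sub>R w') \<bullet> gr v - di v \<bullet> (a *\<^sub>R s + b *\<^sub>R s')" .
next
  fix p assume "p \<in> Qh"
  then show "di (a *\<^sub>R x + b *\<^sub>R x') \<bullet> p = 0"
    using assms by (auto simp: Stokes_proj_def inner_add_left)
qed

text \<open>
  The Stokes projection solves a square linear system, written with spanning sets of \<open>Vh\<close> and \<open>Qh\<close>.
  By Fredholm's alternative it suffices that the right-hand side vanishes on the kernel of the adjoint
  system, and on this kernel the gradient, the divergence and the pressure are 0.
\<close>

lemma Stokes_proj_exists: "\<exists>x q. Stokes_proj w s x q"
proof -
  obtain B where B: "finite B" "B \<subseteq> Vh" "Vh \<subseteq> span B" using Vh_finite by blast
  obtain C where C: "finite C" "C \<subseteq> Qh" "Qh \<subseteq> span C" using Qh_finite by blast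
  define A where "A = (\<lambda>x q v p. gr x \<bullet> gr v - di v \<bullet> q - di x \<bullet> p)"
  define F where "F = (\<lambda>v. gr w \<bullet> gr v - di v \<bullet> s)"
  define row where "row x q i = (case i of Inl v \<Rightarrow> A x q v 0 | Inr p \<Rightarrow> A x q 0 p)" for x q i
  define rhs where "rhs i = (case i of Inl v \<Rightarrow> F v | Inr p \<Rightarrow> (0::real))" for i :: "('h \<times> 'g \<times> 'q) + 'q"
  let ?I = "Inl ` B \<union> Inr ` C"
  have fin: "finite ?I" using B C by auto
  have sum_I: "(\<Sum>i\<in>?I. h i) = (\<Sum>v\<in>B. h (Inl v)) + (\<Sum>p\<in>C. h (Inr p))" for h :: "_ \<Rightarrow> real"
    using B C by (subst sum.union_disjoint) (auto simp: sum.reindex inj_on_def)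
  have "\<exists>g\<in>{row x q |x q. x \<in> Vh \<and> q \<in> Qh}. \<forall>i\<in>?I. g i = rhs i"
  proof (rule finite_linear_system_solvable[OF fin])
    show "{row x q |x q. x \<in> Vh \<and> q \<in> Qh} \<noteq> {}"
      using subspace_0[OF Vh] subspace_0[OF Qh] by blast
  next
    fix g h and a :: real
    assume "g \<in> {row x q |x q. x \<in> Vh \<and> q \<in> Qh}" "h \<in> {row x q |x q. x \<in> Vh \<and> q \<in> Qh}"
    then obtain x q x' q' where *: "g = row x q" "h = row x' q'" "x \<in> Vh" "q \<in> Qh" "x' \<in> Vh" "q' \<in> Qh"
      by blast
    have "(\<lambda>i. g i + a * h i) = row (x + a *\<^sub>R x') (q + a *\<^sub>R q')"
      by (auto simp: * row_def A_def fun_eq_iff inner_add_left inner_add_right algebra_simps split: sum.split)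
    moreover have "x + a *\<^sub>R x' \<in> Vh" "q + a *\<^sub>R q' \<in> Qh"
      using * Vh Qh by (auto intro!: subspace_add subspace_scale)
    ultimately show "(\<lambda>i. g i + a * h i) \<in> {row x q |x q. x \<in> Vh \<and> q \<in> Qh}" by blast
  next
    fix c assume c: "\<And>g. g \<in> {row x q |x q. x \<in> Vh \<and> q \<in> Qh} \<Longrightarrow> (\<Sum>i\<in>?I. c i * g i) = 0"
    define v where "v = (\<Sum>u\<in>B. c (Inl u) *\<^sub>R u)"
    define p where "p = (\<Sum>u\<in>C. c (Inr u) *\<^sub>R u)"
    have v: "v \<in> Vh" and p: "p \<in> Qh"
      using B C Vh Qh by (auto simp: v_def p_def intro!: subspace_sum subspace_scale)
    have kernel: "A x q v p = 0" if "x \<in> Vh" "q \<in> Qh" for x q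
    proof -
      have "(\<Sum>i\<in>?I. c i * row x q i) = A x q v p"
        unfolding sum_I by (simp add: row_def A_def v_def p_def inner_sum_right inner_sum_left fst_sum snd_sum
            sum_subtractf right_diff_distrib sum_negf)
      moreover have "row x q \<in> {row x q |x q. x \<in> Vh \<and> q \<in> Qh}" using that by blast
      ultimately show ?thesis using c[of "row x q"] by simp
    qed
    \<comment> \<open>Testing with \<open>(v, -p)\<close> cancels the divergence terms.\<close>
    have gr_v: "gr v = 0"
      using kernel[OF v subspace_neg[OF Qh p]] by (simp add: A_def)
    then have di_v: "di v = 0"
      using div_le[OF v] by simp
    have "\<beta> * norm p \<le> 0"
      using kernel[OF _ subspace_0[OF Qh]] by (intro inf_sup[OF p]) (auto simp: A_def gr_v)
    have "(\<Sum>i\<in>?I. c i * rhs i) = F v"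
      unfolding sum_I by (simp add: rhs_def F_def v_def inner_sum_right inner_sum_left fst_sum snd_sum
          sum_subtractf right_diff_distrib)
    also have "\<dots> = 0"
      by (simp add: F_def gr_v di_v)
    finally show "(\<Sum>i\<in>?I. c i * rhs i) = 0" .
  qed
  then obtain x q where xq: "x \<in> Vh" "q \<in> Qh" "\<And>i. i \<in> ?I \<Longrightarrow> row x q i = rhs i" by blast
  have "A x q v 0 = F v" if "v \<in> Vh" for v
  proof (rule span_induct[of v B "\<lambda>v. A x q v 0 = F v"])
    show "v \<in> span B" using that B by blast
    show "subspace {v. A x q v 0 = F v}"
      unfolding subspace_def
    proof (intro conjI ballI allI CollectI; (elim CollectE)?)
      show "A x q 0 0 = F 0" by (simp add: A_def F_def)
      show "A x q (u + v) 0 = F (u + v)" if "A x q u 0 = F u" "A x q v 0 = F v" for u v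
        using that by (simp add: A_def F_def inner_add_left inner_add_right)
      show "A x q (c *\<^sub>R v) 0 = F (c *\<^sub>R v)" if "A x q v 0 = F v" for c v
        using arg_cong[OF that, of "\<lambda>r. c * r"] by (simp add: A_def F_def right_diff_distrib)
    qed
    show "A x q v 0 = F v" if "v \<in> B" for v
      using xq(3)[of "Inl v"] that by (simp add: row_def rhs_def)
  qed
  moreover have "A x q 0 p = 0" if "p \<in> Qh" for p
  proof (rule span_induct[of p C "\<lambda>p. A x q 0 p = 0"])
    show "p \<in> span C" using that C by blast
    show "subspace {p. A x q 0 p = 0}"
      by (auto simp: subspace_def A_def inner_add_right)
    show "A x q 0 p = 0" if "p \<in> C" for p
      using xq(3)[of "Inr p"] that by (simp add: row_def rhs_def)
  qed
  ultimately have "Stokes_proj w s x q"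
    using xq(1,2) by (auto simp: Stokes_proj_def A_def F_def)
  then show ?thesis by blast
qed

text \<open>
  The gradient of the difference between the Stokes projection and a discrete pair is at most this
  multiple of the approximation error of that pair.
\<close>

definition stab :: real where "stab = 2 * (1 + K + K / \<beta>)"

lemma stab_nonneg: "stab \<ge> 0"
  using \<beta> K by (simp add: stab_def)

text \<open>
  Quasi-optimality. For the difference \<open>\<eta>, \<phi>\<close> of the projection and a discrete pair, the inf-sup
  condition bounds \<open>\<phi>\<close> by \<open>\<nabla>\<eta>\<close>, and testing with \<open>\<eta>\<close> bounds \<open>\<nabla>\<eta>\<close>; the
  divergence of \<open>\<eta>\<close> is only as small as the approximation error, whence the quadratic inequality.
\<close>

lemma Stokes_proj_error:
  assumes proj: "Stokes_proj w s x q" and y: "y \<in> Vh" and \<psi>: "\<psi> \<in> Qh"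
    and w_div: "\<And>p. p \<in> Qh \<Longrightarrow> di w \<bullet> p = 0"
    and wy: "norm (fst (w - y)) \<le> P * norm (gr (w - y))" "norm (di (w - y)) \<le> K * norm (gr (w - y))"
    and \<delta>: "norm (gr (w - y)) \<le> \<delta>" and \<epsilon>: "norm (s - \<psi>) \<le> \<epsilon>"
  shows "norm (vel (w - x)) \<le> P * (1 + stab) * (\<delta> + \<epsilon>)"
    and "norm (s - q) \<le> (1 + (stab + 1 + K) / \<beta>) * (\<delta> + \<epsilon>)"
proof -
  define \<eta> where "\<eta> = x - y"
  define \<phi> where "\<phi> = q - \<psi>"
  define A where "A = \<delta> + K * \<epsilon>"
  define B where "B = K * \<delta> / \<beta>"
  have \<eta>: "\<eta> \<in> Vh" and \<phi>: "\<phi> \<in> Qh"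
    using proj y \<psi> Vh Qh by (auto simp: \<eta>_def \<phi>_def Stokes_proj_def intro!: subspace_diff)
  have \<delta>0: "\<delta> \<ge> 0" and \<epsilon>0: "\<epsilon> \<ge> 0"
    using order_trans[OF norm_ge_zero \<delta>] order_trans[OF norm_ge_zero \<epsilon>] by auto
  then have A0: "A \<ge> 0" and B0: "B \<ge> 0"
    using K \<beta> by (auto simp: A_def B_def)
  define F where "F = (\<lambda>v. gr (w - y) \<bullet> gr v - di v \<bullet> (s - \<psi>))"
  have eq: "gr \<eta> \<bullet> gr v - di v \<bullet> \<phi> = F v" if "v \<in> Vh" for v
    using proj that by (simp add: Stokes_proj_def \<eta>_def \<phi>_def F_def inner_diff_left inner_diff_right algebra_simps)
  have F_le: "\<bar>F v\<bar> \<le> A * norm (gr v)" if "v \<in> Vh" for v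
  proof -
    have "\<bar>gr (w - y) \<bullet> gr v\<bar> \<le> \<delta> * norm (gr v)"
      by (rule order_trans[OF Cauchy_Schwarz_ineq2]) (intro mult_right_mono \<delta> norm_ge_zero)
    moreover have "\<bar>di v \<bullet> (s - \<psi>)\<bar> \<le> (K * norm (gr v)) * \<epsilon>"
      by (rule order_trans[OF Cauchy_Schwarz_ineq2]) (intro mult_mono div_le[OF that] \<epsilon> norm_ge_zero mult_nonneg_nonneg K)
    ultimately show ?thesis
      unfolding F_def A_def by (simp add: algebra_simps)
  qed
  have "\<beta> * norm \<phi> \<le> norm (gr \<eta>) + A"
  proof (rule inf_sup[OF \<phi>])
    show "norm (gr \<eta>) + A \<ge> 0" using A0 by simp
    fix v assume v: "v \<in> Vh"
    have "di v \<bullet> \<phi> = gr \<eta> \<bullet> gr v - F v" using eq[OF v] by simp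
    also have "\<dots> \<le> (norm (gr \<eta>) + A) * norm (gr v)"
      using norm_cauchy_schwarz[of "gr \<eta>" "gr v"] F_le[OF v] by (simp add: algebra_simps)
    also have "\<dots> \<le> (norm (gr \<eta>) + A) * (norm (fst v) + norm (gr v))"
      using A0 by (intro mult_left_mono) auto
    finally show "di v \<bullet> \<phi> \<le> (norm (gr \<eta>) + A) * (norm (fst v) + norm (gr v))" .
  qed
  then have norm_\<phi>: "norm \<phi> \<le> (norm (gr \<eta>) + A) / \<beta>"
    using \<beta> by (simp add: field_simps)
  have g: "norm (gr \<eta>) \<le> 2 * (A + B)"
  proof -
    have "di \<eta> \<bullet> \<phi> = di (w - y) \<bullet> \<phi>"
      using proj w_div[OF \<phi>] \<phi> by (simp add: \<eta>_def inner_diff_left Stokes_proj_def)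
    also have "\<dots> \<le> norm (di (w - y)) * norm \<phi>"
      by (rule norm_cauchy_schwarz)
    also have "\<dots> \<le> (K * \<delta>) * ((norm (gr \<eta>) + A) / \<beta>)"
      using order_trans[OF wy(2) mult_left_mono[OF \<delta> K]] norm_\<phi> K \<delta>0
      by (intro mult_mono) auto
    also have "\<dots> = B * (norm (gr \<eta>) + A)"
      by (simp add: B_def)
    finally have "(norm (gr \<eta>))\<^sup>2 \<le> A * norm (gr \<eta>) + B * (norm (gr \<eta>) + A)"
      using eq[OF \<eta>] F_le[OF \<eta>] by (simp add: dot_square_norm)
    then have sq: "(norm (gr \<eta>))\<^sup>2 \<le> (A + B) * norm (gr \<eta>) + A * B"
      by (simp add: algebra_simps)
    show ?thesis
    proof (rule ccontr)
      assume "\<not> ?thesis"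
      then have gt: "norm (gr \<eta>) > 2 * (A + B)" by simp
      have "A * B \<le> (A + B) * (A + B)"
        using A0 B0 by (intro mult_mono) auto
      also have "\<dots> \<le> (A + B) * norm (gr \<eta>)"
        using gt A0 B0 by (intro mult_left_mono) auto
      finally have "(norm (gr \<eta>))\<^sup>2 \<le> (2 * (A + B)) * norm (gr \<eta>)"
        using sq by (simp add: algebra_simps)
      moreover have "(2 * (A + B)) * norm (gr \<eta>) < norm (gr \<eta>) * norm (gr \<eta>)"
        using gt A0 B0 by (intro mult_strict_right_mono) auto
      ultimately show False by (simp add: power2_eq_square)
    qed
  qed
  have AB: "2 * (A + B) \<le> stab * (\<delta> + \<epsilon>)"
  proof -
    have "0 \<le> \<epsilon> + K * \<delta> + K * \<epsilon> / \<beta>" using \<delta>0 \<epsilon>0 K \<beta> by simp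
    then show ?thesis
      by (simp add: A_def B_def stab_def distrib_left distrib_right add_divide_distrib mult.assoc[symmetric])
  qed
  have wx: "w - x = (w - y) - \<eta>" by (simp add: \<eta>_def)
  have "norm (vel (w - x)) \<le> norm (vel (w - y)) + norm (vel \<eta>)"
    unfolding wx fst_diff[of "w - y"] by (rule norm_triangle_ineq4)
  also have "\<dots> \<le> P * norm (gr (w - y)) + P * norm (gr \<eta>)"
    by (intro add_mono wy Poincare \<eta>)
  also have "\<dots> \<le> P * (\<delta> + \<epsilon>) + P * (stab * (\<delta> + \<epsilon>))"
    using P \<delta> \<epsilon>0 g AB by (intro add_mono mult_left_mono) auto
  finally show "norm (vel (w - x)) \<le> P * (1 + stab) * (\<delta> + \<epsilon>)"
    by (simp add: algebra_simps)
  have "norm (s - q) \<le> norm (s - \<psi>) + norm \<phi>"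
    using norm_triangle_ineq4[of "s - \<psi>" \<phi>] by (simp add: \<phi>_def)
  also have "\<dots> \<le> (\<delta> + \<epsilon>) + (stab * (\<delta> + \<epsilon>) + (1 + K) * (\<delta> + \<epsilon>)) / \<beta>"
  proof (intro add_mono)
    have "A \<le> (1 + K) * (\<delta> + \<epsilon>)"
      using \<delta>0 \<epsilon>0 K by (simp add: A_def algebra_simps)
    then show "norm \<phi> \<le> (stab * (\<delta> + \<epsilon>) + (1 + K) * (\<delta> + \<epsilon>)) / \<beta>"
      using g AB \<beta> by (intro order_trans[OF norm_\<phi>] divide_right_mono) auto
  qed (use \<epsilon> \<delta>0 in auto)
  finally show "norm (s - q) \<le> (1 + (stab + 1 + K) / \<beta>) * (\<delta> + \<epsilon>)"
    by (simp add: algebra_simps add_divide_distrib)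
qed

text \<open>
  Testing the Crank--Nicolson error equation with the difference quotient of the error, which is
  discretely divergence free, controls that difference quotient and the gradient. The inf-sup
  condition then bounds the pressure error by the remaining terms of the equation.
\<close>

lemma Crank_Nicolson_pressure_bound:
  fixes n :: nat
  assumes \<tau>: "\<And>m. m \<in> {1..n} \<Longrightarrow> \<tau> m > 0" "sum \<tau> {1..n} \<le> T"
    and e: "\<And>m. m \<le> n \<Longrightarrow> e m \<in> Vh" "\<And>m p. m \<le> n \<Longrightarrow> p \<in> Qh \<Longrightarrow> di (e m) \<bullet> p = 0"
    and z: "\<And>m. m \<in> {1..n} \<Longrightarrow> z m \<in> Qh"
    and eq: "\<And>m v. m \<in> {1..n} \<Longrightarrow> v \<in> Vh \<Longrightarrow>
      vel ((e m - e (m - 1)) /\<^sub>R \<tau> m) \<bullet> vel v + gr ((e m + e (m - 1)) /\<^sub>R 2) \<bullet> gr v - di v \<bullet> z m = \<rho> m \<bullet> vel v"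
  shows "\<beta>\<^sup>2 * (\<Sum>m=1..n. \<tau> m * (norm (z m))\<^sup>2) \<le>
    3 * (2 + T) * ((norm (gr (e 0)))\<^sup>2 + (\<Sum>m=1..n. \<tau> m * (norm (\<rho> m))\<^sup>2))"
proof -
  define d where "d m = (e m - e (m - 1)) /\<^sub>R \<tau> m" for m
  define a where "a m = norm (vel (d m))" for m
  define g where "g m = (norm (gr (e m)))\<^sup>2" for m
  define S where "S k = g 0 + (\<Sum>m=1..k. \<tau> m * (norm (\<rho> m))\<^sup>2)" for k
  have d_Vh: "d m \<in> Vh" if "m \<in> {1..n}" for m
    using e(1)[of m] e(1)[of "m - 1"] that Vh by (auto simp: d_def intro!: subspace_diff subspace_scale)
  have step: "\<tau> m * (a m)\<^sup>2 + g m \<le> g (m - 1) + \<tau> m * (norm (\<rho> m))\<^sup>2" if m: "m \<in> {1..n}" for m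
  proof -
    have \<tau>m: "\<tau> m > 0" using \<tau> m by blast
    have "di (d m) \<bullet> z m = 0"
      using e(2)[of m, OF _ z[OF m]] e(2)[of "m - 1", OF _ z[OF m]] m le_trans[OF diff_le_self, of m n 1] by (simp add: d_def inner_diff_left)
    then have "(a m)\<^sup>2 + gr ((e m + e (m - 1)) /\<^sub>R 2) \<bullet> gr (d m) = \<rho> m \<bullet> vel (d m)"
      using eq[OF m d_Vh[OF m]] unfolding d_def[symmetric] by (simp add: a_def dot_square_norm)
    moreover have "gr ((e m + e (m - 1)) /\<^sub>R 2) \<bullet> gr (d m) = (g m - g (m - 1)) / (2 * \<tau> m)"
    proof -
      have "((x + y) /\<^sub>R 2) \<bullet> ((x - y) /\<^sub>R t) = ((norm x)\<^sup>2 - (norm y)\<^sup>2) / (2 * t)" for x y :: 'g and t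
      proof -
        have xy: "(x + y) \<bullet> (x - y) = (norm x)\<^sup>2 - (norm y)\<^sup>2"
          by (simp add: dot_square_norm[symmetric] inner_add_left inner_diff_right) (simp add: inner_commute)
        show ?thesis unfolding inner_scaleR_left inner_scaleR_right xy by (simp add: field_simps)
      qed
      from this[of "gr (e m)" "gr (e (m - 1))" "\<tau> m"] show ?thesis
        by (simp only: d_def g_def fst_add snd_add fst_diff snd_diff fst_scaleR snd_scaleR)
    qed
    moreover have "\<rho> m \<bullet> vel (d m) \<le> ((norm (\<rho> m))\<^sup>2 + (a m)\<^sup>2) / 2"
      using norm_cauchy_schwarz[of "\<rho> m" "vel (d m)"] sum_squares_bound[of "norm (\<rho> m)" "a m"]
      by (simp add: a_def)
    moreover have "X \<le> (r - s) / 2" if "s + Y = w" "Y = X" "w \<le> (r + s) / 2" for X Y r s w :: real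
      using that by (simp add: field_simps)
    ultimately have "(g m - g (m - 1)) / (2 * \<tau> m) \<le> ((norm (\<rho> m))\<^sup>2 - (a m)\<^sup>2) / 2"
      by blast
    then have "g m - g (m - 1) \<le> ((norm (\<rho> m))\<^sup>2 - (a m)\<^sup>2) / 2 * (2 * \<tau> m)"
      using \<tau>m by (subst (asm) pos_divide_le_eq) auto
    then show ?thesis
      by (simp add: algebra_simps)
  qed
  have energy: "(\<Sum>m=1..k. \<tau> m * (a m)\<^sup>2) + g k \<le> S k" if "k \<le> n" for k
    using that
  proof (induction k)
    case (Suc k)
    then show ?case using step[of "Suc k"] by (simp add: S_def)
  qed (simp add: S_def)
  have S_mono: "S k \<le> S n" if "k \<le> n" for k
  proof -
    have "(\<Sum>m=1..k. \<tau> m * (norm (\<rho> m))\<^sup>2) \<le> (\<Sum>m=1..n. \<tau> m * (norm (\<rho> m))\<^sup>2)"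
      using that by (intro sum_mono2) (auto intro!: mult_nonneg_nonneg less_imp_le[OF \<tau>(1)])
    then show ?thesis by (simp add: S_def)
  qed
  have a_sum_nonneg: "0 \<le> (\<Sum>m=1..k. \<tau> m * (a m)\<^sup>2)" if "k \<le> n" for k
    using that by (intro sum_nonneg) (auto intro!: mult_nonneg_nonneg less_imp_le[OF \<tau>(1)])
  have g_le: "g k \<le> S n" if "k \<le> n" for k
    using energy[OF that] S_mono[OF that] a_sum_nonneg[OF that] by linarith
  have z_le: "\<beta>\<^sup>2 * (norm (z m))\<^sup>2 \<le> 3 * ((norm (\<rho> m))\<^sup>2 + (a m)\<^sup>2 + S n)" if m: "m \<in> {1..n}" for m
  proof -
    define b where "b = norm (gr ((e m + e (m - 1)) /\<^sub>R 2))"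
    have "b \<le> (norm (gr (e m)) + norm (gr (e (m - 1)))) / 2"
      unfolding b_def using norm_triangle_ineq[of "gr (e m)" "gr (e (m - 1))"] by simp
    then have "b\<^sup>2 \<le> ((norm (gr (e m)) + norm (gr (e (m - 1)))) / 2)\<^sup>2"
      by (intro power_mono) (auto simp: b_def)
    also have "\<dots> \<le> (g m + g (m - 1)) / 2"
      using sum_squares_bound[of "norm (gr (e m))" "norm (gr (e (m - 1)))"]
      by (simp add: g_def power2_sum power_divide)
    also have "\<dots> \<le> S n"
      using g_le[of m] g_le[of "m - 1"] m by fastforce
    finally have b: "b\<^sup>2 \<le> S n" .
    let ?M = "norm (\<rho> m) + a m + b"
    have M0: "?M \<ge> 0" by (simp add: a_def b_def)
    have "\<beta> * norm (z m) \<le> ?M"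
    proof (rule inf_sup[OF z[OF m] M0])
      fix v assume v: "v \<in> Vh"
      have "di v \<bullet> z m = vel (d m) \<bullet> vel v + gr ((e m + e (m - 1)) /\<^sub>R 2) \<bullet> gr v - \<rho> m \<bullet> vel v"
        using eq[OF m v] by (simp add: d_def)
      also have "\<dots> \<le> a m * norm (vel v) + b * norm (gr v) + norm (\<rho> m) * norm (vel v)"
      proof -
        have "vel (d m) \<bullet> vel v \<le> a m * norm (vel v)" unfolding a_def by (rule norm_cauchy_schwarz)
        moreover have "gr ((e m + e (m - 1)) /\<^sub>R 2) \<bullet> gr v \<le> b * norm (gr v)"
          unfolding b_def by (rule norm_cauchy_schwarz)
        moreover have "- (\<rho> m \<bullet> vel v) \<le> norm (\<rho> m) * norm (vel v)"
          using Cauchy_Schwarz_ineq2[of "\<rho> m" "vel v"] by linarith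
        ultimately show ?thesis by linarith
      qed
      also have "\<dots> \<le> ?M * (norm (vel v) + norm (gr v))"
        by (simp add: algebra_simps a_def b_def)
      finally show "di v \<bullet> z m \<le> ?M * (norm (vel v) + norm (gr v))" .
    qed
    then have "(\<beta> * norm (z m))\<^sup>2 \<le> ?M\<^sup>2"
      using \<beta> by (intro power_mono) auto
    also have "\<dots> \<le> 3 * ((norm (\<rho> m))\<^sup>2 + (a m)\<^sup>2 + b\<^sup>2)"
      using sum_squares_bound[of "norm (\<rho> m)" "a m"] sum_squares_bound[of "norm (\<rho> m)" b]
        sum_squares_bound[of "a m" b] by (simp add: power2_eq_square algebra_simps)
    finally show ?thesis
      using b by (simp add: power_mult_distrib)
  qed
  have S0: "0 \<le> S n" using g_le[of 0] by (simp add: g_def order_trans[OF zero_le_power2])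
  have "\<beta>\<^sup>2 * (\<Sum>m=1..n. \<tau> m * (norm (z m))\<^sup>2) = (\<Sum>m=1..n. \<tau> m * (\<beta>\<^sup>2 * (norm (z m))\<^sup>2))"
    by (simp add: sum_distrib_left mult.left_commute)
  also have "\<dots> \<le> (\<Sum>m=1..n. \<tau> m * (3 * ((norm (\<rho> m))\<^sup>2 + (a m)\<^sup>2 + S n)))"
    using z_le by (intro sum_mono mult_left_mono less_imp_le[OF \<tau>(1)])
  also have "\<dots> = 3 * ((\<Sum>m=1..n. \<tau> m * (norm (\<rho> m))\<^sup>2) + (\<Sum>m=1..n. \<tau> m * (a m)\<^sup>2) + S n * sum \<tau> {1..n})"
    by (simp add: sum_distrib_left sum.distrib[symmetric] algebra_simps)
  also have "\<dots> \<le> 3 * (S n + S n + S n * T)"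
  proof -
    have "(\<Sum>m=1..n. \<tau> m * (norm (\<rho> m))\<^sup>2) \<le> S n" by (simp add: S_def g_def)
    moreover have "(\<Sum>m=1..n. \<tau> m * (a m)\<^sup>2) \<le> S n" using energy[of n] by (simp add: g_def) (smt (verit) zero_le_power2)
    moreover have "S n * sum \<tau> {1..n} \<le> S n * T" using \<tau>(2) S0 by (intro mult_left_mono)
    ultimately show ?thesis by (intro mult_left_mono add_mono S0 \<tau>(2)) auto
  qed
  also have "\<dots> = 3 * (2 + T) * S n" by (simp add: algebra_simps)
  finally show ?thesis by (simp add: S_def g_def)
qed

end

section \<open>Regularity in time\<close>

lemma mean_value_bound:
  fixes y y' :: "real \<Rightarrow> 'a::real_normed_vector"
  assumes "a < b" "{a..b} \<subseteq> S"
    and "\<And>t. t \<in> S \<Longrightarrow> (y has_vector_derivative y' t) (at t within S)"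
    and "\<And>t. t \<in> S \<Longrightarrow> norm (y' t) \<le> M"
  shows "norm ((y b - y a) /\<^sub>R (b - a)) \<le> M"
proof -
  have "norm (y b - y a) \<le> M * \<bar>b - a\<bar>"
  proof (rule vector_derivative_bound[of "{a..b}" y y'])
    fix t assume "t \<in> {a..b}"
    then have t: "t \<in> S" using assms(2) by blast
    show "(y has_vector_derivative y' t) (at t within {a..b})"
      by (rule has_vector_derivative_within_subset[OF assms(3)[OF t] assms(2)])
    show "norm (y' t) \<le> M" by (rule assms(4)[OF t])
  qed (use assms(1) in auto)
  with assms(1) show ?thesis
    unfolding norm_scaleR by (simp add: field_simps)
qed

text \<open>
  The mean value inequality, first for \<open>y'\<close> and then for \<open>t \<mapsto> y t - (t - c) y' c\<close>.
\<close>

lemma linearization_bound: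
  fixes y y' y'' :: "real \<Rightarrow> 'a::real_normed_vector"
  assumes S: "convex S" and c: "c \<in> S" "s \<in> S" "\<And>t. t \<in> S \<Longrightarrow> \<bar>t - c\<bar> \<le> h"
    and d: "\<And>t. t \<in> S \<Longrightarrow> (y has_vector_derivative y' t) (at t within S)"
      "\<And>t. t \<in> S \<Longrightarrow> (y' has_vector_derivative y'' t) (at t within S)"
    and M: "\<And>t. t \<in> S \<Longrightarrow> norm (y'' t) \<le> M"
  shows "norm (y s - y c - (s - c) *\<^sub>R y' c) \<le> M * h * h"
proof -
  have M0: "M \<ge> 0" using M[OF c(1)] norm_ge_zero order_trans by blast
  have h0: "h \<ge> 0" using c(3)[OF c(1)] by simp
  have 1: "norm (y' t - y' c) \<le> M * h" if "t \<in> S" for t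
    using vector_derivative_bound[OF S d(2) M that c(1)] mult_left_mono[OF c(3)[OF that] M0] by linarith
  have 2: "((\<lambda>t. y t - (t - c) *\<^sub>R y' c) has_vector_derivative y' t - y' c) (at t within S)" if "t \<in> S" for t
    using d(1)[OF that] by (auto intro!: derivative_eq_intros)
  have "norm ((y s - (s - c) *\<^sub>R y' c) - (y c - (c - c) *\<^sub>R y' c)) \<le> M * h * \<bar>s - c\<bar>"
    by (rule vector_derivative_bound[OF S 2 1 c(2,1)])
  also have "\<dots> \<le> M * h * h"
    using M0 h0 c by (intro mult_left_mono) auto
  finally show ?thesis by (simp add: algebra_simps)
qed

text \<open>
  Linearize \<open>y\<close> at the midpoint; the linear terms of the two end points cancel.
\<close>

lemma midpoint_error:
  fixes y y' y'' :: "real \<Rightarrow> 'a::real_normed_vector"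
  assumes ab: "a < b" "{a..b} \<subseteq> S"
    and d: "\<And>t. t \<in> S \<Longrightarrow> (y has_vector_derivative y' t) (at t within S)"
      "\<And>t. t \<in> S \<Longrightarrow> (y' has_vector_derivative y'' t) (at t within S)"
    and M: "\<And>t. t \<in> S \<Longrightarrow> norm (y'' t) \<le> M"
  shows "norm (y ((a + b) / 2) - (y a + y b) /\<^sub>R 2) \<le> M * (b - a)\<^sup>2"
proof -
  define c where "c = (a + b) / 2"
  have lin: "norm (y s - y c - (s - c) *\<^sub>R y' c) \<le> M * (b - a) * (b - a)" if "s \<in> {a..b}" for s
  proof (rule linearization_bound[of "{a..b}" c s "b - a" y y' y'' M])
    fix t assume t: "t \<in> {a..b}"
    then have tS: "t \<in> S" using ab(2) by blast
    show "(y has_vector_derivative y' t) (at t within {a..b})" "(y' has_vector_derivative y'' t) (at t within {a..b})"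
      "norm (y'' t) \<le> M"
      by (rule has_vector_derivative_within_subset[OF _ ab(2)] d M tS)+
    show "\<bar>t - c\<bar> \<le> b - a" using t ab by (auto simp: c_def abs_le_iff field_simps)
  qed (use that ab in \<open>auto simp: c_def\<close>)
  have "y c - (y a + y b) /\<^sub>R 2 =
      (-1/2) *\<^sub>R ((y a - y c - (a - c) *\<^sub>R y' c) + (y b - y c - (b - c) *\<^sub>R y' c))"
  proof -
    have "(a - c) *\<^sub>R y' c + (b - c) *\<^sub>R y' c = 0"
      by (simp add: scaleR_add_left[symmetric] c_def field_simps)
    then have "(y a - y c - (a - c) *\<^sub>R y' c) + (y b - y c - (b - c) *\<^sub>R y' c) = y a + y b - 2 *\<^sub>R y c"
      by (simp add: scaleR_2 algebra_simps)
    then show ?thesis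
      by (simp only:) (simp add: scaleR_add_right scaleR_diff_right)
  qed
  also have "norm \<dots> \<le> (1/2) * (M * (b - a) * (b - a) + M * (b - a) * (b - a))"
    using norm_triangle_mono[OF lin[of a] lin[of b]] ab by simp
  finally show ?thesis by (simp add: c_def power2_eq_square)
qed

text \<open>
  The error, times the step size, is the value at \<open>b\<close> of a function that vanishes at \<open>a\<close> and whose
  derivative is half of a linearization error of \<open>y1\<close>.
\<close>

lemma trapezoid_error:
  fixes y y1 y2 y3 :: "real \<Rightarrow> 'a::real_normed_vector"
  assumes ab: "a < b" "{a..b} \<subseteq> S"
    and d: "\<And>t. t \<in> S \<Longrightarrow> (y has_vector_derivative y1 t) (at t within S)"
      "\<And>t. t \<in> S \<Longrightarrow> (y1 has_vector_derivative y2 t) (at t within S)"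
      "\<And>t. t \<in> S \<Longrightarrow> (y2 has_vector_derivative y3 t) (at t within S)"
    and M: "\<And>t. t \<in> S \<Longrightarrow> norm (y3 t) \<le> M"
  shows "norm ((y b - y a) /\<^sub>R (b - a) - (y1 a + y1 b) /\<^sub>R 2) \<le> M * (b - a)\<^sup>2"
proof -
  have d': "(y has_vector_derivative y1 t) (at t within {a..b})"
    "(y1 has_vector_derivative y2 t) (at t within {a..b})" "(y2 has_vector_derivative y3 t) (at t within {a..b})"
    if "t \<in> {a..b}" for t
  proof -
    have tS: "t \<in> S" using that ab(2) by blast
    show "(y has_vector_derivative y1 t) (at t within {a..b})" "(y1 has_vector_derivative y2 t) (at t within {a..b})"
      "(y2 has_vector_derivative y3 t) (at t within {a..b})"
      by (rule has_vector_derivative_within_subset[OF _ ab(2)] d tS)+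
  qed
  have M0: "M \<ge> 0" using order_trans[OF norm_ge_zero M[OF subsetD[OF ab(2), of a]]] ab by simp
  let ?g = "\<lambda>t. y t - y a - ((t - a) / 2) *\<^sub>R (y1 a + y1 t)"
  let ?k = "\<lambda>t. (1/2) *\<^sub>R (y1 t - y1 a - (t - a) *\<^sub>R y2 t)"
  have g: "(?g has_vector_derivative ?k t) (at t within {a..b})" if "t \<in> {a..b}" for t
  proof -
    have lin: "((\<lambda>t. (t - a) / 2) has_real_derivative 1/2) (at t within {a..b})"
      by (auto intro!: derivative_eq_intros)
    have "(?g has_vector_derivative (y1 t - 0) - (((t - a) / 2) *\<^sub>R (0 + y2 t) + (1/2) *\<^sub>R (y1 a + y1 t))) (at t within {a..b})"
      by (intro has_vector_derivative_diff has_vector_derivative_scaleR has_vector_derivative_add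
          has_vector_derivative_const d'[OF that] lin)
    then have "(?g has_vector_derivative y1 t - (((t - a) / 2) *\<^sub>R y2 t + (1/2) *\<^sub>R (y1 a + y1 t))) (at t within {a..b})"
      by simp
    moreover have "y1 t - (((t - a) / 2) *\<^sub>R y2 t + (1/2) *\<^sub>R (y1 a + y1 t)) = ?k t"
    proof -
      have half: "y1 t - (1/2) *\<^sub>R y1 t = (1/2) *\<^sub>R y1 t"
        using scaleR_left_diff_distrib[of 1 "1/2" "y1 t"] by simp
      have "y1 t - (((t - a) / 2) *\<^sub>R y2 t + (1/2) *\<^sub>R (y1 a + y1 t)) =
          (y1 t - (1/2) *\<^sub>R y1 t) - (1/2) *\<^sub>R y1 a - ((t - a) / 2) *\<^sub>R y2 t"
        by (simp add: scaleR_add_right)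
      then show ?thesis
        unfolding half by (simp add: scaleR_diff_right)
    qed
    ultimately show ?thesis by simp
  qed
  \<comment> \<open>\<open>?k\<close> is half the error of the linearization of \<open>y1\<close> at \<open>t\<close>, evaluated at \<open>a\<close>.\<close>
  have k: "norm (?k t) \<le> M * (b - a) * (b - a)" if t: "t \<in> {a..b}" for t
  proof -
    have "norm (y1 a - y1 t - (a - t) *\<^sub>R y2 t) \<le> M * (b - a) * (b - a)"
      by (rule linearization_bound[of "{a..b}" t a "b - a" y1 y2 y3 M]) (use t ab d' M in auto)
    moreover have "?k t = (-1/2) *\<^sub>R (y1 a - y1 t - (a - t) *\<^sub>R y2 t)"
      by (simp add: scaleR_diff_right scaleR_diff_left)
    then have "norm (?k t) = norm (y1 a - y1 t - (a - t) *\<^sub>R y2 t) / 2"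
      by (simp only: norm_scaleR abs_divide abs_minus_cancel abs_one abs_numeral)
    ultimately show ?thesis
      using norm_ge_zero[of "y1 a - y1 t - (a - t) *\<^sub>R y2 t"] by linarith
  qed
  have "norm (?g b - ?g a) \<le> M * (b - a) * (b - a) * \<bar>b - a\<bar>"
    by (rule vector_derivative_bound[OF _ g k]) (use ab in auto)
  then have "norm (?g b) \<le> M * (b - a)\<^sup>2 * (b - a)"
    using ab by (simp add: power2_eq_square mult.assoc)
  moreover have "(y b - y a) /\<^sub>R (b - a) - (y1 a + y1 b) /\<^sub>R 2 = ?g b /\<^sub>R (b - a)"
    using ab by (simp add: scaleR_diff_right)
  moreover have "\<bar>inverse h\<bar> * N \<le> Q" if "N \<le> Q * h" "h > 0" for N Q h :: real
    using that by (simp add: field_simps)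
  ultimately show ?thesis
    using ab(1) by (simp only: norm_scaleR diff_gt_0_iff_gt)
qed

context bounded_open_set
begin

text \<open>
  Every spatial derivative of a function that is smooth in time with values in \<open>H\<^sup>m\<close> is a smooth curve
  in the space of square-integrable functions, because its norm is part of the norm of \<open>H\<^sup>m\<close>.
\<close>

lemma C_time_curves:
  fixes w :: "real \<Rightarrow> real^'d \<Rightarrow> 'b::euclidean_space"
  assumes "C_time \<Omega> T k m w"
  obtains W where "W 0 = w" "\<And>j t. j \<le> k \<Longrightarrow> t \<in> {0..T} \<Longrightarrow> W j t \<in> H_space \<Omega> m"
    "\<And>is j. length is \<le> m \<Longrightarrow> j \<le> k \<Longrightarrow> continuous_on {0..T} (\<lambda>t. D is (W j t))"
    "\<And>is j t. length is \<le> m \<Longrightarrow> j < k \<Longrightarrow> t \<in> {0..T} \<Longrightarrow>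
      ((\<lambda>s. D is (W j s)) has_vector_derivative D is (W (Suc j) t)) (at t within {0..T})"
proof -
  obtain W where W0: "W 0 = w"
    and W1: "\<forall>j\<le>k. \<forall>t\<in>{0..T}. W j t \<in> H_space \<Omega> m \<and>
      ((\<lambda>s. H_norm \<Omega> m (\<lambda>x. W j s x - W j t x)) \<longlongrightarrow> 0) (at t within {0..T})"
    and W2: "\<forall>j<k. \<forall>t\<in>{0..T}.
      ((\<lambda>s. H_norm \<Omega> m (\<lambda>x. (W j s x - W j t x) /\<^sub>R (s - t) - W (Suc j) t x)) \<longlongrightarrow> 0) (at t within {0..T})"
    using assms unfolding C_time_def by (elim exE conjE) (rule that)
  note W = W0 W1[rule_format, THEN conjunct1] W1[rule_format, THEN conjunct2] W2[rule_format]
  have near: "\<forall>\<^sub>F s in at t within {0..T}. s \<in> {0..T}" for t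
    by (simp add: eventually_at_filter)
  show ?thesis
  proof
    show "W 0 = w" by (rule W)
    show "\<And>j t. j \<le> k \<Longrightarrow> t \<in> {0..T} \<Longrightarrow> W j t \<in> H_space \<Omega> m" by (rule W)
    fix "is" :: "'d list" and j assume l: "length is \<le> m"
    show "continuous_on {0..T} (\<lambda>t. D is (W j t))" if j: "j \<le> k"
      unfolding continuous_on_def
    proof
      fix t assume t: "t \<in> {0..T}"
      have "((\<lambda>s. norm (D is (W j s) - D is (W j t))) \<longlongrightarrow> 0) (at t within {0..T})"
      proof (rule tendsto_sandwich[OF _ _ tendsto_const W(3)[OF j t]])
        show "\<forall>\<^sub>F s in at t within {0..T}. norm (D is (W j s) - D is (W j t)) \<le> H_norm \<Omega> m (\<lambda>x. W j s x - W j t x)"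
          using near
        proof eventually_elim
          case (elim s)
          note H = W(2)[OF j elim] W(2)[OF j t]
          show ?case
            unfolding D_diff[OF H l, symmetric] by (rule norm_D_le_H_norm[OF H_space_diff[OF H] l])
        qed
      qed simp
      then show "((\<lambda>t. D is (W j t)) \<longlongrightarrow> D is (W j t)) (at t within {0..T})"
        by (simp add: tendsto_norm_zero_iff LIM_zero_iff)
    qed
    show "((\<lambda>s. D is (W j s)) has_vector_derivative D is (W (Suc j) t)) (at t within {0..T})"
      if j: "j < k" and t: "t \<in> {0..T}" for t
      unfolding has_vector_derivative_iff_quotient
    proof (rule tendsto_sandwich[OF _ _ tendsto_const W(4)[OF j t]])
      show "\<forall>\<^sub>F s in at t within {0..T}. norm ((D is (W j s) - D is (W j t)) /\<^sub>R (s - t) - D is (W (Suc j) t)) \<le>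
          H_norm \<Omega> m (\<lambda>x. (W j s x - W j t x) /\<^sub>R (s - t) - W (Suc j) t x)"
        using near
      proof eventually_elim
        case (elim s)
        have H: "W j s \<in> H_space \<Omega> m" "W j t \<in> H_space \<Omega> m" "W (Suc j) t \<in> H_space \<Omega> m"
          using j t elim by (auto intro!: W(2))
        note Hd = H_space_diff[OF H(1,2)]
        note Hq = H_space_scaleR[OF Hd, of "inverse (s - t)"]
        have "D is (\<lambda>x. (W j s x - W j t x) /\<^sub>R (s - t) - W (Suc j) t x) = (D is (W j s) - D is (W j t)) /\<^sub>R (s - t) - D is (W (Suc j) t)"
          by (simp add: D_diff[OF Hq H(3) l] D_scaleR[OF Hd l] D_diff[OF H(1,2) l])
        then show ?case
          using norm_D_le_H_norm[OF H_space_diff[OF Hq H(3)] l] by simp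
      qed
    qed simp
  qed
qed

text \<open>
  Derivatives of curves are unique, so the choice operator has no freedom beyond null sets.
\<close>

lemma time_deriv_AE_eqI:
  fixes w :: "real \<Rightarrow> real^'d \<Rightarrow> 'b::euclidean_space"
  assumes w: "\<And>s. s \<in> J \<Longrightarrow> w s \<in> L2 \<Omega>" and g: "g \<in> L2 \<Omega>" and t: "t \<in> J" "at t within J \<noteq> bot"
    and deriv: "((\<lambda>s. cls (w s)) has_vector_derivative cls g) (at t within J)"
  shows "time_deriv \<Omega> J w t \<in> L2 \<Omega>" "AE x in lebesgue_on \<Omega>. time_deriv \<Omega> J w t x = g x"
proof -
  have iff: "((\<lambda>s. L2_norm \<Omega> (\<lambda>x. (w s x - w t x) /\<^sub>R (s - t) - h x)) \<longlongrightarrow> 0) (at t within J) \<longleftrightarrow>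
      ((\<lambda>s. cls (w s)) has_vector_derivative cls h) (at t within J)" if h: "h \<in> L2 \<Omega>" for h
    unfolding has_vector_derivative_iff_quotient
  proof (rule filterlim_cong[OF refl refl])
    show "\<forall>\<^sub>F s in at t within J. L2_norm \<Omega> (\<lambda>x. (w s x - w t x) /\<^sub>R (s - t) - h x) =
        norm ((cls (w s) - cls (w t)) /\<^sub>R (s - t) - cls h)"
      unfolding eventually_at_filter
    proof (rule always_eventually, intro allI impI)
      fix s assume "s \<in> J"
      note L2 = w[OF \<open>s \<in> J\<close>] w[OF t(1)]
      note L2d = L2_diff[OF L2]
      note L2q = L2_scaleR[OF L2d, of "inverse (s - t)"]
      show "L2_norm \<Omega> (\<lambda>x. (w s x - w t x) /\<^sub>R (s - t) - h x) = norm ((cls (w s) - cls (w t)) /\<^sub>R (s - t) - cls h)"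
        by (simp add: norm_cls[OF L2_diff[OF L2q h], symmetric] cls_diff[OF L2q h] cls_scaleR[OF L2d] cls_diff[OF L2])
    qed
  qed
  let ?P = "\<lambda>h. h \<in> L2 \<Omega> \<and> ((\<lambda>s. L2_norm \<Omega> (\<lambda>x. (w s x - w t x) /\<^sub>R (s - t) - h x)) \<longlongrightarrow> 0) (at t within J)"
  have "?P (time_deriv \<Omega> J w t)"
    unfolding time_deriv_def by (rule someI[of ?P g]) (use g iff[OF g] deriv in simp)
  then have td: "time_deriv \<Omega> J w t \<in> L2 \<Omega>"
    "((\<lambda>s. cls (w s)) has_vector_derivative cls (time_deriv \<Omega> J w t)) (at t within J)"
    using iff by auto
  have "cls (time_deriv \<Omega> J w t) = cls g"
    by (rule vector_derivative_unique_within[OF t(2) td(2) deriv])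
  with td(1) g show "time_deriv \<Omega> J w t \<in> L2 \<Omega>" "AE x in lebesgue_on \<Omega>. time_deriv \<Omega> J w t x = g x"
    by (simp_all add: cls_eq_iff)
qed

lemma continuous_on_D_bounded:
  fixes w :: "real \<Rightarrow> real^'d \<Rightarrow> 'b::euclidean_space"
  assumes "\<And>is. length is \<le> m \<Longrightarrow> continuous_on {0..T} (\<lambda>t. D is (w t))"
  obtains M where "M \<ge> 0" "\<And>is t. length is \<le> m \<Longrightarrow> t \<in> {0..T} \<Longrightarrow> norm (D is (w t)) \<le> M"
proof -
  have "\<exists>M. \<forall>t\<in>{0..T}. norm (D is (w t)) \<le> M" if "length is \<le> m" for "is" :: "'d list"
    using compact_imp_bounded[OF compact_continuous_image[OF assms[OF that]]] by (auto simp: bounded_iff)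
  then obtain B :: "'d list \<Rightarrow> real" where B: "\<And>is t. length is \<le> m \<Longrightarrow> t \<in> {0..T} \<Longrightarrow> norm (D is (w t)) \<le> B is"
    by metis
  show ?thesis
  proof
    show "0 \<le> (\<Sum>is | length is \<le> m. \<bar>B is\<bar>)" by (simp add: sum_nonneg)
    fix "is" :: "'d list" and t assume *: "length is \<le> m" "t \<in> {0..T}"
    have "\<bar>B is\<bar> \<le> (\<Sum>is | length is \<le> m. \<bar>B is\<bar>)"
      using * by (intro member_le_sum) (auto simp: finite_multiindices)
    with B[OF *] show "norm (D is (w t)) \<le> (\<Sum>is | length is \<le> m. \<bar>B is\<bar>)" by linarith
  qed
qed

text \<open>
  The momentum equation, tested with a function in \<open>H\<^sup>1\<^sub>0\<close>. It is assumed for positive times only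
  and extends to the initial time by continuity.
\<close>

lemma weak_momentum_equation:
  fixes W :: "nat \<Rightarrow> real \<Rightarrow> real^'d \<Rightarrow> real^'d"
  assumes T: "T > 0" and sol: "nonstationary_solution \<Omega> T f u\<^sub>0 u p" and m: "m \<ge> 2"
    and W: "W 0 = u" "\<And>j t. j \<le> 1 \<Longrightarrow> t \<in> {0..T} \<Longrightarrow> W j t \<in> H_space \<Omega> m"
      "\<And>is j. length is \<le> m \<Longrightarrow> j \<le> 1 \<Longrightarrow> continuous_on {0..T} (\<lambda>t. D is (W j t))"
      "\<And>is t. length is \<le> m \<Longrightarrow> t \<in> {0..T} \<Longrightarrow>
        ((\<lambda>s. D is (W 0 s)) has_vector_derivative D is (W 1 t)) (at t within {0..T})"
    and p: "\<And>t. t \<in> {0..T} \<Longrightarrow> p t \<in> H_space \<Omega> 1" "continuous_on {0..T} (\<lambda>t. cls (p t))"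
    and f: "\<And>t. t \<in> {0..T} \<Longrightarrow> f t \<in> L2 \<Omega>" "continuous_on {0..T} (\<lambda>t. cls (f t))"
    and t: "t \<in> {0..T}" and v: "v \<in> V_space \<Omega>"
  shows "cls (W 1 t) \<bullet> cls v + grad (u t) \<bullet> grad v - dv v \<bullet> cls (p t) = cls (f t) \<bullet> cls v"
proof -
  have v1: "v \<in> H_space \<Omega> 1" by (rule V_space_H1[OF v])
  have u2: "u s \<in> H_space \<Omega> 2" and u1: "u s \<in> H_space \<Omega> 1" and W1: "W 1 s \<in> L2 \<Omega>" if "s \<in> {0..T}" for s
  proof -
    have 0: "u s \<in> H_space \<Omega> m" using W(2)[OF zero_le_one that] W(1) by simp
    show "u s \<in> H_space \<Omega> 2" "u s \<in> H_space \<Omega> 1"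
      by (rule H_space_mono[OF 0], use m in simp)+
    show "W 1 s \<in> L2 \<Omega>" by (rule H_space_L2[OF W(2)[OF order_refl that]])
  qed
  define F where "F s = cls (W 1 s) \<bullet> cls v + grad (u s) \<bullet> grad v - dv v \<bullet> cls (p s) - cls (f s) \<bullet> cls v" for s
  have F0: "F s = 0" if s: "s \<in> {0<..T}" for s
  proof -
    have s': "s \<in> {0..T}" using s by auto
    have ae1: "AE x in lebesgue_on \<Omega>. time_deriv \<Omega> {0..T} u s x = W 1 s x"
    proof (rule time_deriv_AE_eqI)
      show "at s within {0..T} \<noteq> bot"
        using T s' by (simp add: trivial_limit_within islimpt_Icc)
      have "((\<lambda>s. D [] (W 0 s)) has_vector_derivative D [] (W 1 s)) (at s within {0..T})"
        by (rule W(4)) (use s' in auto)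
      then have "((\<lambda>s. D [] (u s)) has_vector_derivative cls (W 1 s)) (at s within {0..T})"
        by (simp add: W(1) D_Nil[OF W1[OF s']])
      then show "((\<lambda>s. cls (u s)) has_vector_derivative cls (W 1 s)) (at s within {0..T})"
        by (rule has_vector_derivative_transform[OF s', rotated]) (simp add: D_Nil[OF H_space_L2[OF u1]])
    qed (use s' u1 W1 in \<open>auto intro: H_space_L2\<close>)
    have ae2: "AE x in lebesgue_on \<Omega>. time_deriv \<Omega> {0..T} u s x - Laplacian \<Omega> (u s) x + gradient \<Omega> (p s) x = f s x"
      using sol s unfolding nonstationary_solution_def by (auto elim: eventually_mono)
    note L2L = Laplacian_L2[OF u2[OF s']] and L2g = gradient_L2[OF p(1)[OF s']]
    have "cls (f s) = cls (\<lambda>x. (W 1 s x - Laplacian \<Omega> (u s) x) + gradient \<Omega> (p s) x)"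
    proof (subst cls_eq_iff)
      show "AE x in lebesgue_on \<Omega>. f s x = (W 1 s x - Laplacian \<Omega> (u s) x) + gradient \<Omega> (p s) x"
        using ae1 ae2 by eventually_elim simp
    qed (intro f(1)[OF s'] L2_add L2_diff W1[OF s'] L2L L2g)+
    then have "cls (f s) = (cls (W 1 s) - cls (Laplacian \<Omega> (u s))) + cls (gradient \<Omega> (p s))"
      by (simp add: cls_add[OF L2_diff[OF W1[OF s'] L2L] L2g] cls_diff[OF W1[OF s'] L2L])
    moreover have "dv v \<bullet> cls (p s) = cls (p s) \<bullet> dv v" by (rule inner_commute)
    ultimately show ?thesis
      by (simp add: F_def inner_add_left inner_diff_left Laplacian_pairing[OF u2[OF s'] v]
          gradient_pairing[OF p(1)[OF s'] v])
  qed
  have "continuous_on {0..T} F"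
  proof -
    have "continuous_on {0..T} (\<lambda>s. D [] (W 1 s))" by (rule W(3)) auto
    then have c1: "continuous_on {0..T} (\<lambda>s. cls (W 1 s))"
      by (rule continuous_on_eq) (simp add: D_Nil W1)
    have "continuous_on {0..T} (\<lambda>s. \<Sum>i\<in>UNIV. D [i] (W 0 s) \<bullet> D [i] v)"
      by (intro continuous_on_sum continuous_on_inner continuous_on_const W(3)) (use m in auto)
    then have c2: "continuous_on {0..T} (\<lambda>s. grad (u s) \<bullet> grad v)"
      by (rule continuous_on_eq) (simp add: W(1) inner_grad[OF u1 v1])
    show ?thesis
      unfolding F_def by (intro continuous_intros c1 c2 p f)
  qed
  then have "closed ({0..T} \<inter> F -` {0})"
    by (intro continuous_closed_preimage) auto
  moreover have "{0<..<T} \<subseteq> {0..T} \<inter> F -` {0}" using F0 by auto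
  ultimately have "closure {0<..<T} \<subseteq> {0..T} \<inter> F -` {0}" by (intro closure_minimal)
  with t T have "F t = 0" by auto
  then show ?thesis by (simp add: F_def)
qed

end

section \<open>Finite element spaces\<close>

text \<open>
  Gaussian elimination: if some element of \<open>X\<close> needs a nonzero coefficient at the index \<open>j\<close>, then
  multiples of it remove this coefficient from all others.
\<close>

lemma finite_span_of_coefficients:
  fixes X :: "'x::real_vector set" and R :: "('i \<Rightarrow> real) \<Rightarrow> 'x \<Rightarrow> bool"
  assumes "finite I" "subspace X"
    and "\<And>c d x y a. R c x \<Longrightarrow> R d y \<Longrightarrow> R (\<lambda>i. c i + a * d i) (x + a *\<^sub>R y)"
    and "\<And>x. x \<in> X \<Longrightarrow> \<exists>c. R c x"
    and "\<And>x c. x \<in> X \<Longrightarrow> R c x \<Longrightarrow> (\<And>i. i \<in> I \<Longrightarrow> c i = 0) \<Longrightarrow> x = 0"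
  shows "\<exists>B. finite B \<and> B \<subseteq> X \<and> X \<subseteq> span B"
  using assms
proof (induction I arbitrary: X R rule: finite_induct)
  case empty
  then have "X \<subseteq> {0}" by blast
  then show ?case by (intro exI[of _ "{}"]) auto
next
  case (insert j I)
  let ?R = "\<lambda>c x. R c x \<and> c j = 0"
  define X' where "X' = {x \<in> X. \<exists>c. ?R c x}"
  have X'_0: "0 \<in> X'"
  proof -
    obtain c where c: "R c 0" using insert.prems(3)[OF subspace_0[OF insert.prems(1)]] by blast
    have "R (\<lambda>i. c i + (-1) * c i) (0 + (-1) *\<^sub>R 0)" by (rule insert.prems(2)[OF c c])
    then show ?thesis
      using subspace_0[OF insert.prems(1)] by (auto simp: X'_def intro!: exI[of _ "\<lambda>i. c i + (-1) * c i"])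
  qed
  have lin: "?R (\<lambda>i. c i + a * d i) (x + a *\<^sub>R y)" if "?R c x" "?R d y" for c d x y a
    using insert.prems(2)[of c x d y a] that by simp
  have closed: "x + a *\<^sub>R y \<in> X'" if xy: "x \<in> X'" "y \<in> X'" for x y a
  proof -
    obtain c d where "?R c x" "?R d y" using xy by (auto simp: X'_def)
    from lin[OF this, of a] have "\<exists>c. ?R c (x + a *\<^sub>R y)" by blast
    moreover have "x + a *\<^sub>R y \<in> X"
      using xy insert.prems(1) by (auto simp: X'_def intro!: subspace_add subspace_scale)
    ultimately show ?thesis by (simp add: X'_def)
  qed
  have X': "subspace X'"
    unfolding subspace_def
    using X'_0 closed[of _ _ 1] closed[OF X'_0] by simp
  have "\<exists>B. finite B \<and> B \<subseteq> X' \<and> X' \<subseteq> span B"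
  proof (rule insert.IH[of X' ?R])
    show "\<exists>c. ?R c x" if "x \<in> X'" for x using that by (simp add: X'_def)
    show "x = 0" if "x \<in> X'" "?R c x" "\<And>i. i \<in> I \<Longrightarrow> c i = 0" for x c
      using that insert.prems(4)[of x c] by (auto simp: X'_def)
  qed (use X' lin in auto)
  then obtain B where B: "finite B" "B \<subseteq> X'" "X' \<subseteq> span B" by blast
  show ?case
  proof (cases "X \<subseteq> X'")
    case True
    with B show ?thesis by (intro exI[of _ B]) (auto simp: X'_def)
  next
    case False
    then obtain x0 where x0: "x0 \<in> X" "x0 \<notin> X'" by blast
    obtain c0 where c0: "R c0 x0" using insert.prems(3)[OF x0(1)] by blast
    have c0j: "c0 j \<noteq> 0" using x0 c0 by (auto simp: X'_def)
    have "x \<in> span (insert x0 B)" if x: "x \<in> X" for x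
    proof -
      obtain c where c: "R c x" using insert.prems(3)[OF x] by blast
      let ?a = "- (c j / c0 j)"
      have "R (\<lambda>i. c i + ?a * c0 i) (x + ?a *\<^sub>R x0)"
        by (rule insert.prems(2)[OF c c0])
      moreover have "c j + ?a * c0 j = 0" using c0j by simp
      moreover have "x + ?a *\<^sub>R x0 \<in> X"
        using x x0(1) insert.prems(1) by (intro subspace_add subspace_scale)
      ultimately have "x + ?a *\<^sub>R x0 \<in> X'"
        unfolding X'_def by blast
      then have "x + ?a *\<^sub>R x0 \<in> span (insert x0 B)"
        using B(3) span_mono[of B "insert x0 B"] by blast
      moreover have "x0 \<in> span (insert x0 B)" by (simp add: span_base)
      ultimately have "(x + ?a *\<^sub>R x0) + (c j / c0 j) *\<^sub>R x0 \<in> span (insert x0 B)"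
        by (rule span_add[OF _ span_scale])
      moreover have "(x + ?a *\<^sub>R x0) + (c j / c0 j) *\<^sub>R x0 = x" by simp
      ultimately show ?thesis by (simp only:)
    qed
    then show ?thesis
      using B x0 by (intro exI[of _ "insert x0 B"]) (auto simp: X'_def)
  qed
qed

lemma finite_multiexponents: "finite {\<alpha> :: 'd::finite \<Rightarrow> nat. sum \<alpha> UNIV \<le> l}"
proof (rule finite_subset)
  show "{\<alpha> :: 'd \<Rightarrow> nat. sum \<alpha> UNIV \<le> l} \<subseteq> PiE UNIV (\<lambda>_. {..l})"
  proof
    fix \<alpha> :: "'d \<Rightarrow> nat" assume "\<alpha> \<in> {\<alpha>. sum \<alpha> UNIV \<le> l}"
    moreover have "\<alpha> i \<le> sum \<alpha> UNIV" for i by (rule member_le_sum) auto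
    ultimately show "\<alpha> \<in> PiE UNIV (\<lambda>_. {..l})" by (auto intro: order_trans)
  qed
qed (auto intro: finite_PiE)

text \<open>
  A piecewise mapped polynomial is determined by its values on the cells, hence by finitely many
  coefficients. Functions and coefficients are connected by a relation that is closed
  under linear combinations and in which coefficients 0 represent null functions only, because the
  cells cover the domain.
\<close>

lemma piecewise_polynomials_finite_dimensional:
  fixes S :: "(real^'d \<Rightarrow> 'b::euclidean_space) set" and E :: "(real^'d \<Rightarrow> 'b) \<Rightarrow> 'x::real_vector"
  assumes mesh: "is_mesh \<Omega> \<D>"
    and loc: "\<And>K. K \<in> cells \<D> \<Longrightarrow> mapped_polynomial_space l (ref_cell \<D> K) (ref_map \<D> K) (L K)"
    and S: "\<And>v K. v \<in> S \<Longrightarrow> K \<in> cells \<D> \<Longrightarrow> \<exists>g\<in>L K. AE x in lebesgue_on \<Omega>. x \<in> K \<longrightarrow> v x = g x"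
    and comb: "\<And>v w a. v \<in> S \<Longrightarrow> w \<in> S \<Longrightarrow> (\<lambda>x. v x + a *\<^sub>R w x) \<in> S \<and> E (\<lambda>x. v x + a *\<^sub>R w x) = E v + a *\<^sub>R E w"
    and sub: "subspace (E ` S)"
    and zero: "\<And>v. v \<in> S \<Longrightarrow> AE x in lebesgue_on \<Omega>. v x = 0 \<Longrightarrow> E v = 0"
  shows "\<exists>B. finite B \<and> B \<subseteq> E ` S \<and> E ` S \<subseteq> span B"
proof -
  let ?A = "{\<alpha> :: 'd \<Rightarrow> nat. sum \<alpha> UNIV \<le> l}"
  let ?I = "cells \<D> \<times> ?A \<times> (Basis :: 'b set)"
  define val where "val c K y = (\<Sum>\<alpha>\<in>?A. (\<Prod>i\<in>UNIV. (y $ i) ^ \<alpha> i) *\<^sub>R (\<Sum>b\<in>Basis. c (K, \<alpha>, b) *\<^sub>R b))"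
    for c :: "(real^'d) set \<times> ('d \<Rightarrow> nat) \<times> 'b \<Rightarrow> real" and K and y :: "real^'d"
  define R where "R c z \<longleftrightarrow> (\<exists>v\<in>S. z = E v \<and> (\<forall>K\<in>cells \<D>. AE x in lebesgue_on \<Omega>. x \<in> K \<longrightarrow>
      (\<forall>y\<in>ref_cell \<D> K. ref_map \<D> K y = x \<longrightarrow> v x = val c K y)))" for c z
  have val_lin: "val (\<lambda>i. c i + a * d i) K y = val c K y + a *\<^sub>R val d K y" for c d a K y
  proof -
    define m where "m \<alpha> = (\<Prod>i\<in>UNIV. (y $ i) ^ \<alpha> i)" for \<alpha> :: "'d \<Rightarrow> nat"
    have "m \<alpha> *\<^sub>R (\<Sum>b\<in>Basis. (c (K, \<alpha>, b) + a * d (K, \<alpha>, b)) *\<^sub>R b) =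
        m \<alpha> *\<^sub>R (\<Sum>b\<in>Basis. c (K, \<alpha>, b) *\<^sub>R b) +
        a *\<^sub>R m \<alpha> *\<^sub>R (\<Sum>b\<in>Basis. d (K, \<alpha>, b) *\<^sub>R (b :: 'b))" for \<alpha>
    proof -
      have "(\<Sum>b\<in>Basis. (c (K, \<alpha>, b) + a * d (K, \<alpha>, b)) *\<^sub>R b) =
          (\<Sum>b\<in>Basis. c (K, \<alpha>, b) *\<^sub>R b) + a *\<^sub>R (\<Sum>b\<in>Basis. d (K, \<alpha>, b) *\<^sub>R (b :: 'b))"
        by (simp add: scaleR_add_left sum.distrib scaleR_sum_right)
      then show ?thesis
        by (simp only: scaleR_add_right scaleR_left_commute)
    qed
    then show ?thesis
      unfolding val_def m_def[symmetric] by (simp only: sum.distrib scaleR_right.sum)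
  qed
  show ?thesis
  proof (rule finite_span_of_coefficients[of ?I "E ` S" R])
    show "finite ?I"
      using mesh by (auto simp: is_mesh_def intro!: finite_cartesian_product finite_multiexponents)
    show "subspace (E ` S)" by (rule sub)
  next
    fix c d x y and a :: real
    assume "R c x" "R d y"
    then obtain v w where v: "v \<in> S" "x = E v" and w: "w \<in> S" "y = E w"
      and ae: "\<And>K. K \<in> cells \<D> \<Longrightarrow> AE x in lebesgue_on \<Omega>. x \<in> K \<longrightarrow>
          (\<forall>y\<in>ref_cell \<D> K. ref_map \<D> K y = x \<longrightarrow> v x = val c K y)"
        "\<And>K. K \<in> cells \<D> \<Longrightarrow> AE x in lebesgue_on \<Omega>. x \<in> K \<longrightarrow>
          (\<forall>y\<in>ref_cell \<D> K. ref_map \<D> K y = x \<longrightarrow> w x = val d K y)"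
      unfolding R_def by blast
    show "R (\<lambda>i. c i + a * d i) (x + a *\<^sub>R y)"
      unfolding R_def
    proof (intro bexI[of _ "\<lambda>x. v x + a *\<^sub>R w x"] conjI ballI)
      show "x + a *\<^sub>R y = E (\<lambda>x. v x + a *\<^sub>R w x)" "(\<lambda>x. v x + a *\<^sub>R w x) \<in> S"
        using comb[OF v(1) w(1), of a] v w by auto
      fix K assume K: "K \<in> cells \<D>"
      show "AE x in lebesgue_on \<Omega>. x \<in> K \<longrightarrow>
          (\<forall>y\<in>ref_cell \<D> K. ref_map \<D> K y = x \<longrightarrow> v x + a *\<^sub>R w x = val (\<lambda>i. c i + a * d i) K y)"
        using ae(1)[OF K] ae(2)[OF K] by eventually_elim (auto simp: val_lin)
    qed
  next
    fix z assume "z \<in> E ` S"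
    then obtain v where v: "v \<in> S" "z = E v" by blast
    have "\<forall>K\<in>cells \<D>. \<exists>gk. (AE x in lebesgue_on \<Omega>. x \<in> K \<longrightarrow> v x = fst gk x) \<and>
        (\<forall>y\<in>ref_cell \<D> K. fst gk (ref_map \<D> K y) = (\<Sum>\<alpha>\<in>?A. (\<Prod>i\<in>UNIV. (y $ i) ^ \<alpha> i) *\<^sub>R snd gk \<alpha>))"
    proof
      fix K assume K: "K \<in> cells \<D>"
      obtain g where g: "g \<in> L K" "AE x in lebesgue_on \<Omega>. x \<in> K \<longrightarrow> v x = g x"
        using S[OF v(1) K] by blast
      then obtain g' where g': "polynomial_map l g'" "\<forall>y\<in>ref_cell \<D> K. g (ref_map \<D> K y) = g' y"
        using loc[OF K] unfolding mapped_polynomial_space_def by blast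
      then obtain k where "\<And>y. g' y = (\<Sum>\<alpha>\<in>?A. (\<Prod>i\<in>UNIV. (y $ i) ^ \<alpha> i) *\<^sub>R k \<alpha>)"
        unfolding polynomial_map_def by blast
      with g(2) g'(2) show "\<exists>gk. (AE x in lebesgue_on \<Omega>. x \<in> K \<longrightarrow> v x = fst gk x) \<and>
        (\<forall>y\<in>ref_cell \<D> K. fst gk (ref_map \<D> K y) = (\<Sum>\<alpha>\<in>?A. (\<Prod>i\<in>UNIV. (y $ i) ^ \<alpha> i) *\<^sub>R snd gk \<alpha>))"
        by (intro exI[of _ "(g, k)"]) simp
    qed
    from bchoice[OF this] obtain gk where gk: "\<And>K. K \<in> cells \<D> \<Longrightarrow> AE x in lebesgue_on \<Omega>. x \<in> K \<longrightarrow> v x = fst (gk K) x"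
      "\<And>K y. K \<in> cells \<D> \<Longrightarrow> y \<in> ref_cell \<D> K \<Longrightarrow>
        fst (gk K) (ref_map \<D> K y) = (\<Sum>\<alpha>\<in>?A. (\<Prod>i\<in>UNIV. (y $ i) ^ \<alpha> i) *\<^sub>R snd (gk K) \<alpha>)"
      by blast
    define c where "c i = (case i of (K, \<alpha>, b) \<Rightarrow> snd (gk K) \<alpha> \<bullet> b)" for i
    have val_c: "val c K y = (\<Sum>\<alpha>\<in>?A. (\<Prod>i\<in>UNIV. (y $ i) ^ \<alpha> i) *\<^sub>R snd (gk K) \<alpha>)" for K y
      by (simp add: val_def c_def euclidean_representation)
    have "\<forall>K\<in>cells \<D>. AE x in lebesgue_on \<Omega>. x \<in> K \<longrightarrow>
        (\<forall>y\<in>ref_cell \<D> K. ref_map \<D> K y = x \<longrightarrow> v x = val c K y)"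
    proof
      fix K assume K: "K \<in> cells \<D>"
      show "AE x in lebesgue_on \<Omega>. x \<in> K \<longrightarrow>
          (\<forall>y\<in>ref_cell \<D> K. ref_map \<D> K y = x \<longrightarrow> v x = val c K y)"
        using gk(1)[OF K] by eventually_elim (auto simp: val_c gk(2)[OF K, symmetric])
    qed
    then show "\<exists>c. R c z"
      using v unfolding R_def by blast
  next
    fix z c assume "R c z" and c: "\<And>i. i \<in> ?I \<Longrightarrow> c i = 0"
    then obtain v where v: "v \<in> S" "z = E v"
      and ae: "\<And>K. K \<in> cells \<D> \<Longrightarrow> AE x in lebesgue_on \<Omega>. x \<in> K \<longrightarrow>
          (\<forall>y\<in>ref_cell \<D> K. ref_map \<D> K y = x \<longrightarrow> v x = val c K y)"
      unfolding R_def by blast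
    have val0: "val c K y = 0" if "K \<in> cells \<D>" for K y
      using c that by (simp add: val_def)
    have "AE x in lebesgue_on \<Omega>. \<forall>K\<in>cells \<D>. x \<in> K \<longrightarrow>
        (\<forall>y\<in>ref_cell \<D> K. ref_map \<D> K y = x \<longrightarrow> v x = 0)"
      using mesh ae by (intro AE_finite_allI) (auto simp: is_mesh_def val0 cong: ball_cong elim!: eventually_mono)
    moreover have "AE x in lebesgue_on \<Omega>. x \<in> \<Omega>"
      by (rule AE_I2) simp
    ultimately have "AE x in lebesgue_on \<Omega>. v x = 0"
    proof eventually_elim
      case (elim x)
      then have "x \<in> closure \<Omega>" using closure_subset by blast
      moreover have "\<Union> (cells \<D>) = closure \<Omega>" using mesh by (simp add: is_mesh_def)
      ultimately obtain K where K: "K \<in> cells \<D>" "x \<in> K" by blast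
      have "ref_map \<D> K ` ref_cell \<D> K = K" using mesh K(1) by (simp add: is_mesh_def)
      with K(2) obtain y where "y \<in> ref_cell \<D> K" "ref_map \<D> K y = x" by (metis imageE)
      with elim K show ?case by blast
    qed
    with zero v show "z = 0" by simp
  qed
qed

lemma mesh_size_pos:
  assumes "is_mesh \<Omega> \<D>" "shape_regular \<sigma> \<D>" "\<Omega> \<noteq> {}"
  shows "mesh_size \<D> > 0"
proof -
  have fin: "finite (cells \<D>)" using assms(1) by (simp add: is_mesh_def)
  have "\<Union> (cells \<D>) \<noteq> {}" using assms(1,3) closure_subset by (auto simp: is_mesh_def)
  then obtain K where K: "K \<in> cells \<D>" by blast
  obtain c \<rho> where c: "0 < \<rho>" "cball c \<rho> \<subseteq> K"
    using assms(2) K unfolding shape_regular_def by blast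
  have "compact K"
  proof -
    have "compact (ref_cell \<D> K)" "continuous_on (ref_cell \<D> K) (ref_map \<D> K)" "ref_map \<D> K ` ref_cell \<D> K = K"
      using assms(1) K by (auto simp: is_mesh_def intro: polytope_imp_compact)
    then show ?thesis using compact_continuous_image by fastforce
  qed
  then have "diameter (cball c \<rho>) \<le> diameter K"
    using c by (intro diameter_subset compact_imp_bounded)
  with c have "0 < diameter K" by simp
  also have "diameter K \<le> mesh_size \<D>"
    unfolding mesh_size_def using fin K by (intro Max_ge) auto
  finally show ?thesis .
qed

context bounded_open_set
begin

lemma Q_space_L2: "q \<in> Q_space \<Omega> \<Longrightarrow> q \<in> L2 \<Omega>"
  by (simp add: Q_space_def)

lemma Q_space_combination:
  assumes "q \<in> Q_space \<Omega>" "s \<in> Q_space \<Omega>"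
  shows "(\<lambda>x. a * q x + b * s x) \<in> Q_space \<Omega>"
proof -
  have "integrable (lebesgue_on \<Omega>) q" "integrable (lebesgue_on \<Omega>) s"
    using assms by (auto intro: L2_integrable[OF Q_space_L2 bounded_\<Omega> sets_\<Omega>])
  moreover have "(\<lambda>x. a *\<^sub>R q x + b *\<^sub>R s x) \<in> L2 \<Omega>"
    using assms by (intro L2_add L2_scaleR Q_space_L2)
  ultimately show ?thesis
    using assms by (simp add: Q_space_def)
qed

lemma local_combination:
  assumes "mapped_polynomial_space l K0 F L" "g \<in> L" "h \<in> L"
    and "AE x in lebesgue_on \<Omega>. x \<in> K \<longrightarrow> v x = g x" "AE x in lebesgue_on \<Omega>. x \<in> K \<longrightarrow> w x = h x"
  shows "\<exists>k\<in>L. AE x in lebesgue_on \<Omega>. x \<in> K \<longrightarrow> a *\<^sub>R v x + b *\<^sub>R w x = k x"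
proof
  show "(\<lambda>x. a *\<^sub>R g x + b *\<^sub>R h x) \<in> L"
    using assms(1-3) by (simp add: mapped_polynomial_space_def)
  show "AE x in lebesgue_on \<Omega>. x \<in> K \<longrightarrow> a *\<^sub>R v x + b *\<^sub>R w x = a *\<^sub>R g x + b *\<^sub>R h x"
    using assms(4,5) by eventually_elim auto
qed

lemma V_h_V_space: "v \<in> V_h \<Omega> \<D> \<Longrightarrow> v \<in> V_space \<Omega>"
  by (simp add: V_h_def)

lemma V_h_H1: "v \<in> V_h \<Omega> \<D> \<Longrightarrow> v \<in> H_space \<Omega> 1"
  by (intro V_space_H1 V_h_V_space)

lemma Q_h_L2: "q \<in> Q_h \<Omega> \<D> \<Longrightarrow> q \<in> L2 \<Omega>"
  by (simp add: Q_h_def Q_space_L2)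

lemma V_h_combination:
  assumes "local_spaces l \<D>" "v \<in> V_h \<Omega> \<D>" "w \<in> V_h \<Omega> \<D>"
  shows "(\<lambda>x. a *\<^sub>R v x + b *\<^sub>R w x) \<in> V_h \<Omega> \<D>"
  unfolding V_h_def
proof (intro CollectI conjI ballI)
  show "(\<lambda>x. a *\<^sub>R v x + b *\<^sub>R w x) \<in> V_space \<Omega>"
    using assms by (intro V_space_combination V_h_V_space)
  fix K assume K: "K \<in> cells \<D>"
  then obtain g h where "g \<in> V_loc \<D> K" "AE x in lebesgue_on \<Omega>. x \<in> K \<longrightarrow> v x = g x"
    "h \<in> V_loc \<D> K" "AE x in lebesgue_on \<Omega>. x \<in> K \<longrightarrow> w x = h x"
    using assms(2,3) unfolding V_h_def by blast
  moreover have "mapped_polynomial_space l (ref_cell \<D> K) (ref_map \<D> K) (V_loc \<D> K)"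
    using assms(1) K by (simp add: local_spaces_def)
  ultimately show "\<exists>g\<in>V_loc \<D> K. AE x in lebesgue_on \<Omega>. x \<in> K \<longrightarrow> a *\<^sub>R v x + b *\<^sub>R w x = g x"
    by (intro local_combination)
qed

lemma Q_h_combination:
  assumes "local_spaces l \<D>" "v \<in> Q_h \<Omega> \<D>" "w \<in> Q_h \<Omega> \<D>"
  shows "(\<lambda>x. a *\<^sub>R v x + b *\<^sub>R w x) \<in> Q_h \<Omega> \<D>"
  unfolding Q_h_def
proof (intro CollectI conjI ballI)
  show "(\<lambda>x. a *\<^sub>R v x + b *\<^sub>R w x) \<in> Q_space \<Omega>"
    using assms Q_space_combination[of v w a b] by (simp add: Q_h_def)
  fix K assume K: "K \<in> cells \<D>"
  then obtain g h where "g \<in> Q_loc \<D> K" "AE x in lebesgue_on \<Omega>. x \<in> K \<longrightarrow> v x = g x"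
    "h \<in> Q_loc \<D> K" "AE x in lebesgue_on \<Omega>. x \<in> K \<longrightarrow> w x = h x"
    using assms(2,3) unfolding Q_h_def by blast
  moreover have "mapped_polynomial_space l (ref_cell \<D> K) (ref_map \<D> K) (Q_loc \<D> K)"
    using assms(1) K by (simp add: local_spaces_def)
  ultimately show "\<exists>g\<in>Q_loc \<D> K. AE x in lebesgue_on \<Omega>. x \<in> K \<longrightarrow> a *\<^sub>R v x + b *\<^sub>R w x = g x"
    by (intro local_combination)
qed

lemma cls_combination:
  assumes "v \<in> L2 \<Omega>" "w \<in> L2 \<Omega>"
  shows "cls (\<lambda>x. a *\<^sub>R v x + b *\<^sub>R w x) = a *\<^sub>R cls v + b *\<^sub>R cls w"
  using assms by (simp only: cls_add[OF L2_scaleR L2_scaleR] cls_scaleR)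

lemma zero_V_h: "local_spaces l \<D> \<Longrightarrow> (\<lambda>x. 0) \<in> V_h \<Omega> \<D>"
proof -
  assume loc: "local_spaces l \<D>"
  have "(\<lambda>x. 0 :: real^'d) \<in> V_space \<Omega>"
    using test_function_H1[OF test_functions_zero] closure_subset[of "jet ` test_functions \<Omega>"]
      test_functions_zero by (auto simp: V_space_iff)
  moreover have "(\<lambda>x. 0) \<in> V_loc \<D> K" if "K \<in> cells \<D>" for K
    using loc that by (simp add: local_spaces_def mapped_polynomial_space_def)
  ultimately show ?thesis
    unfolding V_h_def by (auto intro!: bexI[of _ "\<lambda>x. 0"])
qed

lemma zero_Q_h: "local_spaces l \<D> \<Longrightarrow> (\<lambda>x. 0) \<in> Q_h \<Omega> \<D>"
proof -
  assume loc: "local_spaces l \<D>"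
  have "(\<lambda>x. 0) \<in> Q_loc \<D> K" if "K \<in> cells \<D>" for K
    using loc that by (simp add: local_spaces_def mapped_polynomial_space_def)
  then show ?thesis
    unfolding Q_h_def Q_space_def by (auto simp: L2_zero intro!: bexI[of _ "\<lambda>x. 0"])
qed

lemma subspace_jet_V_h:
  assumes "local_spaces l \<D>"
  shows "subspace (jet ` V_h \<Omega> \<D>)"
proof -
  have *: "a *\<^sub>R x + b *\<^sub>R y \<in> jet ` V_h \<Omega> \<D>" if xy: "x \<in> jet ` V_h \<Omega> \<D>" "y \<in> jet ` V_h \<Omega> \<D>" for a b x y
  proof -
    obtain v w where "v \<in> V_h \<Omega> \<D>" "x = jet v" "w \<in> V_h \<Omega> \<D>" "y = jet w" using xy by blast
    then show ?thesis
      using V_h_combination[OF assms, of v w a b] jet_combination[OF V_h_H1 V_h_H1, of v \<D> w \<D> a b] by force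
  qed
  obtain x where x: "x \<in> jet ` V_h \<Omega> \<D>" using zero_V_h[OF assms] by blast
  show ?thesis
    unfolding subspace_def using *[OF x x, of 0 0] *[of _ _ 1 1] *[OF _ x, of _ _ 0] by simp
qed

lemma subspace_cls_Q_h:
  assumes "local_spaces l \<D>"
  shows "subspace (cls ` Q_h \<Omega> \<D>)"
proof -
  have *: "a *\<^sub>R x + b *\<^sub>R y \<in> cls ` Q_h \<Omega> \<D>" if xy: "x \<in> cls ` Q_h \<Omega> \<D>" "y \<in> cls ` Q_h \<Omega> \<D>" for a b x y
  proof -
    obtain v w where "v \<in> Q_h \<Omega> \<D>" "x = cls v" "w \<in> Q_h \<Omega> \<D>" "y = cls w" using xy by blast
    then show ?thesis
      using Q_h_combination[OF assms, of v w a b] cls_combination[OF Q_h_L2 Q_h_L2, of v \<D> w \<D> a b] by force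
  qed
  obtain x where x: "x \<in> cls ` Q_h \<Omega> \<D>" using zero_Q_h[OF assms] by blast
  show ?thesis
    unfolding subspace_def using *[OF x x, of 0 0] *[of _ _ 1 1] *[OF _ x, of _ _ 0] by simp
qed

lemma jet_zero: "jet (\<lambda>x. 0) = 0"
  using jet_combination[OF test_function_H1 test_function_H1, OF test_functions_zero test_functions_zero, of 0 0]
  by simp

text \<open>
  The inf-sup condition in the form of the locale \<open>mixed_method\<close>. The factor 1/2 accounts for the
  sum of the norms of \<open>v\<close> and \<open>\<nabla>v\<close>, which is at most \<open>2 \<parallel>v\<parallel>\<^sub>1\<close>.
\<close>

lemma inf_sup_bound:
  assumes loc: "local_spaces l \<D>" and isc: "inf_sup_condition \<beta> \<Omega> \<D>" and q: "q \<in> Q_h \<Omega> \<D>" and M: "M \<ge> 0"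
    and le: "\<And>v. v \<in> V_h \<Omega> \<D> \<Longrightarrow> dv v \<bullet> cls q \<le> M * (norm (cls v) + norm (grad v))"
  shows "\<beta> / 2 * norm (cls q) \<le> M"
proof (cases "L2_norm \<Omega> q = 0")
  case True
  then show ?thesis using M by (simp add: norm_cls[OF Q_h_L2[OF q]])
next
  case False
  have nq: "norm (cls q) = L2_norm \<Omega> q" by (rule norm_cls[OF Q_h_L2[OF q]])
  then have nq_pos: "L2_norm \<Omega> q > 0" using False norm_ge_zero[of "cls q"] by linarith
  have bound: "- L2_inner \<Omega> (divergence \<Omega> v) q / (H_norm \<Omega> 1 v * L2_norm \<Omega> q) \<le> 2 * M / L2_norm \<Omega> q"
    if v: "v \<in> V_h \<Omega> \<D>" "L2_norm \<Omega> v \<noteq> 0" for v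
  proof -
    note v1 = V_h_H1[OF v(1)]
    have nv: "(\<lambda>x. (-1) *\<^sub>R v x + 0 *\<^sub>R v x) \<in> V_h \<Omega> \<D>"
      by (rule V_h_combination[OF loc v(1) v(1)])
    have "jet (\<lambda>x. (-1) *\<^sub>R v x + 0 *\<^sub>R v x) = - jet v"
      unfolding jet_combination[OF v1 v1] by simp
    then have "- (dv v \<bullet> cls q) \<le> M * (norm (cls v) + norm (grad v))"
      using le[OF nv] by (simp add: jet_def)
    also have "\<dots> \<le> M * (2 * H_norm \<Omega> 1 v)"
      using norm_cls_le_H_norm[OF v1] M by (intro mult_left_mono) auto
    finally have b: "- L2_inner \<Omega> (divergence \<Omega> v) q \<le> 2 * M * H_norm \<Omega> 1 v"
      by (simp add: inner_cls[OF divergence_L2[OF v1] Q_h_L2[OF q]])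
    have "0 < H_norm \<Omega> 1 v"
      using v(2) norm_cls_le_H_norm(1)[OF v1] norm_cls[OF H_space_L2[OF v1]] norm_ge_zero[of "cls v"] by linarith
    moreover have "c / (H * Q) \<le> 2 * M / Q" if "c \<le> 2 * M * H" "H > 0" "Q > 0" for c H Q :: real
    proof -
      have "c / H \<le> 2 * M" using that by (subst pos_divide_le_eq) auto
      then have "c / H / Q \<le> 2 * M / Q" using that by (intro divide_right_mono) auto
      then show ?thesis by simp
    qed
    ultimately show ?thesis
      using b nq_pos by blast
  qed
  have "ereal \<beta> \<le> (SUP v \<in> {v \<in> V_h \<Omega> \<D>. L2_norm \<Omega> v \<noteq> 0}.
      ereal (- L2_inner \<Omega> (divergence \<Omega> v) q / (H_norm \<Omega> 1 v * L2_norm \<Omega> q)))"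
  proof (rule order_trans[OF isc[unfolded inf_sup_condition_def]])
    show "(INF q \<in> {q \<in> Q_h \<Omega> \<D>. L2_norm \<Omega> q \<noteq> 0}.
        SUP v \<in> {v \<in> V_h \<Omega> \<D>. L2_norm \<Omega> v \<noteq> 0}.
          ereal (- L2_inner \<Omega> (divergence \<Omega> v) q / (H_norm \<Omega> 1 v * L2_norm \<Omega> q))) \<le>
        (SUP v \<in> {v \<in> V_h \<Omega> \<D>. L2_norm \<Omega> v \<noteq> 0}.
          ereal (- L2_inner \<Omega> (divergence \<Omega> v) q / (H_norm \<Omega> 1 v * L2_norm \<Omega> q)))"
      by (rule INF_lower) (use q False in blast)
  qed
  also have "\<dots> \<le> ereal (2 * M / L2_norm \<Omega> q)"
    using bound by (intro SUP_least) auto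
  finally have "\<beta> \<le> 2 * M / L2_norm \<Omega> q" by simp
  then have "\<beta> * L2_norm \<Omega> q \<le> 2 * M"
    using nq_pos by (simp only: pos_le_divide_eq)
  then show ?thesis
    unfolding nq by simp
qed

lemma mixed_method_finite_elements:
  assumes mesh: "is_mesh \<Omega> \<D>" and loc: "local_spaces l \<D>" and isc: "inf_sup_condition \<beta> \<Omega> \<D>" and \<beta>: "\<beta> > 0"
    and P: "P \<ge> 0" "\<And>v. v \<in> V_space \<Omega> \<Longrightarrow> norm (cls v) \<le> P * norm (grad v)"
  shows "mixed_method (jet ` V_h \<Omega> \<D>) (cls ` Q_h \<Omega> \<D>) (\<beta> / 2) P (real CARD('d))"
proof
  show "subspace (jet ` V_h \<Omega> \<D>)" "subspace (cls ` Q_h \<Omega> \<D>)"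
    using loc by (rule subspace_jet_V_h, rule subspace_cls_Q_h)
  show "\<exists>B. finite B \<and> B \<subseteq> jet ` V_h \<Omega> \<D> \<and> jet ` V_h \<Omega> \<D> \<subseteq> span B"
  proof (rule piecewise_polynomials_finite_dimensional[OF mesh])
    show "mapped_polynomial_space l (ref_cell \<D> K) (ref_map \<D> K) (V_loc \<D> K)" if "K \<in> cells \<D>" for K
      using loc that by (simp add: local_spaces_def)
    show "\<exists>g\<in>V_loc \<D> K. AE x in lebesgue_on \<Omega>. x \<in> K \<longrightarrow> v x = g x" if "v \<in> V_h \<Omega> \<D>" "K \<in> cells \<D>" for v K
      using that by (simp add: V_h_def)
    show "(\<lambda>x. v x + a *\<^sub>R w x) \<in> V_h \<Omega> \<D> \<and> jet (\<lambda>x. v x + a *\<^sub>R w x) = jet v + a *\<^sub>R jet w"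
      if "v \<in> V_h \<Omega> \<D>" "w \<in> V_h \<Omega> \<D>" for v w a
      using V_h_combination[OF loc that, of 1 a] jet_combination[OF V_h_H1[OF that(1)] V_h_H1[OF that(2)], of 1 a] by simp
    show "subspace (jet ` V_h \<Omega> \<D>)" by (rule subspace_jet_V_h[OF loc])
    show "jet v = 0" if "v \<in> V_h \<Omega> \<D>" "AE x in lebesgue_on \<Omega>. v x = 0" for v
      using jet_AE_cong[OF V_h_H1[OF that(1)] that(2)] jet_zero by simp
  qed
  show "\<exists>B. finite B \<and> B \<subseteq> cls ` Q_h \<Omega> \<D> \<and> cls ` Q_h \<Omega> \<D> \<subseteq> span B"
  proof (rule piecewise_polynomials_finite_dimensional[OF mesh])
    show "mapped_polynomial_space l (ref_cell \<D> K) (ref_map \<D> K) (Q_loc \<D> K)" if "K \<in> cells \<D>" for K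
      using loc that by (simp add: local_spaces_def)
    show "\<exists>g\<in>Q_loc \<D> K. AE x in lebesgue_on \<Omega>. x \<in> K \<longrightarrow> v x = g x" if "v \<in> Q_h \<Omega> \<D>" "K \<in> cells \<D>" for v K
      using that by (simp add: Q_h_def)
    show "(\<lambda>x. v x + a *\<^sub>R w x) \<in> Q_h \<Omega> \<D> \<and> cls (\<lambda>x. v x + a *\<^sub>R w x) = cls v + a *\<^sub>R cls w"
      if "v \<in> Q_h \<Omega> \<D>" "w \<in> Q_h \<Omega> \<D>" for v w a
      using Q_h_combination[OF loc that, of 1 a] cls_combination[OF Q_h_L2[OF that(1)] Q_h_L2[OF that(2)], of 1 a] by simp
    show "subspace (cls ` Q_h \<Omega> \<D>)" by (rule subspace_cls_Q_h[OF loc])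
    show "cls v = 0" if "v \<in> Q_h \<Omega> \<D>" "AE x in lebesgue_on \<Omega>. v x = 0" for v
      using cls_eq_iff[OF Q_h_L2[OF that(1)] L2_zero] that(2) l2_class_zero by metis
  qed
  show "\<beta> / 2 > 0" "P \<ge> 0" "real CARD('d) \<ge> 0" using \<beta> P by auto
  show "norm (fst x) \<le> P * norm (fst (snd x))" "norm (snd (snd x)) \<le> real CARD('d) * norm (fst (snd x))"
    if "x \<in> jet ` V_h \<Omega> \<D>" for x
    using that P(2)[OF V_h_V_space] norm_dv_le[OF V_h_H1] by (auto simp: jet_def)
  show "\<beta> / 2 * norm q \<le> M" if q: "q \<in> cls ` Q_h \<Omega> \<D>" and "M \<ge> 0"
    and le: "\<And>x. x \<in> jet ` V_h \<Omega> \<D> \<Longrightarrow> snd (snd x) \<bullet> q \<le> M * (norm (fst x) + norm (fst (snd x)))" for q M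
  proof -
    obtain q' where q': "q' \<in> Q_h \<Omega> \<D>" "q = cls q'" using q by blast
    show ?thesis
      unfolding q'(2)
      by (rule inf_sup_bound[OF loc isc q'(1) \<open>M \<ge> 0\<close>]) (use le q' in \<open>force simp: jet_def\<close>)
  qed
qed

text \<open>
  The defining equations are solvable, so the choice operator yields a solution.
\<close>

lemma Stokes_projection_spec:
  assumes mm: "mixed_method (jet ` V_h \<Omega> \<D>) (cls ` Q_h \<Omega> \<D>) \<beta> P K"
    and w: "w \<in> V_space \<Omega>" and s: "s \<in> Q_space \<Omega>"
  obtains "fst (Stokes_projection \<Omega> \<D> w s) \<in> V_h \<Omega> \<D>"
    "mixed_method.Stokes_proj (jet ` V_h \<Omega> \<D>) (cls ` Q_h \<Omega> \<D>) (jet w) (cls s)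
      (jet (fst (Stokes_projection \<Omega> \<D> w s))) (cls (snd (Stokes_projection \<Omega> \<D> w s)))"
proof -
  interpret mixed_method "jet ` V_h \<Omega> \<D>" "cls ` Q_h \<Omega> \<D>" \<beta> P K by (rule mm)
  let ?P = "\<lambda>w\<^sub>h s\<^sub>h. w\<^sub>h \<in> V_h \<Omega> \<D> \<and> s\<^sub>h \<in> Q_h \<Omega> \<D> \<and>
     (\<forall>v\<in>V_h \<Omega> \<D>. a_form \<Omega> w\<^sub>h v + b_form \<Omega> v s\<^sub>h = a_form \<Omega> w v + b_form \<Omega> v s) \<and>
     (\<forall>q\<in>Q_h \<Omega> \<D>. b_form \<Omega> w\<^sub>h q = 0)"
  have a: "a_form \<Omega> y v = grad y \<bullet> grad v" if "y \<in> H_space \<Omega> 1" "v \<in> H_space \<Omega> 1" for y v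
    by (simp add: a_form_def inner_cls[OF Jacobian_L2[OF that(1)] Jacobian_L2[OF that(2)]])
  have b: "b_form \<Omega> v q = - (dv v \<bullet> cls q)" if "v \<in> H_space \<Omega> 1" "q \<in> L2 \<Omega>" for v q
    by (simp add: b_form_def inner_cls[OF divergence_L2[OF that(1)] that(2)])
  have iff: "Stokes_proj (jet w) (cls s) (jet w\<^sub>h) (cls s\<^sub>h) \<longleftrightarrow> ?P w\<^sub>h s\<^sub>h"
    if "w\<^sub>h \<in> V_h \<Omega> \<D>" "s\<^sub>h \<in> Q_h \<Omega> \<D>" for w\<^sub>h s\<^sub>h
    using that V_space_H1[OF w] Q_space_L2[OF s] V_h_H1 Q_h_L2
    unfolding Stokes_proj_def by (simp add: a b) (simp add: jet_def)
  obtain x q where xq: "Stokes_proj (jet w) (cls s) x q" using Stokes_proj_exists by blast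
  then obtain w\<^sub>h s\<^sub>h where "w\<^sub>h \<in> V_h \<Omega> \<D>" "s\<^sub>h \<in> Q_h \<Omega> \<D>" "x = jet w\<^sub>h" "q = cls s\<^sub>h"
    by (auto simp: Stokes_proj_def)
  with xq iff have "?P w\<^sub>h s\<^sub>h" by blast
  then have "case (w\<^sub>h, s\<^sub>h) of (w\<^sub>h, s\<^sub>h) \<Rightarrow> ?P w\<^sub>h s\<^sub>h" by simp
  then have "case Stokes_projection \<Omega> \<D> w s of (w\<^sub>h, s\<^sub>h) \<Rightarrow> ?P w\<^sub>h s\<^sub>h"
    unfolding Stokes_projection_def by (rule someI)
  then have P: "?P (fst (Stokes_projection \<Omega> \<D> w s)) (snd (Stokes_projection \<Omega> \<D> w s))"
    unfolding case_prod_beta .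
  show ?thesis
    by (rule that) (use P iff[of "fst (Stokes_projection \<Omega> \<D> w s)" "snd (Stokes_projection \<Omega> \<D> w s)"] in blast)+
qed

text \<open>
  One power of \<open>h\<close> in the approximation property for the velocity is spent on the gradient.
\<close>

lemma Stokes_projection_error:
  assumes mm: "mixed_method (jet ` V_h \<Omega> \<D>) (cls ` Q_h \<Omega> \<D>) \<beta> P K" and KP: "K = real CARD('d)"
    "\<And>v. v \<in> V_space \<Omega> \<Longrightarrow> norm (cls v) \<le> P * norm (grad v)"
    and app: "approximation_property C r \<Omega> \<D>" and h: "mesh_size \<D> > 0"
    and w: "w \<in> V_div \<Omega>" "w \<in> H_space \<Omega> (r + 1)" "H_norm \<Omega> (r + 1) w \<le> M"
    and s: "s \<in> Q_space \<Omega>" "s \<in> H_space \<Omega> r" "H_norm \<Omega> r s \<le> M"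
    and proj: "mixed_method.Stokes_proj (jet ` V_h \<Omega> \<D>) (cls ` Q_h \<Omega> \<D>) (jet w) (cls s) x q"
  shows "norm (cls w - fst x) \<le> P * (1 + mixed_method.stab \<beta> K) * (2 * \<bar>C\<bar> * M) * mesh_size \<D> ^ r"
    and "norm (cls s - q) \<le> (1 + (mixed_method.stab \<beta> K + 1 + K) / \<beta>) * (2 * \<bar>C\<bar> * M) * mesh_size \<D> ^ r"
proof -
  interpret mixed_method "jet ` V_h \<Omega> \<D>" "cls ` Q_h \<Omega> \<D>" \<beta> P K by (rule mm)
  have wV: "w \<in> V_space \<Omega>" using w(1) by (simp add: V_div_def)
  obtain y where y: "y \<in> V_h \<Omega> \<D>" "L2_norm \<Omega> (\<lambda>x. w x - y x) + mesh_size \<D> * L2_norm \<Omega> (Jacobian \<Omega> (\<lambda>x. w x - y x))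
      \<le> C * mesh_size \<D> ^ (r + 1) * H_norm \<Omega> (r + 1) w"
    using app w(2) wV unfolding approximation_property_def by blast
  obtain \<psi> where \<psi>: "\<psi> \<in> Q_h \<Omega> \<D>" "L2_norm \<Omega> (\<lambda>x. s x - \<psi> x) \<le> C * mesh_size \<D> ^ r * H_norm \<Omega> r s"
    using app s unfolding approximation_property_def by blast
  have wy: "(\<lambda>x. w x - y x) \<in> V_space \<Omega>"
    by (rule V_space_diff[OF wV V_h_V_space[OF y(1)]])
  have jet_wy: "jet (\<lambda>x. w x - y x) = jet w - jet y"
    by (rule jet_diff[OF V_space_H1[OF wV] V_h_H1[OF y(1)]])
  have CM: "C * m \<le> \<bar>C\<bar> * M" if "0 \<le> m" "m \<le> M" for m
    using mult_right_mono[of C "\<bar>C\<bar>" m] mult_left_mono[of m M "\<bar>C\<bar>"] that by linarith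
  have \<delta>: "norm (grad (\<lambda>x. w x - y x)) \<le> \<bar>C\<bar> * M * mesh_size \<D> ^ r"
  proof -
    have "0 \<le> L2_norm \<Omega> (\<lambda>x. w x - y x)"
      using norm_cls[OF H_space_L2[OF V_space_H1[OF wy]]] norm_ge_zero[of "cls (\<lambda>x. w x - y x)"] by simp
    then have "mesh_size \<D> * norm (grad (\<lambda>x. w x - y x)) \<le> C * mesh_size \<D> ^ (r + 1) * H_norm \<Omega> (r + 1) w"
      using y(2) norm_cls[OF Jacobian_L2[OF V_space_H1[OF wy]]] by simp
    also have "\<dots> = mesh_size \<D> * (mesh_size \<D> ^ r * (C * H_norm \<Omega> (r + 1) w))"
      by (simp add: power_add)
    finally have "norm (grad (\<lambda>x. w x - y x)) \<le> mesh_size \<D> ^ r * (C * H_norm \<Omega> (r + 1) w)"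
      using h by (simp only: mult_le_cancel_left_pos)
    also have "\<dots> \<le> mesh_size \<D> ^ r * (\<bar>C\<bar> * M)"
      using h by (intro mult_left_mono CM H_norm_nonneg w) auto
    finally show ?thesis by (simp add: mult.commute)
  qed
  have \<epsilon>: "norm (cls s - cls \<psi>) \<le> \<bar>C\<bar> * M * mesh_size \<D> ^ r"
  proof -
    have "norm (cls s - cls \<psi>) = L2_norm \<Omega> (\<lambda>x. s x - \<psi> x)"
      using norm_cls[OF L2_diff[OF Q_space_L2[OF s(1)] Q_h_L2[OF \<psi>(1)]]]
      by (simp add: cls_diff[OF Q_space_L2[OF s(1)] Q_h_L2[OF \<psi>(1)]])
    also have "\<dots> \<le> mesh_size \<D> ^ r * (C * H_norm \<Omega> r s)"
      using \<psi>(2) by (simp add: mult.commute mult.left_commute)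
    also have "\<dots> \<le> mesh_size \<D> ^ r * (\<bar>C\<bar> * M)"
      using h by (intro mult_left_mono CM H_norm_nonneg s) auto
    finally show ?thesis by (simp add: mult.commute)
  qed
  have w_div: "snd (snd (jet w)) \<bullet> p = 0" if p: "p \<in> cls ` Q_h \<Omega> \<D>" for p
  proof -
    obtain p' where p': "p' \<in> Q_h \<Omega> \<D>" "p = cls p'" using p by blast
    then have "L2_inner \<Omega> (divergence \<Omega> w) p' = 0"
      using w(1) by (simp add: V_div_def Q_h_def)
    then show ?thesis
      by (simp add: jet_def p'(2) inner_cls[OF divergence_L2[OF V_space_H1[OF wV]] Q_h_L2[OF p'(1)]])
  qed
  have c1: "norm (fst (jet w - jet y)) \<le> P * norm (fst (snd (jet w - jet y)))"
    "norm (snd (snd (jet w - jet y))) \<le> K * norm (fst (snd (jet w - jet y)))"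
    unfolding jet_wy[symmetric] using KP(2)[OF wy] norm_dv_le[OF V_space_H1[OF wy]] by (simp_all add: jet_def KP(1))
  have c2: "norm (fst (snd (jet w - jet y))) \<le> \<bar>C\<bar> * M * mesh_size \<D> ^ r"
    unfolding jet_wy[symmetric] using \<delta> by (simp add: jet_def)
  have sum2: "\<bar>C\<bar> * M * mesh_size \<D> ^ r + \<bar>C\<bar> * M * mesh_size \<D> ^ r = (2 * \<bar>C\<bar> * M) * mesh_size \<D> ^ r"
    by simp
  note err = Stokes_proj_error[OF proj imageI[OF y(1)] imageI[OF \<psi>(1)] w_div c1 c2 \<epsilon>, unfolded sum2]
  have wx: "fst (jet w - x) = cls w - fst x" by (simp add: jet_def)
  show "norm (cls w - fst x) \<le> P * (1 + stab) * (2 * \<bar>C\<bar> * M) * mesh_size \<D> ^ r"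
    using err(1) unfolding wx by (simp only: mult.assoc)
  show "norm (cls s - q) \<le> (1 + (stab + 1 + K) / \<beta>) * (2 * \<bar>C\<bar> * M) * mesh_size \<D> ^ r"
    using err(2) by (simp only: mult.assoc)
qed

end

section \<open>The discrete scheme as a Crank--Nicolson method\<close>

lemma integral_affine_Ioc:
  fixes \<alpha> \<gamma> a b :: real
  assumes "a \<le> b"
  shows "(LINT s:{a<..b}|lborel. \<alpha> + s * \<gamma>) = (b - a) * (\<alpha> + (a + b) / 2 * \<gamma>)"
proof -
  have "(LINT s:{a<..b}|lborel. \<alpha> + s * \<gamma>) = (LINT s|lborel. indicator {a..b} s *\<^sub>R (\<alpha> + s * \<gamma>))"
    unfolding set_lebesgue_integral_def
  proof (rule integral_cong_AE)
    show "AE s in lborel. indicat_real {a<..b} s *\<^sub>R (\<alpha> + s * \<gamma>) = indicat_real {a..b} s *\<^sub>R (\<alpha> + s * \<gamma>)"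
      using AE_lborel_singleton[of a] by eventually_elim (auto simp: indicator_def)
  qed auto
  also have "\<dots> = (\<alpha> * b + b\<^sup>2 / 2 * \<gamma>) - (\<alpha> * a + a\<^sup>2 / 2 * \<gamma>)"
    by (rule integral_FTC_atLeastAtMost[OF assms])
       (auto intro!: derivative_eq_intros continuous_intros simp: has_real_derivative_iff_has_vector_derivative[symmetric])
  also have "\<dots> = (b - a) * (\<alpha> + (a + b) / 2 * \<gamma>)"
    by (simp add: field_simps power2_eq_square)
  finally show ?thesis .
qed

lemma poly_in_time_1E:
  assumes "poly_in_time \<Omega> 1 J X w"
  obtains c0 c1 where "c0 \<in> X" "c1 \<in> X" "\<And>s. s \<in> J \<Longrightarrow> AE x in lebesgue_on \<Omega>. w s x = c0 x + s *\<^sub>R c1 x"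
proof -
  obtain c where c: "\<forall>j\<le>1. c j \<in> X" "\<forall>s\<in>J. AE x in lebesgue_on \<Omega>. w s x = (\<Sum>j\<le>1. s ^ j *\<^sub>R c j x)"
    using assms unfolding poly_in_time_def by blast
  have "(\<Sum>j\<le>1. s ^ j *\<^sub>R c j x) = c 0 x + s *\<^sub>R c 1 x" for s x
    by (simp add: atMost_Suc)
  with c show ?thesis by (intro that[of "c 0" "c 1"]) auto
qed

context bounded_open_set
begin

lemma L2_norm_AE:
  assumes "g \<in> L2 \<Omega>" "AE x in lebesgue_on \<Omega>. g x = f x"
  shows "L2_norm \<Omega> f = norm (cls g)"
proof -
  have f: "f \<in> L2 \<Omega>" by (rule L2_AE_closed[OF sets_\<Omega> assms])
  then have "cls g = cls f" using assms by (simp add: cls_eq_iff)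
  with f show ?thesis by (simp add: norm_cls)
qed

text \<open>
  The integrands are affine in time, so their mean values are their values at the midpoint.
\<close>

lemma scheme_step:
  assumes ab: "a < b" and loc: "local_spaces l \<D>"
    and c: "c0 \<in> V_h \<Omega> \<D>" "c1 \<in> V_h \<Omega> \<D>" "\<And>s. s \<in> {a<..b} \<Longrightarrow> AE x in lebesgue_on \<Omega>. w s x = c0 x + s *\<^sub>R c1 x"
    and d: "d0 \<in> Q_h \<Omega> \<D>" "d1 \<in> Q_h \<Omega> \<D>" "\<And>s. s \<in> {a<..b} \<Longrightarrow> AE x in lebesgue_on \<Omega>. q s x = d0 x + s *\<^sub>R d1 x"
  shows "v \<in> V_h \<Omega> \<D> \<Longrightarrow>
      (LINT s:{a<..b}|lborel. L2_inner \<Omega> (time_deriv \<Omega> {a<..b} w s) v + a_form \<Omega> (w s) v + b_form \<Omega> v (q s)) =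
      (b - a) * (cls c1 \<bullet> cls v + (grad c0 + ((a + b) / 2) *\<^sub>R grad c1) \<bullet> grad v - dv v \<bullet> (cls d0 + ((a + b) / 2) *\<^sub>R cls d1))"
    and "p \<in> Q_h \<Omega> \<D> \<Longrightarrow>
      (LINT s:{a<..b}|lborel. b_form \<Omega> (w s) p) = - (b - a) * ((dv c0 + ((a + b) / 2) *\<^sub>R dv c1) \<bullet> cls p)"
proof -
  have c2: "c0 \<in> L2 \<Omega>" "c1 \<in> L2 \<Omega>" and c1: "c0 \<in> H_space \<Omega> 1" "c1 \<in> H_space \<Omega> 1"
    using V_h_H1[OF c(1)] V_h_H1[OF c(2)] by (auto intro: H_space_L2)
  have d2: "d0 \<in> L2 \<Omega>" "d1 \<in> L2 \<Omega>" using d Q_h_L2 by auto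
  have cs: "(\<lambda>x. c0 x + s *\<^sub>R c1 x) \<in> H_space \<Omega> 1" and jet_cs: "jet (\<lambda>x. c0 x + s *\<^sub>R c1 x) = jet c0 + s *\<^sub>R jet c1" for s
    using H_space_combination[OF c1, of 1 s] jet_combination[OF c1, of 1 s] by auto
  have ds: "cls (\<lambda>x. d0 x + s *\<^sub>R d1 x) = cls d0 + s *\<^sub>R cls d1" "(\<lambda>x. d0 x + s *\<^sub>R d1 x) \<in> L2 \<Omega>" for s
    using cls_combination[OF d2, of 1 s] L2_add[OF d2(1) L2_scaleR[OF d2(2), of s]] by auto
  have ws: "w s \<in> H_space \<Omega> 1" "jet (w s) = jet c0 + s *\<^sub>R jet c1" if s: "s \<in> {a<..b}" for s
  proof -
    have ae: "AE x in lebesgue_on \<Omega>. c0 x + s *\<^sub>R c1 x = w s x"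
      using c(3)[OF s] by eventually_elim simp
    show "w s \<in> H_space \<Omega> 1" "jet (w s) = jet c0 + s *\<^sub>R jet c1"
      using H_space_AE_closed[OF cs ae] jet_AE_cong[OF cs ae] jet_cs by auto
  qed
  have qs: "q s \<in> L2 \<Omega>" "cls (q s) = cls d0 + s *\<^sub>R cls d1" if s: "s \<in> {a<..b}" for s
  proof -
    have ae: "AE x in lebesgue_on \<Omega>. d0 x + s *\<^sub>R d1 x = q s x"
      using d(3)[OF s] by eventually_elim simp
    show q2: "q s \<in> L2 \<Omega>" by (rule L2_AE_closed[OF sets_\<Omega> ds(2) ae])
    show "cls (q s) = cls d0 + s *\<^sub>R cls d1"
      using cls_eq_iff[OF ds(2) q2] ae ds(1) by metis
  qed
  have td: "time_deriv \<Omega> {a<..b} w s \<in> L2 \<Omega>" "cls (time_deriv \<Omega> {a<..b} w s) = cls c1" if s: "s \<in> {a<..b}" for s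
  proof -
    have "((\<lambda>s. cls c0 + s *\<^sub>R cls c1) has_vector_derivative cls c1) (at s within {a<..b})"
      by (auto intro!: derivative_eq_intros)
    then have "((\<lambda>s. cls (w s)) has_vector_derivative cls c1) (at s within {a<..b})"
      by (rule has_vector_derivative_transform[OF s, rotated]) (use ws(2) in \<open>simp add: jet_def\<close>)
    moreover have "at s within {a<..b} \<noteq> bot"
      using s ab by (simp add: trivial_limit_within)
    ultimately have "time_deriv \<Omega> {a<..b} w s \<in> L2 \<Omega>" "AE x in lebesgue_on \<Omega>. time_deriv \<Omega> {a<..b} w s x = c1 x"
      using time_deriv_AE_eqI[of "{a<..b}" w c1 s, OF H_space_L2[OF ws(1)] c2(2) s] by blast+
    then show "time_deriv \<Omega> {a<..b} w s \<in> L2 \<Omega>" "cls (time_deriv \<Omega> {a<..b} w s) = cls c1"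
      using c2(2) by (auto simp: cls_eq_iff)
  qed
  show "(LINT s:{a<..b}|lborel. L2_inner \<Omega> (time_deriv \<Omega> {a<..b} w s) v + a_form \<Omega> (w s) v + b_form \<Omega> v (q s)) =
      (b - a) * (cls c1 \<bullet> cls v + (grad c0 + ((a + b) / 2) *\<^sub>R grad c1) \<bullet> grad v - dv v \<bullet> (cls d0 + ((a + b) / 2) *\<^sub>R cls d1))"
    if v: "v \<in> V_h \<Omega> \<D>"
  proof -
    note v1 = V_h_H1[OF v]
    let ?\<alpha> = "cls c1 \<bullet> cls v + grad c0 \<bullet> grad v - dv v \<bullet> cls d0"
    let ?\<gamma> = "grad c1 \<bullet> grad v - dv v \<bullet> cls d1"
    have "(LINT s:{a<..b}|lborel. L2_inner \<Omega> (time_deriv \<Omega> {a<..b} w s) v + a_form \<Omega> (w s) v + b_form \<Omega> v (q s)) =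
        (LINT s:{a<..b}|lborel. ?\<alpha> + s * ?\<gamma>)"
    proof (rule set_lebesgue_integral_cong)
      show "\<forall>s. s \<in> {a<..b} \<longrightarrow> L2_inner \<Omega> (time_deriv \<Omega> {a<..b} w s) v + a_form \<Omega> (w s) v + b_form \<Omega> v (q s) = ?\<alpha> + s * ?\<gamma>"
      proof (intro allI impI)
        fix s assume s: "s \<in> {a<..b}"
        have "L2_inner \<Omega> (time_deriv \<Omega> {a<..b} w s) v = cls c1 \<bullet> cls v"
          using inner_cls[OF td(1)[OF s] H_space_L2[OF v1]] td(2)[OF s] by simp
        moreover have "a_form \<Omega> (w s) v = (grad c0 + s *\<^sub>R grad c1) \<bullet> grad v"
          using inner_cls[OF Jacobian_L2[OF ws(1)[OF s]] Jacobian_L2[OF v1]] ws(2)[OF s] by (simp add: a_form_def jet_def)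
        moreover have "b_form \<Omega> v (q s) = - (dv v \<bullet> (cls d0 + s *\<^sub>R cls d1))"
          using inner_cls[OF divergence_L2[OF v1] qs(1)[OF s]] qs(2)[OF s] by (simp add: b_form_def)
        ultimately show "L2_inner \<Omega> (time_deriv \<Omega> {a<..b} w s) v + a_form \<Omega> (w s) v + b_form \<Omega> v (q s) = ?\<alpha> + s * ?\<gamma>"
          by (simp add: inner_add_left inner_add_right right_diff_distrib)
      qed
    qed simp
    also have "\<dots> = (b - a) * (?\<alpha> + (a + b) / 2 * ?\<gamma>)"
      using ab by (intro integral_affine_Ioc) simp
    also have "?\<alpha> + (a + b) / 2 * ?\<gamma> =
        cls c1 \<bullet> cls v + (grad c0 + ((a + b) / 2) *\<^sub>R grad c1) \<bullet> grad v - dv v \<bullet> (cls d0 + ((a + b) / 2) *\<^sub>R cls d1)"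
      by (simp add: inner_add_left inner_add_right right_diff_distrib)
    finally show ?thesis .
  qed
  show "(LINT s:{a<..b}|lborel. b_form \<Omega> (w s) p) = - (b - a) * ((dv c0 + ((a + b) / 2) *\<^sub>R dv c1) \<bullet> cls p)"
    if p: "p \<in> Q_h \<Omega> \<D>"
  proof -
    let ?\<alpha> = "- (dv c0 \<bullet> cls p)" and ?\<gamma> = "- (dv c1 \<bullet> cls p)"
    have "(LINT s:{a<..b}|lborel. b_form \<Omega> (w s) p) = (LINT s:{a<..b}|lborel. ?\<alpha> + s * ?\<gamma>)"
    proof (rule set_lebesgue_integral_cong)
      show "\<forall>s. s \<in> {a<..b} \<longrightarrow> b_form \<Omega> (w s) p = ?\<alpha> + s * ?\<gamma>"
      proof (intro allI impI)
        fix s assume s: "s \<in> {a<..b}"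
        show "b_form \<Omega> (w s) p = ?\<alpha> + s * ?\<gamma>"
          using inner_cls[OF divergence_L2[OF ws(1)[OF s]] Q_h_L2[OF p]] ws(2)[OF s]
          by (simp add: b_form_def jet_def inner_add_left)
      qed
    qed simp
    also have "\<dots> = (b - a) * (?\<alpha> + (a + b) / 2 * ?\<gamma>)"
      using ab by (intro integral_affine_Ioc) simp
    also have "\<dots> = - (b - a) * ((dv c0 + ((a + b) / 2) *\<^sub>R dv c1) \<bullet> cls p)"
      unfolding inner_add_left inner_scaleR_left by (simp add: field_simps)
    finally show ?thesis .
  qed
qed

text \<open>
  On each time interval a discrete trajectory is affine, so the scheme only sees the nodal values
  \<open>U n\<close> of the velocity and the midpoint values \<open>Pm n\<close> of the pressure.
\<close>

lemma scheme_nodal_values: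
  assumes loc: "local_spaces l \<D>" and tm: "time_mesh T N t" and u0: "u\<^sub>0\<^sub>h \<in> V_h_div \<Omega> \<D>"
    and sol: "scheme_solution \<Omega> \<D> N t f u\<^sub>0\<^sub>h u\<^sub>h p\<^sub>h"
    and f: "\<And>n. n \<le> N \<Longrightarrow> f (t n) \<in> L2 \<Omega>"
  obtains U Pm where
    "\<And>n. n \<le> N \<Longrightarrow> U n \<in> V_h \<Omega> \<D>" "AE x in lebesgue_on \<Omega>. u\<^sub>h 0 x = U 0 x"
    "\<And>n. n \<in> {1..N} \<Longrightarrow> Pm n \<in> Q_h \<Omega> \<D>"
    "\<And>n. n \<in> {1..N} \<Longrightarrow> AE x in lebesgue_on \<Omega>. p\<^sub>h (midpt t n) x = Pm n x"
    "\<And>n q. n \<le> N \<Longrightarrow> q \<in> Q_h \<Omega> \<D> \<Longrightarrow> dv (U n) \<bullet> cls q = 0"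
    "\<And>n v. n \<in> {1..N} \<Longrightarrow> v \<in> V_h \<Omega> \<D> \<Longrightarrow>
      fst ((jet (U n) - jet (U (n - 1))) /\<^sub>R step t n) \<bullet> cls v
      + fst (snd ((jet (U n) + jet (U (n - 1))) /\<^sub>R 2)) \<bullet> grad v - dv v \<bullet> cls (Pm n)
      = ((cls (f (t (n - 1))) + cls (f (t n))) /\<^sub>R 2) \<bullet> cls v"
proof -
  have t_less: "t (n - 1) < t n" if "n \<in> {1..N}" for n
    using tm that unfolding time_mesh_def by (cases n) (auto simp: less_eq_Suc_le)
  let ?I = "\<lambda>n. {t (n - 1)<..t n}"
  have sol': "poly_in_time \<Omega> 1 (?I n) (V_h \<Omega> \<D>) u\<^sub>h" "poly_in_time \<Omega> 1 (?I n) (Q_h \<Omega> \<D>) p\<^sub>h"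
    "has_right_limit \<Omega> u\<^sub>h (t (n - 1)) (u\<^sub>h (t (n - 1)))"
    "\<And>v. v \<in> V_h \<Omega> \<D> \<Longrightarrow>
       (LINT s:?I n|lborel. L2_inner \<Omega> (time_deriv \<Omega> (?I n) u\<^sub>h s) v + a_form \<Omega> (u\<^sub>h s) v + b_form \<Omega> v (p\<^sub>h s))
       = step t n / 2 * L2_inner \<Omega> (\<lambda>x. f (t (n - 1)) x + f (t n) x) v"
    "\<And>q. q \<in> Q_h \<Omega> \<D> \<Longrightarrow> (LINT s:?I n|lborel. b_form \<Omega> (u\<^sub>h s) q) = 0"
    if n: "n \<in> {1..N}" for n
  proof -
    note * = bspec[OF conjunct2[OF sol[unfolded scheme_solution_def Let_def]] n]
    show "poly_in_time \<Omega> 1 (?I n) (V_h \<Omega> \<D>) u\<^sub>h" "poly_in_time \<Omega> 1 (?I n) (Q_h \<Omega> \<D>) p\<^sub>h"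
      "has_right_limit \<Omega> u\<^sub>h (t (n - 1)) (u\<^sub>h (t (n - 1)))"
      using * by blast+
    show "(LINT s:?I n|lborel. L2_inner \<Omega> (time_deriv \<Omega> (?I n) u\<^sub>h s) v + a_form \<Omega> (u\<^sub>h s) v + b_form \<Omega> v (p\<^sub>h s))
       = step t n / 2 * L2_inner \<Omega> (\<lambda>x. f (t (n - 1)) x + f (t n) x) v" if "v \<in> V_h \<Omega> \<D>" for v
      using * that by blast
    show "(LINT s:?I n|lborel. b_form \<Omega> (u\<^sub>h s) q) = 0" if "q \<in> Q_h \<Omega> \<D>" for q
      using * that by blast
  qed
  have "\<forall>n\<in>{1..N}. \<exists>c. fst c \<in> V_h \<Omega> \<D> \<and> snd c \<in> V_h \<Omega> \<D> \<and>
      (\<forall>s\<in>?I n. AE x in lebesgue_on \<Omega>. u\<^sub>h s x = fst c x + s *\<^sub>R snd c x)"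
  proof
    fix n assume "n \<in> {1..N}"
    from poly_in_time_1E[OF sol'(1)[OF this]] obtain c0 c1 where
      "c0 \<in> V_h \<Omega> \<D>" "c1 \<in> V_h \<Omega> \<D>"
      "\<And>s. s \<in> ?I n \<Longrightarrow> AE x in lebesgue_on \<Omega>. u\<^sub>h s x = c0 x + s *\<^sub>R c1 x" by blast
    then show "\<exists>c. fst c \<in> V_h \<Omega> \<D> \<and> snd c \<in> V_h \<Omega> \<D> \<and>
      (\<forall>s\<in>?I n. AE x in lebesgue_on \<Omega>. u\<^sub>h s x = fst c x + s *\<^sub>R snd c x)"
      by (intro exI[of _ "(c0, c1)"]) simp
  qed
  from bchoice[OF this] obtain c where c: "\<And>n. n \<in> {1..N} \<Longrightarrow> fst (c n) \<in> V_h \<Omega> \<D> \<and> snd (c n) \<in> V_h \<Omega> \<D> \<and>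
      (\<forall>s\<in>?I n. AE x in lebesgue_on \<Omega>. u\<^sub>h s x = fst (c n) x + s *\<^sub>R snd (c n) x)"
    by blast
  have "\<forall>n\<in>{1..N}. \<exists>c. fst c \<in> Q_h \<Omega> \<D> \<and> snd c \<in> Q_h \<Omega> \<D> \<and>
      (\<forall>s\<in>?I n. AE x in lebesgue_on \<Omega>. p\<^sub>h s x = fst c x + s *\<^sub>R snd c x)"
  proof
    fix n assume "n \<in> {1..N}"
    from poly_in_time_1E[OF sol'(2)[OF this]] obtain c0 c1 where
      "c0 \<in> Q_h \<Omega> \<D>" "c1 \<in> Q_h \<Omega> \<D>"
      "\<And>s. s \<in> ?I n \<Longrightarrow> AE x in lebesgue_on \<Omega>. p\<^sub>h s x = c0 x + s *\<^sub>R c1 x" by blast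
    then show "\<exists>c. fst c \<in> Q_h \<Omega> \<D> \<and> snd c \<in> Q_h \<Omega> \<D> \<and>
      (\<forall>s\<in>?I n. AE x in lebesgue_on \<Omega>. p\<^sub>h s x = fst c x + s *\<^sub>R snd c x)"
      by (intro exI[of _ "(c0, c1)"]) simp
  qed
  from bchoice[OF this] obtain d where d: "\<And>n. n \<in> {1..N} \<Longrightarrow> fst (d n) \<in> Q_h \<Omega> \<D> \<and> snd (d n) \<in> Q_h \<Omega> \<D> \<and>
      (\<forall>s\<in>?I n. AE x in lebesgue_on \<Omega>. p\<^sub>h s x = fst (d n) x + s *\<^sub>R snd (d n) x)"
    by blast
  define c0 c1 d0 d1 where "c0 n = fst (c n)" and "c1 n = snd (c n)" and "d0 n = fst (d n)" and "d1 n = snd (d n)" for n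
  have c: "c0 n \<in> V_h \<Omega> \<D>" "c1 n \<in> V_h \<Omega> \<D>"
    "\<And>s. s \<in> ?I n \<Longrightarrow> AE x in lebesgue_on \<Omega>. u\<^sub>h s x = c0 n x + s *\<^sub>R c1 n x" if "n \<in> {1..N}" for n
    using c[OF that] by (auto simp: c0_def c1_def)
  have d: "d0 n \<in> Q_h \<Omega> \<D>" "d1 n \<in> Q_h \<Omega> \<D>"
    "\<And>s. s \<in> ?I n \<Longrightarrow> AE x in lebesgue_on \<Omega>. p\<^sub>h s x = d0 n x + s *\<^sub>R d1 n x" if "n \<in> {1..N}" for n
    using d[OF that] by (auto simp: d0_def d1_def)
  define U where "U n = (if n = 0 then u\<^sub>0\<^sub>h else (\<lambda>x. c0 n x + t n *\<^sub>R c1 n x))" for n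
  define Pm where "Pm n = (\<lambda>x. d0 n x + midpt t n *\<^sub>R d1 n x)" for n
  have u0_Vh: "u\<^sub>0\<^sub>h \<in> V_h \<Omega> \<D>" using u0 by (simp add: V_h_div_def)
  have U_Vh: "U n \<in> V_h \<Omega> \<D>" if "n \<le> N" for n
  proof (cases "n = 0")
    case False
    then have n: "n \<in> {1..N}" using that by simp
    show ?thesis using V_h_combination[OF loc c(1,2)[OF n], of 1 "t n"] False by (simp add: U_def)
  qed (simp add: U_def u0_Vh)
  have u_U: "AE x in lebesgue_on \<Omega>. u\<^sub>h (t n) x = U n x" if "n \<le> N" for n
  proof (cases "n = 0")
    case True
    then show ?thesis using sol tm by (simp add: U_def scheme_solution_def time_mesh_def)
  next
    case False
    then have n: "n \<in> {1..N}" using that by simp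
    show ?thesis using c(3)[OF n, of "t n"] t_less[OF n] False by (simp add: U_def)
  qed
  have jet_U: "jet (U n) = jet (c0 n) + t n *\<^sub>R jet (c1 n)" if n: "n \<in> {1..N}" for n
    using jet_combination[OF V_h_H1[OF c(1)[OF n]] V_h_H1[OF c(2)[OF n]], of 1 "t n"] n by (simp add: U_def)
  have jet_U': "jet (U (n - 1)) = jet (c0 n) + t (n - 1) *\<^sub>R jet (c1 n)" if n: "n \<in> {1..N}" for n
  proof -
    let ?a = "t (n - 1)"
    have n1: "n - 1 \<le> N" using n by auto
    note Hc = V_h_H1[OF c(1)[OF n]] V_h_H1[OF c(2)[OF n]] and HU = V_h_H1[OF U_Vh[OF n1]]
    note L = H_space_L2[OF Hc(1)] H_space_L2[OF Hc(2)] and LU = H_space_L2[OF HU]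
    let ?y = "\<lambda>s. cls (c0 n) + s *\<^sub>R cls (c1 n)"
    have cs: "cls (\<lambda>x. c0 n x + s *\<^sub>R c1 n x) = ?y s" "(\<lambda>x. c0 n x + s *\<^sub>R c1 n x) \<in> L2 \<Omega>" for s
      using cls_combination[OF L, of 1 s] L2_add[OF L(1) L2_scaleR[OF L(2), of s]] by auto
    (* The affine function on the n-th interval, continued to its left end point, has the nodal
       value there by the condition on the right-sided limit. *)
    have "((\<lambda>s. norm (?y s - cls (U (n - 1)))) \<longlongrightarrow> 0) (at_right ?a)"
    proof (rule Lim_transform_eventually[OF sol'(3)[OF n, unfolded has_right_limit_def]])
      have "\<forall>\<^sub>F s in at_right ?a. s \<in> {?a<..<t n}"
        using t_less[OF n] by (rule eventually_at_right_real)
      then show "\<forall>\<^sub>F s in at_right ?a. L2_norm \<Omega> (\<lambda>x. u\<^sub>h s x - u\<^sub>h ?a x) = norm (?y s - cls (U (n - 1)))"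
      proof eventually_elim
        case (elim s)
        have s: "s \<in> ?I n" using elim by simp
        have "AE x in lebesgue_on \<Omega>. (c0 n x + s *\<^sub>R c1 n x) - U (n - 1) x = u\<^sub>h s x - u\<^sub>h ?a x"
          using c(3)[OF n s] u_U[OF n1] by eventually_elim simp
        from L2_norm_AE[OF L2_diff[OF cs(2) LU] this] show ?case
          by (simp add: cls_diff[OF cs(2) LU] cs(1))
      qed
    qed
    moreover have "((\<lambda>s. norm (?y s - cls (U (n - 1)))) \<longlongrightarrow> norm (?y ?a - cls (U (n - 1)))) (at_right ?a)"
      by (intro tendsto_intros)
    ultimately have "norm (?y ?a - cls (U (n - 1))) = 0"
      by (intro tendsto_unique[OF trivial_limit_at_right_real])
    then have "cls (\<lambda>x. c0 n x + ?a *\<^sub>R c1 n x) = cls (U (n - 1))"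
      by (simp add: cs(1))
    then have "AE x in lebesgue_on \<Omega>. c0 n x + ?a *\<^sub>R c1 n x = U (n - 1) x"
      by (simp only: cls_eq_iff[OF cs(2) LU])
    moreover have "(\<lambda>x. c0 n x + ?a *\<^sub>R c1 n x) \<in> H_space \<Omega> 1"
      using H_space_combination[OF Hc, of 1 ?a] by simp
    ultimately have "jet (\<lambda>x. c0 n x + ?a *\<^sub>R c1 n x) = jet (U (n - 1))"
      by (intro jet_AE_cong)
    then show ?thesis
      using jet_combination[OF Hc, of 1 ?a] by simp
  qed
  have diff: "(jet (U n) - jet (U (n - 1))) /\<^sub>R step t n = jet (c1 n)" if n: "n \<in> {1..N}" for n
  proof -
    have "jet (U n) - jet (U (n - 1)) = step t n *\<^sub>R jet (c1 n)"
      by (simp add: jet_U[OF n] jet_U'[OF n] step_def scaleR_diff_left)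
    moreover have "step t n \<noteq> 0" using t_less[OF n] by (simp add: step_def)
    ultimately show ?thesis by simp
  qed
  have avg: "(jet (U n) + jet (U (n - 1))) /\<^sub>R 2 = jet (c0 n) + midpt t n *\<^sub>R jet (c1 n)" if n: "n \<in> {1..N}" for n
  proof -
    have "t (n - 1) + t n = 2 * midpt t n" by (simp add: midpt_def)
    then have "t n *\<^sub>R y + t (n - 1) *\<^sub>R y = (2 * midpt t n) *\<^sub>R y" for y :: "'v::real_vector"
      by (metis scaleR_add_left add.commute)
    note sum = this
    have split: "(x + y) + (x + z) = 2 *\<^sub>R x + (y + z)" for x y z :: "'v::real_vector"
      by (simp add: scaleR_2)
    have "jet (U n) + jet (U (n - 1)) =
        (jet (c0 n) + t n *\<^sub>R jet (c1 n)) + (jet (c0 n) + t (n - 1) *\<^sub>R jet (c1 n))"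
      by (simp only: jet_U[OF n] jet_U'[OF n])
    also have "\<dots> = 2 *\<^sub>R jet (c0 n) + (2 * midpt t n) *\<^sub>R jet (c1 n)"
      by (simp only: split sum)
    also have "\<dots> = 2 *\<^sub>R (jet (c0 n) + midpt t n *\<^sub>R jet (c1 n))"
      by (simp only: scaleR_add_right scaleR_scaleR)
    finally have "jet (U n) + jet (U (n - 1)) = 2 *\<^sub>R (jet (c0 n) + midpt t n *\<^sub>R jet (c1 n))" .
    then show ?thesis by simp
  qed
  have dv_U: "dv (U n) \<bullet> cls q = 0" if "n \<le> N" and q: "q \<in> Q_h \<Omega> \<D>" for n q
    using that(1)
  proof (induction n)
    case 0
    have "L2_inner \<Omega> (divergence \<Omega> u\<^sub>0\<^sub>h) q = 0" using u0 q by (simp add: V_h_div_def)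
    then show ?case
      by (simp add: U_def inner_cls[OF divergence_L2[OF V_h_H1[OF u0_Vh]] Q_h_L2[OF q]])
  next
    case (Suc m)
    then have n: "Suc m \<in> {1..N}" by simp
    have "- (t (Suc m) - t (Suc m - 1)) * ((dv (c0 (Suc m)) + midpt t (Suc m) *\<^sub>R dv (c1 (Suc m))) \<bullet> cls q) = 0"
      using scheme_step(2)[OF t_less[OF n] loc c[OF n] d[OF n] q] sol'(5)[OF n q] by (simp add: midpt_def)
    then have "(dv (c0 (Suc m)) + midpt t (Suc m) *\<^sub>R dv (c1 (Suc m))) \<bullet> cls q = 0"
      using t_less[OF n] by simp
    then have "snd (snd ((jet (U (Suc m)) + jet (U (Suc m - 1))) /\<^sub>R 2)) \<bullet> cls q = 0"
      unfolding avg[OF n] by (simp add: jet_def)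
    then show ?case
      using Suc by (simp add: jet_def inner_add_left)
  qed
  show ?thesis
  proof (rule that[of U Pm])
    show "U n \<in> V_h \<Omega> \<D>" if "n \<le> N" for n by (rule U_Vh[OF that])
    show "AE x in lebesgue_on \<Omega>. u\<^sub>h 0 x = U 0 x"
      using u_U[of 0] tm by (simp add: time_mesh_def)
    show "Pm n \<in> Q_h \<Omega> \<D>" if "n \<in> {1..N}" for n
      using Q_h_combination[OF loc d(1,2)[OF that], of 1 "midpt t n"] by (simp add: Pm_def)
    show "AE x in lebesgue_on \<Omega>. p\<^sub>h (midpt t n) x = Pm n x" if n: "n \<in> {1..N}" for n
      unfolding Pm_def by (rule d(3)[OF n]) (use t_less[OF n] in \<open>simp add: midpt_def field_simps\<close>)
    show "dv (U n) \<bullet> cls q = 0" if "n \<le> N" "q \<in> Q_h \<Omega> \<D>" for n q by (rule dv_U[OF that])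
    fix n v assume n: "n \<in> {1..N}" and v: "v \<in> V_h \<Omega> \<D>"
    have fL: "f (t (n - 1)) \<in> L2 \<Omega>" "f (t n) \<in> L2 \<Omega>" using n f by auto
    have "step t n * (cls (c1 n) \<bullet> cls v + (grad (c0 n) + midpt t n *\<^sub>R grad (c1 n)) \<bullet> grad v
        - dv v \<bullet> (cls (d0 n) + midpt t n *\<^sub>R cls (d1 n))) =
        step t n / 2 * L2_inner \<Omega> (\<lambda>x. f (t (n - 1)) x + f (t n) x) v"
      unfolding sol'(4)[OF n v, symmetric] unfolding midpt_def step_def
      by (rule scheme_step(1)[OF t_less[OF n] loc c[OF n] d[OF n] v, symmetric])
    also have "\<dots> = step t n * (((cls (f (t (n - 1))) + cls (f (t n))) /\<^sub>R 2) \<bullet> cls v)"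
      using inner_cls[OF L2_add[OF fL] H_space_L2[OF V_h_H1[OF v]]] cls_add[OF fL] by simp
    finally have "step t n * (cls (c1 n) \<bullet> cls v + (grad (c0 n) + midpt t n *\<^sub>R grad (c1 n)) \<bullet> grad v
        - dv v \<bullet> (cls (d0 n) + midpt t n *\<^sub>R cls (d1 n))) =
        step t n * (((cls (f (t (n - 1))) + cls (f (t n))) /\<^sub>R 2) \<bullet> cls v)" .
    moreover have "step t n \<noteq> 0" using t_less[OF n] by (simp add: step_def)
    moreover have "cls (Pm n) = cls (d0 n) + midpt t n *\<^sub>R cls (d1 n)"
      using cls_combination[OF Q_h_L2 Q_h_L2, OF d(1,2)[OF n], of 1 "midpt t n"] by (simp add: Pm_def)
    ultimately show "fst ((jet (U n) - jet (U (n - 1))) /\<^sub>R step t n) \<bullet> cls v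
        + fst (snd ((jet (U n) + jet (U (n - 1))) /\<^sub>R 2)) \<bullet> grad v - dv v \<bullet> cls (Pm n)
        = ((cls (f (t (n - 1))) + cls (f (t n))) /\<^sub>R 2) \<bullet> cls v"
      unfolding diff[OF n] avg[OF n] by (simp add: jet_def)
  qed
qed

end

section \<open>The pressure error\<close>

context bounded_open_set
begin

lemma V_div_combination:
  assumes "v \<in> V_div \<Omega>" "w \<in> V_div \<Omega>"
  shows "(\<lambda>x. a *\<^sub>R v x + b *\<^sub>R w x) \<in> V_div \<Omega>"
proof -
  have V: "v \<in> V_space \<Omega>" "w \<in> V_space \<Omega>" using assms by (auto simp: V_div_def)
  note H = V_space_H1[OF V(1)] V_space_H1[OF V(2)] and Hc = V_space_H1[OF V_space_combination[OF V, of a b]]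
  have "L2_inner \<Omega> (divergence \<Omega> (\<lambda>x. a *\<^sub>R v x + b *\<^sub>R w x)) q = 0" if q: "q \<in> Q_space \<Omega>" for q
  proof -
    have "dv v \<bullet> cls q = 0" "dv w \<bullet> cls q = 0"
      using assms q inner_cls[OF divergence_L2[OF H(1)] Q_space_L2[OF q]] inner_cls[OF divergence_L2[OF H(2)] Q_space_L2[OF q]]
      by (auto simp: V_div_def)
    then show ?thesis
      unfolding inner_cls[OF divergence_L2[OF Hc] Q_space_L2[OF q], symmetric] dv_combination[OF H]
      by (simp add: inner_add_left)
  qed
  then show ?thesis
    using V_space_combination[OF V] by (simp add: V_div_def)
qed

text \<open>
  The estimate for one discretization, with a constant that depends on it only through the
  inf-sup constant \<open>\<beta>\<close> and the approximation constant \<open>C\<close>. The number \<open>M\<close> collects the norms of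
  the solution. The hypotheses on \<open>t \<mapsto> (u t, p t)\<close> are consequences of its regularity in time.
\<close>

lemma pressure_error_bound:
  fixes y1 :: "real \<Rightarrow> (real^'d, real^'d) l2"
  defines "du \<equiv> \<lambda>(u :: real \<Rightarrow> real^'d \<Rightarrow> real^'d) a b x. inverse (b - a) *\<^sub>R u b x + (- inverse (b - a)) *\<^sub>R u a x"
    and "dp \<equiv> \<lambda>(p :: real \<Rightarrow> real^'d \<Rightarrow> real) a b x. inverse (b - a) *\<^sub>R p b x + (- inverse (b - a)) *\<^sub>R p a x"
  assumes mm: "mixed_method (jet ` V_h \<Omega> \<D>) (cls ` Q_h \<Omega> \<D>) \<beta> P K" and KP: "K = real CARD('d)"
      "\<And>v. v \<in> V_space \<Omega> \<Longrightarrow> norm (cls v) \<le> P * norm (grad v)"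
    and loc: "local_spaces l \<D>" and app: "approximation_property C r \<Omega> \<D>" and h: "mesh_size \<D> > 0" and M: "M \<ge> 0"
    and f: "\<And>t. t \<in> {0..T} \<Longrightarrow> f t \<in> L2 \<Omega>"
    and u: "\<And>t. t \<in> {0..T} \<Longrightarrow> u t \<in> V_div \<Omega>" "\<And>t. t \<in> {0..T} \<Longrightarrow> u t \<in> H_space \<Omega> (r + 1)"
      "\<And>t. t \<in> {0..T} \<Longrightarrow> H_norm \<Omega> (r + 1) (u t) \<le> M"
      "\<And>a b. a \<in> {0..T} \<Longrightarrow> b \<in> {0..T} \<Longrightarrow> a < b \<Longrightarrow> H_norm \<Omega> (r + 1) (du u a b) \<le> M"
    and p: "\<And>t. t \<in> {0..T} \<Longrightarrow> p t \<in> Q_space \<Omega>" "\<And>t. t \<in> {0..T} \<Longrightarrow> p t \<in> H_space \<Omega> r"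
      "\<And>t. t \<in> {0..T} \<Longrightarrow> H_norm \<Omega> r (p t) \<le> M"
      "\<And>a b. a \<in> {0..T} \<Longrightarrow> b \<in> {0..T} \<Longrightarrow> a < b \<Longrightarrow> H_norm \<Omega> r (dp p a b) \<le> M"
    and trapezoid: "\<And>a b. a \<in> {0..T} \<Longrightarrow> b \<in> {0..T} \<Longrightarrow> a < b \<Longrightarrow>
      norm ((cls (u b) - cls (u a)) /\<^sub>R (b - a) - (y1 a + y1 b) /\<^sub>R 2) \<le> M * (b - a)\<^sup>2"
    and midpoint: "\<And>a b. a \<in> {0..T} \<Longrightarrow> b \<in> {0..T} \<Longrightarrow> a < b \<Longrightarrow>
      norm (cls (p ((a + b) / 2)) - (cls (p a) + cls (p b)) /\<^sub>R 2) \<le> M * (b - a)\<^sup>2"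
    and momentum: "\<And>t v. t \<in> {0..T} \<Longrightarrow> v \<in> V_space \<Omega> \<Longrightarrow>
      y1 t \<bullet> cls v + grad (u t) \<bullet> grad v - dv v \<bullet> cls (p t) = cls (f t) \<bullet> cls v"
    and tm: "time_mesh T N t" and u0: "u\<^sub>0\<^sub>h \<in> V_h_div \<Omega> \<D>"
    and sol: "scheme_solution \<Omega> \<D> N t f u\<^sub>0\<^sub>h u\<^sub>h p\<^sub>h" and n: "n \<in> {1..N}"
  defines "c1 \<equiv> P * (1 + mixed_method.stab \<beta> K) * (2 * \<bar>C\<bar> * M) + M"
    and "c2 \<equiv> (1 + (mixed_method.stab \<beta> K + 1 + K) / \<beta>) * (2 * \<bar>C\<bar> * M) + M"
  shows "(\<Sum>m=1..n. step t m * (L2_norm \<Omega> (\<lambda>x. p (midpt t m) x - p\<^sub>h (midpt t m) x))\<^sup>2)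
    \<le> (4 * c2\<^sup>2 * T + 6 * (2 + T) / \<beta>\<^sup>2 * (1 + 2 * T * c1\<^sup>2)) *
      ((L2_norm \<Omega> (Jacobian \<Omega> (\<lambda>x. u_hat \<Omega> \<D> t u p 0 x - u\<^sub>h 0 x)))\<^sup>2
        + max_step N t ^ 4 + mesh_size \<D> ^ (2 * r))"
proof -
  interpret mm: mixed_method "jet ` V_h \<Omega> \<D>" "cls ` Q_h \<Omega> \<D>" \<beta> P K by (rule mm)
  have t_less: "t (m - 1) < t m" if "m \<in> {1..N}" for m
    using tm that unfolding time_mesh_def by (cases m) (auto simp: less_eq_Suc_le)
  have t_mono: "t i \<le> t j" if "i \<le> j" "j \<le> N" for i j
    using that
  proof (induction j rule: dec_induct)
    case (step j)
    then show ?case using t_less[of "Suc j"] by simp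
  qed simp
  have t_in: "t m \<in> {0..T}" if "m \<le> N" for m
    using t_mono[of 0 m] t_mono[of m N] tm that by (simp add: time_mesh_def)
  have T0: "T \<ge> 0" using t_in[of 0] by simp
  have step_pos: "step t m > 0" if "m \<in> {1..N}" for m using t_less[OF that] by (simp add: step_def)
  have step_le: "step t m \<le> max_step N t" if "m \<in> {1..N}" for m
    unfolding max_step_def using that by (intro Max_ge) auto
  define \<tau> where "\<tau> = max_step N t"
  define H where "H = mesh_size \<D> ^ r"
  have H0: "H \<ge> 0" using h by (simp add: H_def)
  have \<tau>_sq: "(step t m)\<^sup>2 \<le> \<tau>\<^sup>2" if "m \<in> {1..N}" for m
    using step_le[OF that] step_pos[OF that] by (intro power_mono) (auto simp: \<tau>_def)
  have sum_step: "(\<Sum>m=1..k. step t m) = t k" if "k \<le> N" for k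
    using that
  proof (induction k)
    case 0
    then show ?case using tm by (simp add: time_mesh_def)
  qed (simp add: step_def)
  obtain U Pm where
    U: "\<And>n. n \<le> N \<Longrightarrow> U n \<in> V_h \<Omega> \<D>" "AE x in lebesgue_on \<Omega>. u\<^sub>h 0 x = U 0 x"
    and Pm: "\<And>n. n \<in> {1..N} \<Longrightarrow> Pm n \<in> Q_h \<Omega> \<D>"
      "\<And>n. n \<in> {1..N} \<Longrightarrow> AE x in lebesgue_on \<Omega>. p\<^sub>h (midpt t n) x = Pm n x"
    and div_U: "\<And>n q. n \<le> N \<Longrightarrow> q \<in> Q_h \<Omega> \<D> \<Longrightarrow> dv (U n) \<bullet> cls q = 0"
    and scheme: "\<And>n v. n \<in> {1..N} \<Longrightarrow> v \<in> V_h \<Omega> \<D> \<Longrightarrow>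
      fst ((jet (U n) - jet (U (n - 1))) /\<^sub>R step t n) \<bullet> cls v
      + fst (snd ((jet (U n) + jet (U (n - 1))) /\<^sub>R 2)) \<bullet> grad v - dv v \<bullet> cls (Pm n)
      = ((cls (f (t (n - 1))) + cls (f (t n))) /\<^sub>R 2) \<bullet> cls v"
    by (rule scheme_nodal_values[OF loc tm u0 sol f[OF t_in]]) (assumption, rule that)
  have uV: "u (t m) \<in> V_space \<Omega>" if "m \<le> N" for m
    using u(1)[OF t_in[OF that]] by (simp add: V_div_def)
  define y where "y m = fst (Stokes_projection \<Omega> \<D> (u (t m)) (p (t m)))" for m
  define x where "x m = jet (y m)" for m
  define q where "q m = cls (snd (Stokes_projection \<Omega> \<D> (u (t m)) (p (t m))))" for m
  have y: "y m \<in> V_h \<Omega> \<D>" and proj: "mm.Stokes_proj (jet (u (t m))) (cls (p (t m))) (x m) (q m)" if "m \<le> N" for m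
    by (rule Stokes_projection_spec[OF mm uV[OF that] p(1)[OF t_in[OF that]]], simp add: y_def x_def q_def)+
  define e where "e m = x m - jet (U m)" for m
  define z where "z m = (q m + q (m - 1)) /\<^sub>R 2 - cls (Pm m)" for m
  define \<rho> where "\<rho> m = fst ((x m - x (m - 1)) /\<^sub>R step t m) - (y1 (t (m - 1)) + y1 (t m)) /\<^sub>R 2" for m
  have energy: "\<beta>\<^sup>2 * (\<Sum>m=1..n. step t m * (norm (z m))\<^sup>2) \<le>
      3 * (2 + T) * ((norm (fst (snd (e 0))))\<^sup>2 + (\<Sum>m=1..n. step t m * (norm (\<rho> m))\<^sup>2))"
  proof (rule mm.Crank_Nicolson_pressure_bound)
    show "step t m > 0" if "m \<in> {1..n}" for m using step_pos[of m] that n by auto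
    show "sum (step t) {1..n} \<le> T" using sum_step[of n] t_in[of n] n by simp
    show "e m \<in> jet ` V_h \<Omega> \<D>" if "m \<le> n" for m
      unfolding e_def x_def using that n y[of m] U(1)[of m] mm.Vh by (intro subspace_diff) auto
    show "snd (snd (e m)) \<bullet> s = 0" if "m \<le> n" "s \<in> cls ` Q_h \<Omega> \<D>" for m s
    proof -
      have "snd (snd (x m)) \<bullet> s = 0" using proj[of m] that n by (auto simp: mm.Stokes_proj_def)
      moreover have "snd (snd (jet (U m))) \<bullet> s = 0" using div_U[of m] that n by (auto simp: jet_def)
      ultimately show ?thesis by (simp add: e_def inner_diff_left)
    qed
    show "z m \<in> cls ` Q_h \<Omega> \<D>" if "m \<in> {1..n}" for m
    proof -
      have "q m \<in> cls ` Q_h \<Omega> \<D>" "q (m - 1) \<in> cls ` Q_h \<Omega> \<D>"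
        using proj[of m] proj[of "m - 1"] that n by (auto simp: mm.Stokes_proj_def)
      moreover have "cls (Pm m) \<in> cls ` Q_h \<Omega> \<D>" using Pm(1)[of m] that n by auto
      ultimately show ?thesis
        unfolding z_def using mm.Qh by (intro subspace_diff subspace_scale subspace_add)
    qed
    fix m v assume m: "m \<in> {1..n}" and v: "v \<in> jet ` V_h \<Omega> \<D>"
    then obtain v' where v': "v' \<in> V_h \<Omega> \<D>" "v = jet v'" by blast
    have mN: "m \<in> {1..N}" "m \<le> N" "m - 1 \<le> N" using m n by auto
    have vj: "fst v = cls v'" "fst (snd v) = grad v'" "snd (snd v) = dv v'" by (simp_all add: v'(2) jet_def)
    have pr: "fst (snd (x k)) \<bullet> grad v' - dv v' \<bullet> q k = grad (u (t k)) \<bullet> grad v' - dv v' \<bullet> cls (p (t k))" if "k \<le> N" for k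
      using bspec[OF proj[OF that, unfolded mm.Stokes_proj_def, THEN conjunct2, THEN conjunct2, THEN conjunct1] v]
      unfolding vj by (simp add: jet_def)
    have mo: "y1 (t k) \<bullet> cls v' + grad (u (t k)) \<bullet> grad v' - dv v' \<bullet> cls (p (t k)) = cls (f (t k)) \<bullet> cls v'" if "k \<le> N" for k
      by (rule momentum[OF t_in[OF that] V_h_V_space[OF v'(1)]])
    have "fst ((e m - e (m - 1)) /\<^sub>R step t m) \<bullet> cls v' + fst (snd ((e m + e (m - 1)) /\<^sub>R 2)) \<bullet> grad v' - dv v' \<bullet> z m
      = fst ((x m - x (m - 1)) /\<^sub>R step t m) \<bullet> cls v'
        + ((fst (snd (x m)) \<bullet> grad v' - dv v' \<bullet> q m) + (fst (snd (x (m - 1))) \<bullet> grad v' - dv v' \<bullet> q (m - 1))) / 2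
        - (fst ((jet (U m) - jet (U (m - 1))) /\<^sub>R step t m) \<bullet> cls v'
          + fst (snd ((jet (U m) + jet (U (m - 1))) /\<^sub>R 2)) \<bullet> grad v' - dv v' \<bullet> cls (Pm m))"
      by (simp add: e_def z_def inner_add_left inner_add_right inner_diff_left inner_diff_right field_simps)
    also have "\<dots> = \<rho> m \<bullet> cls v'"
      unfolding pr[OF mN(2)] pr[OF mN(3)] scheme[OF mN(1) v'(1)]
      using mo[OF mN(2)] mo[OF mN(3)] by (simp add: \<rho>_def inner_add_left inner_diff_left field_simps)
    finally show "fst ((e m - e (m - 1)) /\<^sub>R step t m) \<bullet> fst v + fst (snd ((e m + e (m - 1)) /\<^sub>R 2)) \<bullet> fst (snd v)
        - snd (snd v) \<bullet> z m = \<rho> m \<bullet> fst v"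
      by (simp only: vj)
  qed
  \<comment> \<open>The difference quotient of the Stokes projections is the Stokes projection of the difference
    quotients.\<close>
  have \<rho>_le: "norm (\<rho> m) \<le> c1 * (H + \<tau>\<^sup>2)" if m: "m \<in> {1..N}" for m
  proof -
    have mN: "m \<le> N" "m - 1 \<le> N" using m by auto
    let ?a = "t (m - 1)" and ?b = "t m"
    have ab: "?a \<in> {0..T}" "?b \<in> {0..T}" "?a < ?b" using t_in[OF mN(1)] t_in[OF mN(2)] t_less[OF m] by auto
    have uH: "u ?b \<in> H_space \<Omega> 1" "u ?a \<in> H_space \<Omega> 1"
      using V_space_H1[OF uV[OF mN(1)]] V_space_H1[OF uV[OF mN(2)]] by auto
    have pL: "p ?b \<in> L2 \<Omega>" "p ?a \<in> L2 \<Omega>" using p(1) ab Q_space_L2 by auto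
    let ?i = "inverse (?b - ?a)"
    have "mm.Stokes_proj (jet (du u ?a ?b)) (cls (dp p ?a ?b)) (?i *\<^sub>R x m + (- ?i) *\<^sub>R x (m - 1)) (?i *\<^sub>R q m + (- ?i) *\<^sub>R q (m - 1))"
      unfolding du_def dp_def jet_combination[OF uH] cls_combination[OF pL]
      by (rule mm.Stokes_proj_combination[OF proj[OF mN(1)] proj[OF mN(2)]])
    moreover have "du u ?a ?b \<in> V_div \<Omega>"
      unfolding du_def by (intro V_div_combination u(1) ab(1,2))
    moreover have "du u ?a ?b \<in> H_space \<Omega> (r + 1)"
      unfolding du_def by (rule H_space_combination[OF u(2)[OF ab(2)] u(2)[OF ab(1)]])
    moreover have "dp p ?a ?b \<in> Q_space \<Omega>"
      unfolding dp_def real_scaleR_def using p(1) ab by (intro Q_space_combination)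
    moreover have "dp p ?a ?b \<in> H_space \<Omega> r"
      unfolding dp_def using p(2) ab by (intro H_space_combination)
    ultimately have "norm (cls (du u ?a ?b) - fst (?i *\<^sub>R x m + (- ?i) *\<^sub>R x (m - 1)))
        \<le> P * (1 + mm.stab) * (2 * \<bar>C\<bar> * M) * mesh_size \<D> ^ r"
      using u(4)[OF ab] p(4)[OF ab] by (intro Stokes_projection_error(1)[OF mm KP app h]) auto
    moreover have "cls (du u ?a ?b) = (cls (u ?b) - cls (u ?a)) /\<^sub>R (?b - ?a)"
      unfolding du_def cls_combination[OF H_space_L2[OF uH(1)] H_space_L2[OF uH(2)]] by (simp add: scaleR_diff_right)
    moreover have "?i *\<^sub>R x m + (- ?i) *\<^sub>R x (m - 1) = (x m - x (m - 1)) /\<^sub>R step t m"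
      by (simp add: step_def scaleR_diff_right)
    ultimately have A: "norm ((cls (u ?b) - cls (u ?a)) /\<^sub>R (?b - ?a) - fst ((x m - x (m - 1)) /\<^sub>R step t m))
        \<le> P * (1 + mm.stab) * (2 * \<bar>C\<bar> * M) * H"
      by (simp only: H_def)
    have B: "norm ((cls (u ?b) - cls (u ?a)) /\<^sub>R (?b - ?a) - (y1 ?a + y1 ?b) /\<^sub>R 2) \<le> M * \<tau>\<^sup>2"
      using trapezoid[OF ab] mult_left_mono[OF \<tau>_sq[OF m] M] by (simp add: step_def)
    have "\<rho> m = ((cls (u ?b) - cls (u ?a)) /\<^sub>R (?b - ?a) - (y1 ?a + y1 ?b) /\<^sub>R 2)
        - ((cls (u ?b) - cls (u ?a)) /\<^sub>R (?b - ?a) - fst ((x m - x (m - 1)) /\<^sub>R step t m))"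
      by (simp add: \<rho>_def)
    then have "norm (\<rho> m) \<le> M * \<tau>\<^sup>2 + P * (1 + mm.stab) * (2 * \<bar>C\<bar> * M) * H"
      using norm_triangle_le_diff[OF add_mono[OF B A]] by simp
    also have "\<dots> \<le> c1 * (H + \<tau>\<^sup>2)"
    proof -
      have "0 \<le> P * (1 + mm.stab) * (2 * \<bar>C\<bar> * M) * \<tau>\<^sup>2" "0 \<le> M * H"
        using mm.P mm.stab_nonneg M H0 by auto
      then show ?thesis unfolding c1_def by (simp only: distrib_left distrib_right)
    qed
    finally show ?thesis .
  qed
  have e_p: "L2_norm \<Omega> (\<lambda>x. p (midpt t m) x - p\<^sub>h (midpt t m) x) \<le> c2 * (H + \<tau>\<^sup>2) + norm (z m)" if m: "m \<in> {1..N}" for m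
  proof -
    have mN: "m \<le> N" "m - 1 \<le> N" using m by auto
    let ?a = "t (m - 1)" and ?b = "t m"
    have ab: "?a \<in> {0..T}" "?b \<in> {0..T}" "?a < ?b" using t_in[OF mN(1)] t_in[OF mN(2)] t_less[OF m] by auto
    have mid: "midpt t m \<in> {0..T}" using ab by (auto simp: midpt_def)
    note pL = Q_space_L2[OF p(1)[OF mid]] and PL = Q_h_L2[OF Pm(1)[OF m]]
    have "AE x in lebesgue_on \<Omega>. p (midpt t m) x - Pm m x = p (midpt t m) x - p\<^sub>h (midpt t m) x"
      using Pm(2)[OF m] by eventually_elim simp
    from L2_norm_AE[OF L2_diff[OF pL PL] this]
    have "L2_norm \<Omega> (\<lambda>x. p (midpt t m) x - p\<^sub>h (midpt t m) x) = norm (cls (p (midpt t m)) - cls (Pm m))"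
      by (simp add: cls_diff[OF pL PL])
    also have "cls (p (midpt t m)) - cls (Pm m) =
        (cls (p ((?a + ?b) / 2)) - (cls (p ?a) + cls (p ?b)) /\<^sub>R 2)
        + ((cls (p ?a) - q (m - 1)) /\<^sub>R 2 + (cls (p ?b) - q m) /\<^sub>R 2) + z m"
      by (simp add: z_def midpt_def scaleR_add_right scaleR_diff_right)
    also have "norm \<dots> \<le> norm (cls (p ((?a + ?b) / 2)) - (cls (p ?a) + cls (p ?b)) /\<^sub>R 2)
        + (norm (cls (p ?a) - q (m - 1)) / 2 + norm (cls (p ?b) - q m) / 2) + norm (z m)"
      by (intro norm_triangle_mono order_refl) simp_all
    also have "\<dots> \<le> M * \<tau>\<^sup>2 + ((1 + (mm.stab + 1 + K) / \<beta>) * (2 * \<bar>C\<bar> * M) * H) + norm (z m)"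
    proof -
      have "norm (cls (p (t k)) - q k) \<le> (1 + (mm.stab + 1 + K) / \<beta>) * (2 * \<bar>C\<bar> * M) * H" if k: "k \<le> N" for k
        unfolding H_def
        by (rule Stokes_projection_error(2)[OF mm KP app h u(1,2,3)[OF t_in[OF k]] p(1,2,3)[OF t_in[OF k]] proj[OF k]])
      moreover have "a' / 2 + b' / 2 \<le> c'" if "a' \<le> c'" "b' \<le> c'" for a' b' c' :: real
        using that by simp
      ultimately have "norm (cls (p ?a) - q (m - 1)) / 2 + norm (cls (p ?b) - q m) / 2 \<le> (1 + (mm.stab + 1 + K) / \<beta>) * (2 * \<bar>C\<bar> * M) * H"
        using mN by blast
      moreover have "norm (cls (p ((?a + ?b) / 2)) - (cls (p ?a) + cls (p ?b)) /\<^sub>R 2) \<le> M * \<tau>\<^sup>2"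
        using midpoint[OF ab] mult_left_mono[OF \<tau>_sq[OF m] M] by (simp add: step_def)
      ultimately show ?thesis by (intro add_mono order_refl)
    qed
    also have "\<dots> \<le> c2 * (H + \<tau>\<^sup>2) + norm (z m)"
    proof -
      have "0 \<le> (1 + (mm.stab + 1 + K) / \<beta>) * (2 * \<bar>C\<bar> * M) * \<tau>\<^sup>2" "0 \<le> M * H"
        using mm.\<beta> mm.K mm.stab_nonneg M H0 by auto
      then show ?thesis unfolding c2_def by (simp only: distrib_left distrib_right)
    qed
    finally show ?thesis .
  qed
  define G where "G = (norm (fst (snd (e 0))))\<^sup>2"
  define S where "S = H\<^sup>2 + (\<tau>\<^sup>2)\<^sup>2"
  have S0: "S \<ge> 0" by (simp add: S_def)
  have sq: "(c * (H + \<tau>\<^sup>2))\<^sup>2 \<le> 2 * c\<^sup>2 * S" for c :: real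
  proof -
    have "(H + \<tau>\<^sup>2)\<^sup>2 \<le> 2 * S"
      using sum_squares_bound[of H "\<tau>\<^sup>2"] by (simp add: S_def power2_sum)
    from mult_left_mono[OF this, of "c\<^sup>2"] show ?thesis by (simp add: power_mult_distrib mult.left_commute)
  qed
  have tn: "(\<Sum>m=1..n. step t m) \<le> T" using sum_step[of n] t_in[of n] n by simp
  have m_in: "m \<in> {1..N}" if "m \<in> {1..n}" for m using that n by auto
  have sum_const: "(\<Sum>m=1..n. step t m * a) \<le> T * a" if "a \<ge> 0" for a
    using mult_right_mono[OF tn that] by (simp add: sum_distrib_right)
  have "(\<Sum>m=1..n. step t m * (norm (\<rho> m))\<^sup>2) \<le> (\<Sum>m=1..n. step t m * (2 * c1\<^sup>2 * S))"
  proof (intro sum_mono mult_left_mono)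
    fix m assume m: "m \<in> {1..n}"
    have "(norm (\<rho> m))\<^sup>2 \<le> (c1 * (H + \<tau>\<^sup>2))\<^sup>2" by (intro power_mono \<rho>_le m_in m) simp
    then show "(norm (\<rho> m))\<^sup>2 \<le> 2 * c1\<^sup>2 * S" using sq[of c1] by linarith
    show "0 \<le> step t m" using step_pos[OF m_in[OF m]] by simp
  qed
  also have "\<dots> \<le> T * (2 * c1\<^sup>2 * S)" using S0 by (intro sum_const) simp
  finally have \<rho>_sum: "(\<Sum>m=1..n. step t m * (norm (\<rho> m))\<^sup>2) \<le> T * (2 * c1\<^sup>2 * S)" .
  have "\<beta>\<^sup>2 * (\<Sum>m=1..n. step t m * (norm (z m))\<^sup>2) \<le> 3 * (2 + T) * (G + T * (2 * c1\<^sup>2 * S))"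
    using T0 \<rho>_sum by (intro order_trans[OF energy] mult_left_mono) (auto simp: G_def)
  then have z_sum: "(\<Sum>m=1..n. step t m * (norm (z m))\<^sup>2) \<le> 3 * (2 + T) / \<beta>\<^sup>2 * (G + T * (2 * c1\<^sup>2 * S))"
    using mm.\<beta> by (simp add: pos_le_divide_eq mult.commute)
  have "(\<Sum>m=1..n. step t m * (L2_norm \<Omega> (\<lambda>x. p (midpt t m) x - p\<^sub>h (midpt t m) x))\<^sup>2)
      \<le> (\<Sum>m=1..n. step t m * (4 * c2\<^sup>2 * S + 2 * (norm (z m))\<^sup>2))"
  proof (intro sum_mono mult_left_mono)
    fix m assume m: "m \<in> {1..n}"
    have "0 \<le> L2_norm \<Omega> (\<lambda>x. p (midpt t m) x - p\<^sub>h (midpt t m) x)"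
      by (simp add: L2_norm_def L2_inner_def)
    then have "(L2_norm \<Omega> (\<lambda>x. p (midpt t m) x - p\<^sub>h (midpt t m) x))\<^sup>2 \<le> (c2 * (H + \<tau>\<^sup>2) + norm (z m))\<^sup>2"
      by (intro power_mono e_p m_in m)
    also have "\<dots> \<le> 2 * (c2 * (H + \<tau>\<^sup>2))\<^sup>2 + 2 * (norm (z m))\<^sup>2"
      using sum_squares_bound[of "c2 * (H + \<tau>\<^sup>2)" "norm (z m)"] by (simp add: power2_sum)
    also have "\<dots> \<le> 4 * c2\<^sup>2 * S + 2 * (norm (z m))\<^sup>2" using sq[of c2] by linarith
    finally show "(L2_norm \<Omega> (\<lambda>x. p (midpt t m) x - p\<^sub>h (midpt t m) x))\<^sup>2 \<le> 4 * c2\<^sup>2 * S + 2 * (norm (z m))\<^sup>2" .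
    show "0 \<le> step t m" using step_pos[OF m_in[OF m]] by simp
  qed
  also have "\<dots> = (\<Sum>m=1..n. step t m * (4 * c2\<^sup>2 * S)) + 2 * (\<Sum>m=1..n. step t m * (norm (z m))\<^sup>2)"
    by (simp add: distrib_left sum.distrib sum_distrib_left mult.left_commute)
  also have "\<dots> \<le> T * (4 * c2\<^sup>2 * S) + 2 * (3 * (2 + T) / \<beta>\<^sup>2 * (G + T * (2 * c1\<^sup>2 * S)))"
    using S0 z_sum by (intro add_mono sum_const mult_left_mono) auto
  also have "\<dots> = 4 * c2\<^sup>2 * T * S + 6 * (2 + T) / \<beta>\<^sup>2 * (G + 2 * T * c1\<^sup>2 * S)"
    by (simp add: field_simps)
  also have "\<dots> \<le> 4 * c2\<^sup>2 * T * (G + S) + 6 * (2 + T) / \<beta>\<^sup>2 * ((1 + 2 * T * c1\<^sup>2) * (G + S))"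
  proof -
    have "G \<ge> 0" by (simp add: G_def)
    then have "S \<le> G + S" "0 \<le> S + 2 * T * c1\<^sup>2 * G" using S0 T0 by auto
    moreover have "G + 2 * T * c1\<^sup>2 * S \<le> (1 + 2 * T * c1\<^sup>2) * (G + S)"
      using calculation(2) by (simp add: distrib_left distrib_right)
    ultimately show ?thesis
      using T0 mm.\<beta> by (intro add_mono mult_left_mono) auto
  qed
  also have "\<dots> = (4 * c2\<^sup>2 * T + 6 * (2 + T) / \<beta>\<^sup>2 * (1 + 2 * T * c1\<^sup>2)) * (G + S)"
    by (simp only: distrib_right mult.assoc)
  also have "G = (L2_norm \<Omega> (Jacobian \<Omega> (\<lambda>x. u_hat \<Omega> \<D> t u p 0 x - u\<^sub>h 0 x)))\<^sup>2"
  proof -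
    have R: "R1_interpolant t v 0 = v 0" for v :: "real \<Rightarrow> real^'d \<Rightarrow> 'b::real_normed_vector"
      by (rule ext) (simp add: R1_interpolant_def)
    have "u_hat \<Omega> \<D> t u p 0 = y 0"
      using tm by (simp add: u_hat_def y_def R time_mesh_def)
    moreover have HyU: "y 0 \<in> H_space \<Omega> 1" "U 0 \<in> H_space \<Omega> 1"
      using V_h_H1[OF y] V_h_H1[OF U(1)] by auto
    note HD = H_space_diff[OF HyU]
    have ae: "AE x in lebesgue_on \<Omega>. y 0 x - U 0 x = y 0 x - u\<^sub>h 0 x"
      using U(2) by eventually_elim simp
    have "jet (\<lambda>x. y 0 x - u\<^sub>h 0 x) = e 0"
      using jet_AE_cong[OF HD ae] jet_diff[OF HyU] by (simp add: e_def x_def)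
    then have "grad (\<lambda>x. y 0 x - u\<^sub>h 0 x) = fst (snd (e 0))"
      by (auto simp: jet_def dest: arg_cong[of _ _ "\<lambda>x. fst (snd x)"])
    ultimately show ?thesis
      using norm_cls[OF Jacobian_L2[OF H_space_AE_closed[OF HD ae]]] by (simp add: G_def)
  qed
  also have "S = max_step N t ^ 4 + mesh_size \<D> ^ (2 * r)"
    by (simp add: S_def H_def \<tau>_def power_mult[symmetric] mult.commute)
  finally show ?thesis by (simp only: add.assoc)
qed

end

context bounded_open_set
begin

lemma H_norm_le_card:
  assumes "v \<in> H_space \<Omega> m" "\<And>is. length is \<le> m \<Longrightarrow> norm (D is v) \<le> B"
  shows "H_norm \<Omega> m v \<le> real (card {is :: 'd list. length is \<le> m}) * B"
proof -
  have "(\<Sum>is | length is \<le> m. norm (D is v)) \<le> real (card {is :: 'd list. length is \<le> m}) * B"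
    by (rule sum_bounded_above) (use assms(2) in auto)
  with H_norm_le_sum[OF assms(1)] show ?thesis by linarith
qed

text \<open>
  The mean value inequality for each spatial derivative bounds difference quotients in time in the
  same norm as the function itself.
\<close>

lemma H_norm_difference_quotient_bound:
  fixes w :: "real \<Rightarrow> real^'d \<Rightarrow> 'b::euclidean_space"
  assumes "C_time \<Omega> T k k' w" "0 < k" "m \<le> k'"
  obtains M where "M \<ge> 0" "\<And>t. t \<in> {0..T} \<Longrightarrow> H_norm \<Omega> m (w t) \<le> M"
    "\<And>a b. a \<in> {0..T} \<Longrightarrow> b \<in> {0..T} \<Longrightarrow> a < b \<Longrightarrow>
      H_norm \<Omega> m (\<lambda>x. inverse (b - a) *\<^sub>R w b x + (- inverse (b - a)) *\<^sub>R w a x) \<le> M"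
proof -
  obtain W where W: "W 0 = w" "\<And>j t. j \<le> k \<Longrightarrow> t \<in> {0..T} \<Longrightarrow> W j t \<in> H_space \<Omega> k'"
    "\<And>is j. length is \<le> k' \<Longrightarrow> j \<le> k \<Longrightarrow> continuous_on {0..T} (\<lambda>t. D is (W j t))"
    "\<And>is j t. length is \<le> k' \<Longrightarrow> j < k \<Longrightarrow> t \<in> {0..T} \<Longrightarrow>
      ((\<lambda>s. D is (W j s)) has_vector_derivative D is (W (Suc j) t)) (at t within {0..T})"
    by (rule C_time_curves[OF assms(1)]) (rule that)
  have wH: "w t \<in> H_space \<Omega> m" if "t \<in> {0..T}" for t
    using H_space_mono[OF W(2)[OF le0 that] assms(3)] W(1) by simp
  obtain M0 where M0: "M0 \<ge> 0" "\<And>is t. length is \<le> m \<Longrightarrow> t \<in> {0..T} \<Longrightarrow> norm (D is (W 0 t)) \<le> M0"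
    by (rule continuous_on_D_bounded[of m T "W 0"]) (use W(3) assms in auto)
  obtain M1 where M1: "M1 \<ge> 0" "\<And>is t. length is \<le> m \<Longrightarrow> t \<in> {0..T} \<Longrightarrow> norm (D is (W (Suc 0) t)) \<le> M1"
    by (rule continuous_on_D_bounded[of m T "W (Suc 0)"]) (use W(3) assms in auto)
  let ?c = "real (card {is :: 'd list. length is \<le> m})"
  show ?thesis
  proof (rule that[of "?c * (M0 + M1)"])
    show "0 \<le> ?c * (M0 + M1)" using M0 M1 by simp
    show "H_norm \<Omega> m (w t) \<le> ?c * (M0 + M1)" if t: "t \<in> {0..T}" for t
      by (rule H_norm_le_card[OF wH[OF t]]) (use M0(2)[OF _ t] M1(1) W(1) in fastforce)
    fix a b assume ab: "a \<in> {0..T}" "b \<in> {0..T}" "a < b"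
    show "H_norm \<Omega> m (\<lambda>x. inverse (b - a) *\<^sub>R w b x + (- inverse (b - a)) *\<^sub>R w a x) \<le> ?c * (M0 + M1)"
    proof (rule H_norm_le_card[OF H_space_combination[OF wH[OF ab(2)] wH[OF ab(1)]]])
      fix "is" :: "'d list" assume l: "length is \<le> m"
      have "norm ((D is (W 0 b) - D is (W 0 a)) /\<^sub>R (b - a)) \<le> M1"
      proof (rule mean_value_bound[OF ab(3)])
        show "{a..b} \<subseteq> {0..T}" using ab by auto
        show "((\<lambda>s. D is (W 0 s)) has_vector_derivative D is (W (Suc 0) t)) (at t within {0..T})" if "t \<in> {0..T}" for t
          by (rule W(4)) (use l assms that in auto)
        show "norm (D is (W (Suc 0) t)) \<le> M1" if "t \<in> {0..T}" for t by (rule M1(2)[OF l that])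
      qed
      then have "norm ((D is (W 0 b) - D is (W 0 a)) /\<^sub>R (b - a)) \<le> M0 + M1"
        using M0(1) by linarith
      moreover have "D is (\<lambda>x. inverse (b - a) *\<^sub>R w b x + (- inverse (b - a)) *\<^sub>R w a x) =
          (D is (W 0 b) - D is (W 0 a)) /\<^sub>R (b - a)"
        unfolding D_combination[OF wH[OF ab(2)] wH[OF ab(1)] l] by (simp add: W(1) scaleR_diff_right)
      ultimately show "norm (D is (\<lambda>x. inverse (b - a) *\<^sub>R w b x + (- inverse (b - a)) *\<^sub>R w a x)) \<le> M0 + M1"
        by (simp only:)
    qed
  qed
qed

text \<open>
  The solution enters the estimates only through the constant obtained here and through the time
  derivative \<open>y1\<close> of the velocity, for which the momentum equation holds up to the initial time.
\<close>

lemma solution_regularity_bounds: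
  assumes T: "0 < T" and sol: "nonstationary_solution \<Omega> T f u\<^sub>0 u p"
    and Cu: "C_time \<Omega> T (r + 3) (r + 3) u" and Cp: "C_time \<Omega> T (r + 3) (r + 3) p" and Cf: "C_time \<Omega> T k' m' f"
  obtains M y1 where "M \<ge> 0"
    "\<And>t. t \<in> {0..T} \<Longrightarrow> H_norm \<Omega> (r + 1) (u t) \<le> M" "\<And>t. t \<in> {0..T} \<Longrightarrow> H_norm \<Omega> r (p t) \<le> M"
    "\<And>a b. a \<in> {0..T} \<Longrightarrow> b \<in> {0..T} \<Longrightarrow> a < b \<Longrightarrow>
      H_norm \<Omega> (r + 1) (\<lambda>x. inverse (b - a) *\<^sub>R u b x + (- inverse (b - a)) *\<^sub>R u a x) \<le> M"
    "\<And>a b. a \<in> {0..T} \<Longrightarrow> b \<in> {0..T} \<Longrightarrow> a < b \<Longrightarrow>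
      H_norm \<Omega> r (\<lambda>x. inverse (b - a) *\<^sub>R p b x + (- inverse (b - a)) *\<^sub>R p a x) \<le> M"
    "\<And>a b. a \<in> {0..T} \<Longrightarrow> b \<in> {0..T} \<Longrightarrow> a < b \<Longrightarrow>
      norm ((cls (u b) - cls (u a)) /\<^sub>R (b - a) - (y1 a + y1 b) /\<^sub>R 2) \<le> M * (b - a)\<^sup>2"
    "\<And>a b. a \<in> {0..T} \<Longrightarrow> b \<in> {0..T} \<Longrightarrow> a < b \<Longrightarrow>
      norm (cls (p ((a + b) / 2)) - (cls (p a) + cls (p b)) /\<^sub>R 2) \<le> M * (b - a)\<^sup>2"
    "\<And>t v. t \<in> {0..T} \<Longrightarrow> v \<in> V_space \<Omega> \<Longrightarrow>
      y1 t \<bullet> cls v + grad (u t) \<bullet> grad v - dv v \<bullet> cls (p t) = cls (f t) \<bullet> cls v"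
proof -
  obtain W where W: "W 0 = u" "\<And>j t. j \<le> r + 3 \<Longrightarrow> t \<in> {0..T} \<Longrightarrow> W j t \<in> H_space \<Omega> (r + 3)"
    "\<And>is j. length is \<le> r + 3 \<Longrightarrow> j \<le> r + 3 \<Longrightarrow> continuous_on {0..T} (\<lambda>t. D is (W j t))"
    "\<And>is j t. length is \<le> r + 3 \<Longrightarrow> j < r + 3 \<Longrightarrow> t \<in> {0..T} \<Longrightarrow>
      ((\<lambda>s. D is (W j s)) has_vector_derivative D is (W (Suc j) t)) (at t within {0..T})"
    by (rule C_time_curves[OF Cu]) (rule that)
  obtain Q where Q: "Q 0 = p" "\<And>j t. j \<le> r + 3 \<Longrightarrow> t \<in> {0..T} \<Longrightarrow> Q j t \<in> H_space \<Omega> (r + 3)"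
    "\<And>is j. length is \<le> r + 3 \<Longrightarrow> j \<le> r + 3 \<Longrightarrow> continuous_on {0..T} (\<lambda>t. D is (Q j t))"
    "\<And>is j t. length is \<le> r + 3 \<Longrightarrow> j < r + 3 \<Longrightarrow> t \<in> {0..T} \<Longrightarrow>
      ((\<lambda>s. D is (Q j s)) has_vector_derivative D is (Q (Suc j) t)) (at t within {0..T})"
    by (rule C_time_curves[OF Cp]) (rule that)
  obtain F where F: "F 0 = f" "\<And>j t. j \<le> k' \<Longrightarrow> t \<in> {0..T} \<Longrightarrow> F j t \<in> H_space \<Omega> m'"
    "\<And>is j. length is \<le> m' \<Longrightarrow> j \<le> k' \<Longrightarrow> continuous_on {0..T} (\<lambda>t. D is (F j t))"
    by (rule C_time_curves[OF Cf]) (rule that)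
  have Du: "D [] (W j t) = cls (W j t)" if "j \<le> r + 3" "t \<in> {0..T}" for j t
    by (rule D_Nil[OF H_space_L2[OF W(2)[OF that]]])
  have Dp: "D [] (Q j t) = cls (Q j t)" if "j \<le> r + 3" "t \<in> {0..T}" for j t
    by (rule D_Nil[OF H_space_L2[OF Q(2)[OF that]]])
  have Du0: "D [] (u t) = cls (u t)" and Dp0: "D [] (p t) = cls (p t)" if "t \<in> {0..T}" for t
    using Du[OF le0 that] Dp[OF le0 that] by (simp_all add: W(1) Q(1))
  obtain Mu where Mu: "Mu \<ge> 0" "\<And>t. t \<in> {0..T} \<Longrightarrow> H_norm \<Omega> (r + 1) (u t) \<le> Mu"
    "\<And>a b. a \<in> {0..T} \<Longrightarrow> b \<in> {0..T} \<Longrightarrow> a < b \<Longrightarrow>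
      H_norm \<Omega> (r + 1) (\<lambda>x. inverse (b - a) *\<^sub>R u b x + (- inverse (b - a)) *\<^sub>R u a x) \<le> Mu"
    by (rule H_norm_difference_quotient_bound[OF Cu, of "r + 1"]) (simp, simp, rule that)
  obtain Mp where Mp: "Mp \<ge> 0" "\<And>t. t \<in> {0..T} \<Longrightarrow> H_norm \<Omega> r (p t) \<le> Mp"
    "\<And>a b. a \<in> {0..T} \<Longrightarrow> b \<in> {0..T} \<Longrightarrow> a < b \<Longrightarrow>
      H_norm \<Omega> r (\<lambda>x. inverse (b - a) *\<^sub>R p b x + (- inverse (b - a)) *\<^sub>R p a x) \<le> Mp"
    by (rule H_norm_difference_quotient_bound[OF Cp, of r]) (simp, simp, rule that)
  obtain M3 where M3: "M3 \<ge> 0" "\<And>is t. length is \<le> 0 \<Longrightarrow> t \<in> {0..T} \<Longrightarrow> norm (D is (W 3 t)) \<le> M3"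
    by (rule continuous_on_D_bounded[of 0 T "W 3"]) (use W(3) in auto)
  obtain M2 where M2: "M2 \<ge> 0" "\<And>is t. length is \<le> 0 \<Longrightarrow> t \<in> {0..T} \<Longrightarrow> norm (D is (Q 2 t)) \<le> M2"
    by (rule continuous_on_D_bounded[of 0 T "Q 2"]) (use Q(3) in auto)
  define M where "M = Mu + Mp + M3 + M2"
  have M_ge: "Mu \<le> M" "Mp \<le> M" "M3 \<le> M" "M2 \<le> M" "0 \<le> M"
    using Mu(1) Mp(1) M3(1) M2(1) by (auto simp: M_def)
  have W': "((\<lambda>s. D [] (W j s)) has_vector_derivative D [] (W (Suc j) t)) (at t within {0..T})"
    if "j < r + 3" "t \<in> {0..T}" for j t
    by (rule W(4)) (use that in auto)
  have Q': "((\<lambda>s. D [] (Q j s)) has_vector_derivative D [] (Q (Suc j) t)) (at t within {0..T})"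
    if "j < r + 3" "t \<in> {0..T}" for j t
    by (rule Q(4)) (use that in auto)
  show ?thesis
  proof (rule that[of M "\<lambda>t. cls (W 1 t)"])
    show "M \<ge> 0" by (rule M_ge)
    show "H_norm \<Omega> (r + 1) (u t) \<le> M" "H_norm \<Omega> r (p t) \<le> M" if "t \<in> {0..T}" for t
      using Mu(2)[OF that] Mp(2)[OF that] M_ge by linarith+
    show "H_norm \<Omega> (r + 1) (\<lambda>x. inverse (b - a) *\<^sub>R u b x + (- inverse (b - a)) *\<^sub>R u a x) \<le> M"
      "H_norm \<Omega> r (\<lambda>x. inverse (b - a) *\<^sub>R p b x + (- inverse (b - a)) *\<^sub>R p a x) \<le> M"
      if "a \<in> {0..T}" "b \<in> {0..T}" "a < b" for a b
      using Mu(3)[OF that] Mp(3)[OF that] M_ge by linarith+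
  next
    fix a b assume ab: "a \<in> {0..T}" "b \<in> {0..T}" "a < b"
    have sub: "{a..b} \<subseteq> {0..T}" using ab by auto
    have mid: "(a + b) / 2 \<in> {0..T}" using ab by auto
    have "norm ((D [] (W 0 b) - D [] (W 0 a)) /\<^sub>R (b - a) - (D [] (W 1 a) + D [] (W 1 b)) /\<^sub>R 2) \<le> M * (b - a)\<^sup>2"
    proof (rule trapezoid_error[OF ab(3) sub])
      show "((\<lambda>s. D [] (W 0 s)) has_vector_derivative D [] (W 1 t)) (at t within {0..T})"
        "((\<lambda>s. D [] (W 1 s)) has_vector_derivative D [] (W 2 t)) (at t within {0..T})"
        "((\<lambda>s. D [] (W 2 s)) has_vector_derivative D [] (W 3 t)) (at t within {0..T})"
        "norm (D [] (W 3 t)) \<le> M" if "t \<in> {0..T}" for t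
        using W'[of 0 t] W'[of 1 t] W'[of 2 t] M3(2)[of "[]" t] that M_ge(3)
        by (simp_all add: eval_nat_numeral One_nat_def)
    qed
    then show "norm ((cls (u b) - cls (u a)) /\<^sub>R (b - a) - (cls (W 1 a) + cls (W 1 b)) /\<^sub>R 2) \<le> M * (b - a)\<^sup>2"
      using ab by (simp add: Du Du0 W(1))
    have "norm (D [] (Q 0 ((a + b) / 2)) - (D [] (Q 0 a) + D [] (Q 0 b)) /\<^sub>R 2) \<le> M * (b - a)\<^sup>2"
    proof (rule midpoint_error[OF ab(3) sub])
      show "((\<lambda>s. D [] (Q 0 s)) has_vector_derivative D [] (Q 1 t)) (at t within {0..T})"
        "((\<lambda>s. D [] (Q 1 s)) has_vector_derivative D [] (Q 2 t)) (at t within {0..T})"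
        "norm (D [] (Q 2 t)) \<le> M" if "t \<in> {0..T}" for t
        using Q'[of 0 t] Q'[of 1 t] M2(2)[of "[]" t] that M_ge(4)
        by (simp_all add: eval_nat_numeral One_nat_def)
    qed
    then show "norm (cls (p ((a + b) / 2)) - (cls (p a) + cls (p b)) /\<^sub>R 2) \<le> M * (b - a)\<^sup>2"
      using ab mid by (simp add: Dp0 Q(1))
  next
    fix t v assume tv: "t \<in> {0..T}" "v \<in> V_space \<Omega>"
    show "cls (W 1 t) \<bullet> cls v + grad (u t) \<bullet> grad v - dv v \<bullet> cls (p t) = cls (f t) \<bullet> cls v"
    proof (rule weak_momentum_equation[OF T sol, of "r + 3" W])
      show "((\<lambda>s. D is (W 0 s)) has_vector_derivative D is (W 1 t)) (at t within {0..T})"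
        if "length is \<le> r + 3" "t \<in> {0..T}" for "is" t
        using W(4)[OF that(1) _ that(2), of 0] by (simp add: One_nat_def)
      show "p t \<in> H_space \<Omega> 1" if "t \<in> {0..T}" for t
        using H_space_mono[OF Q(2)[OF le0 that], of 1] Q(1) by simp
      have "continuous_on {0..T} (\<lambda>t. D [] (Q 0 t))" by (rule Q(3)) auto
      then show "continuous_on {0..T} (\<lambda>t. cls (p t))"
        by (rule continuous_on_eq) (simp add: Dp0 Q(1))
      show fL: "f t \<in> L2 \<Omega>" if "t \<in> {0..T}" for t
        using H_space_L2[OF F(2)[OF le0 that]] F(1) by simp
      have "continuous_on {0..T} (\<lambda>t. D [] (F 0 t))" by (rule F(3)) auto
      then show "continuous_on {0..T} (\<lambda>t. cls (f t))"
        by (rule continuous_on_eq) (simp add: D_Nil[OF fL] F(1))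
    qed (use W(1,2,3) tv in auto)
  qed
qed

end

theorem theorem3p10:
  fixes r :: nat
  assumes "CARD('d::finite) \<in> {2, 3}"
  shows "\<exists>k. \<forall>(\<Omega> :: (real^'d) set) T f u\<^sub>0 u p \<F>.
    bounded_domain \<Omega> \<and> 0 < T \<and> Stokes_H2_regular \<Omega> \<and>
    nonstationary_solution \<Omega> T f u\<^sub>0 u p \<and>
    C_time \<Omega> T k k u \<and> C_time \<Omega> T k k p \<and> C_time \<Omega> T (k - 2) (k - 2) f \<and>
    finite_element_family \<Omega> r \<F> \<longrightarrow>
    (\<exists>C>0. \<forall>\<D>\<in>\<F>. \<forall>N t u\<^sub>0\<^sub>h u\<^sub>h p\<^sub>h.
       time_mesh T N t \<and> u\<^sub>0\<^sub>h \<in> V_h_div \<Omega> \<D> \<and> scheme_solution \<Omega> \<D> N t f u\<^sub>0\<^sub>h u\<^sub>h p\<^sub>h \<longrightarrow>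
       (\<forall>n\<in>{1..N}.
          (\<Sum>m=1..n. step t m * (L2_norm \<Omega> (\<lambda>x. p (midpt t m) x - p\<^sub>h (midpt t m) x))\<^sup>2)
          \<le> C * ((L2_norm \<Omega> (Jacobian \<Omega> (\<lambda>x. u_hat \<Omega> \<D> t u p 0 x - u\<^sub>h 0 x)))\<^sup>2
                 + max_step N t ^ 4 + mesh_size \<D> ^ (2 * r))))"
proof (intro exI[of _ "r + 3"] allI impI, elim conjE)
  fix \<Omega> :: "(real^'d) set" and T f u\<^sub>0 u p \<F>
  assume dom: "bounded_domain \<Omega>" and T: "0 < T" and sol: "nonstationary_solution \<Omega> T f u\<^sub>0 u p"
    and Cu: "C_time \<Omega> T (r + 3) (r + 3) u" and Cp: "C_time \<Omega> T (r + 3) (r + 3) p"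
    and Cf: "C_time \<Omega> T (r + 3 - 2) (r + 3 - 2) f" and fam: "finite_element_family \<Omega> r \<F>"
  interpret bounded_open_set \<Omega>
    using dom by unfold_locales (auto simp: bounded_domain_def)
  have \<Omega>: "\<Omega> \<noteq> {}" using dom by (simp add: bounded_domain_def)
  obtain \<sigma> l \<beta> C where mesh: "\<And>\<D>. \<D> \<in> \<F> \<Longrightarrow> is_mesh \<Omega> \<D>" and sr: "\<And>\<D>. \<D> \<in> \<F> \<Longrightarrow> shape_regular \<sigma> \<D>"
    and loc: "\<And>\<D>. \<D> \<in> \<F> \<Longrightarrow> local_spaces l \<D>" and \<beta>: "\<beta> > 0"
    and isc: "\<And>\<D>. \<D> \<in> \<F> \<Longrightarrow> inf_sup_condition \<beta> \<Omega> \<D>"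
    and app: "\<And>\<D>. \<D> \<in> \<F> \<Longrightarrow> approximation_property C r \<Omega> \<D>"
    using fam unfolding finite_element_family_def by blast
  obtain P where P: "P \<ge> 0" "\<And>v. v \<in> V_space \<Omega> \<Longrightarrow> norm (cls v) \<le> P * norm (grad v)"
    using Poincare by blast
  obtain M y1 where M: "M \<ge> 0"
    "\<And>t. t \<in> {0..T} \<Longrightarrow> H_norm \<Omega> (r + 1) (u t) \<le> M" "\<And>t. t \<in> {0..T} \<Longrightarrow> H_norm \<Omega> r (p t) \<le> M"
    "\<And>a b. a \<in> {0..T} \<Longrightarrow> b \<in> {0..T} \<Longrightarrow> a < b \<Longrightarrow>
      H_norm \<Omega> (r + 1) (\<lambda>x. inverse (b - a) *\<^sub>R u b x + (- inverse (b - a)) *\<^sub>R u a x) \<le> M"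
    "\<And>a b. a \<in> {0..T} \<Longrightarrow> b \<in> {0..T} \<Longrightarrow> a < b \<Longrightarrow>
      H_norm \<Omega> r (\<lambda>x. inverse (b - a) *\<^sub>R p b x + (- inverse (b - a)) *\<^sub>R p a x) \<le> M"
    "\<And>a b. a \<in> {0..T} \<Longrightarrow> b \<in> {0..T} \<Longrightarrow> a < b \<Longrightarrow>
      norm ((cls (u b) - cls (u a)) /\<^sub>R (b - a) - (y1 a + y1 b) /\<^sub>R 2) \<le> M * (b - a)\<^sup>2"
    "\<And>a b. a \<in> {0..T} \<Longrightarrow> b \<in> {0..T} \<Longrightarrow> a < b \<Longrightarrow>
      norm (cls (p ((a + b) / 2)) - (cls (p a) + cls (p b)) /\<^sub>R 2) \<le> M * (b - a)\<^sup>2"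
    "\<And>t v. t \<in> {0..T} \<Longrightarrow> v \<in> V_space \<Omega> \<Longrightarrow>
      y1 t \<bullet> cls v + grad (u t) \<bullet> grad v - dv v \<bullet> cls (p t) = cls (f t) \<bullet> cls v"
    by (rule solution_regularity_bounds[OF T sol Cu Cp Cf]) (rule that)
  have space: "u t \<in> V_div \<Omega>" "p t \<in> Q_space \<Omega>" if "t \<in> {0..T}" for t
    using sol that by (auto simp: nonstationary_solution_def)
  have C_time_H: "w t \<in> H_space \<Omega> m" if "C_time \<Omega> T k m w" "t \<in> {0..T}"
    for w :: "real \<Rightarrow> real^'d \<Rightarrow> 'b::euclidean_space" and k m t
    using that unfolding C_time_def by blast
  have uH: "u t \<in> H_space \<Omega> (r + 1)" and pH: "p t \<in> H_space \<Omega> r" and fL: "f t \<in> L2 \<Omega>" if "t \<in> {0..T}" for t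
    using H_space_mono[OF C_time_H[OF Cu that], of "r + 1"] H_space_mono[OF C_time_H[OF Cp that], of r]
      H_space_L2[OF C_time_H[OF Cf that]] by auto
  let ?K = "real CARD('d)"
  define c1 where "c1 = P * (1 + mixed_method.stab (\<beta> / 2) ?K) * (2 * \<bar>C\<bar> * M) + M"
  define c2 where "c2 = (1 + (mixed_method.stab (\<beta> / 2) ?K + 1 + ?K) / (\<beta> / 2)) * (2 * \<bar>C\<bar> * M) + M"
  define c where "c = 4 * c2\<^sup>2 * T + 6 * (2 + T) / (\<beta> / 2)\<^sup>2 * (1 + 2 * T * c1\<^sup>2)"
  have "0 < 6 * (2 + T) / (\<beta> / 2)\<^sup>2 * (1 + 2 * T * c1\<^sup>2)"
    using T \<beta> by (intro mult_pos_pos divide_pos_pos add_pos_nonneg) auto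
  moreover have "0 \<le> 4 * c2\<^sup>2 * T" using T by simp
  ultimately have "c > 0" unfolding c_def by linarith
  moreover have "(\<Sum>m=1..n. step t m * (L2_norm \<Omega> (\<lambda>x. p (midpt t m) x - p\<^sub>h (midpt t m) x))\<^sup>2)
          \<le> c * ((L2_norm \<Omega> (Jacobian \<Omega> (\<lambda>x. u_hat \<Omega> \<D> t u p 0 x - u\<^sub>h 0 x)))\<^sup>2
                 + max_step N t ^ 4 + mesh_size \<D> ^ (2 * r))"
    if D: "\<D> \<in> \<F>" and tm: "time_mesh T N t" and u0: "u\<^sub>0\<^sub>h \<in> V_h_div \<Omega> \<D>"
      and sch: "scheme_solution \<Omega> \<D> N t f u\<^sub>0\<^sub>h u\<^sub>h p\<^sub>h" and n: "n \<in> {1..N}"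
    for \<D> N t u\<^sub>0\<^sub>h u\<^sub>h p\<^sub>h n
    unfolding c_def c1_def c2_def
    by (rule pressure_error_bound[OF mixed_method_finite_elements[OF mesh[OF D] loc[OF D] isc[OF D] \<beta> P] refl P(2)
          loc[OF D] app[OF D] mesh_size_pos[OF mesh[OF D] sr[OF D] \<Omega>] M(1) fL space(1) uH M(2,4) space(2) pH M(3,5-8)
          tm u0 sch n])
  ultimately show "\<exists>C>0. \<forall>\<D>\<in>\<F>. \<forall>N t u\<^sub>0\<^sub>h u\<^sub>h p\<^sub>h.
       time_mesh T N t \<and> u\<^sub>0\<^sub>h \<in> V_h_div \<Omega> \<D> \<and> scheme_solution \<Omega> \<D> N t f u\<^sub>0\<^sub>h u\<^sub>h p\<^sub>h \<longrightarrow>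
       (\<forall>n\<in>{1..N}.
          (\<Sum>m=1..n. step t m * (L2_norm \<Omega> (\<lambda>x. p (midpt t m) x - p\<^sub>h (midpt t m) x))\<^sup>2)
          \<le> C * ((L2_norm \<Omega> (Jacobian \<Omega> (\<lambda>x. u_hat \<Omega> \<D> t u p 0 x - u\<^sub>h 0 x)))\<^sup>2
                 + max_step N t ^ 4 + mesh_size \<D> ^ (2 * r)))"
    by blast
qed

end
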